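(* Let $b\in\mathbb{R}$, let $\mu$ be a Borel measure on $(0,\infty)$ such that $\bar\mu(x)<\infty$ for all $x>0$, and let $M$ be an $\mathrm{ESN}(b,\mu)$ process, with laws $(\mathbb{P}_x)_{x\ge 0}$. (1) Let $n\ge 1$ and $0=s_0<s_1<s_2<\cdots<s_n$. For any $u_1,\dots,u_n\in[0,\infty)$, $$\mathbb{P}_0(M(s_1)\le u_1,\dots,M(s_n)\le u_n)=\exp\left(-\sum_{i=1}^n\int_{s_{i-1}}^{s_i}\bar\mu\Big(\bigwedge_{j=i}^{n}\big(u_j+b(s_j-t)\big)\Big)\,dt\right)\prod_{i=1}^n \mathbf{1}_{\{u_i\ge(-bs_i)_+\}}.$$ In particular the one-dimensional law at time $s$ has the following cumulative distribution function: for any $u\in\mathbb{R}$, $$F^0_s(u):=\mathbb{P}_0(M(s)\le u)=\exp\left(-\int_0^s\bar\mu(u+b(s-t))\,dt\right)\mathbf{1}_{\{u\ge(-bs)_+\}},$$ and, if $b\ne 0$, $$F^0_s(u)=\exp\left(-\frac1b\int_u^{u+bs}\bar\mu(y)\,dy\right)\mathbf{1}_{\{u\ge(-bs)_+\}}.$$ (2) Let $x\in[0,\infty)$ and $t\ge 0$. For any $u\in\mathbb{R}$, $$F^x_t(u):=\mathbb{P}_x(M(t)\le u)=F^0_t(u)\,\mathbf{1}_{\{u\ge(x-bt)_+\}}.$$ (3) The process $M$ is a Markov process with the Feller property, i.e. its semigroup $(P_t)$ satisfies: (a) $P_tC_0([0,\infty))\subset C_0([0,\infty))$; (b) for any $f\in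 C_0([0,\infty))$, $P_tf\to f$ uniformly as $t\to0$. (4) Assume $b\ge 0$. The following equivalence holds: for all $s>0$, $\mathbb{P}_0(M(s)=0)>0$ if and only if $\int_0^1\bar\mu(v)\,dv<\infty$. Moreover, in this case the Lebesgue measure of the zero set of $M$, $\mathcal{Z}:=\{t>0: M(t)=0\}$, is strictly positive a.s. (and the boundary $0$ is said to be sticky). (5) Assume $b>0$. When $\int_1^\infty\bar\mu(u)\,du=\infty$, $M(s)\to\infty$ in $\mathbb{P}_x$-probability as $s\to\infty$, for all $x\ge0$. When $\int_1^\infty\bar\mu(u)\,du<\infty$, the process $M$ admits a non-degenerate stationary distribution $\pi$ whose cumulative distribution function is given by $$\pi([0,u])=\exp\left(-\frac1b\int_u^\infty\bar\mu(v)\,dv\right)\quad\text{for any }u\ge0.$$ Moreover, when $\int_1^\infty\bar\mu(u)\,du<\infty$, for all $x\ge0$ the probability measure $\mathbb{P}_x(M(t)\in\cdot)$ converges in total variation distance towards $\pi$. Furthermore, for all $t>x/b$, $$d_{\mathrm{TV}}\big(\mathbb{P}_x(M(t)\in\cdot),\pi(\cdot)\big)\le\frac1b\int_{bt}^\infty\bar\mu(u)\,du,$$ where $d_{\mathrm{TV}}$ denotes the total variation distance.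
   Context: Write $(a)_+=\max(a,0)$, $x\vee y=\max(x,y)$ and $x\wedge y=\min(x,y)$. For a Borel measure $\mu$ on $(0,\infty)$, its tail is $\bar\mu(x):=\mu([x,\infty))$ (so $\bar\mu(x)=\mu((0,\infty))$, possibly infinite, if $x\le 0$). Extremal shot noise process $\mathrm{ESN}(b,\mu)$: let $\mathcal{N}=\sum_{s\ge0}\delta_{(s,\xi_s)}$ be a Poisson point process on $[0,\infty)\times(0,\infty)$ with intensity $\lambda\times\mu$, $\lambda$ being Lebesgue measure (times $s$ carrying no atom are given $\xi_s=0$). The standard $\mathrm{ESN}(b,\mu)$ process, started from $0$, is $$M^0(t):=\sup_{0\le s\le t}\big(\xi_s-b(t-s)\big)_+,\qquad t\ge0,$$ so that $M^0(t)\ge(-bt)_+$. The $\mathrm{ESN}(b,\mu)$ process started from $x\ge0$ is obtained by adjoining a point $(0,x)$ to $\mathcal{N}$, i.e. $M^x(t)=(x-bt)_+\vee M^0(t)$, $t\ge 0$. The law of $M^x$ is denoted $\mathbb{P}_x$ (with expectation $\mathbb{E}_x$), and $M$ denotes the process under these laws; it takes values in $[0,\infty)$ and has càdlàg paths. Its semigroup is $P_tf(x)=\mathbb{E}_x[f(M(t))]$. $C_0([0,\infty))$ is the space of continuous functions on $[0,\infty)$ vanishing at $\infty$.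
   Formalization: For b=0, (1) uses the closed tail μ([x,∞)) only if no u_i is an atom of μ, and μ((x,∞)) in general; for b=0, (4) also requires μ((0,∞))<∞; in (5) π is claimed not to be a point mass only if μ≠0. The printed claims fail in these cases. *)

theory Defs
  imports "HOL-Probability.Probability"
begin

text \<open>
  Borel measures on (0,\<infinity>) are measures on \<^term>\<open>restrict_space borel {0<..}\<close>, and the state
  space [0,\<infinity>) carries its Borel sets.
\<close>

abbreviation pos_halfline :: "real measure" where
  "pos_halfline \<equiv> restrict_space borel {0<..}"

abbreviation state_space :: "real measure" where
  "state_space \<equiv> restrict_space borel {0..}"

definition tail :: "real measure \<Rightarrow> real \<Rightarrow> ennreal" where
  "tail \<mu> x = emeasure \<mu> ({0<..} \<inter> {x..})"

text \<open>
  The strict tail differs from \<^const>\<open>tail\<close> only at the atoms of the measure.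
\<close>

definition strict_tail :: "real measure \<Rightarrow> real \<Rightarrow> ennreal" where
  "strict_tail \<mu> x = emeasure \<mu> ({0<..} \<inter> {x<..})"

text \<open>The number exp(-a), with the convention exp(-\<infinity>) = 0.\<close>

definition exp_minus :: "ennreal \<Rightarrow> real" where
  "exp_minus a = (if a = \<infinity> then 0 else exp (- enn2real a))"

text \<open>
  A (simple) point process is represented by its random set of atoms \<^term>\<open>N \<omega>\<close>; the random
  measure it stands for is the counting measure of that set.
\<close>

definition num_points :: "('w \<Rightarrow> 'a set) \<Rightarrow> 'a set \<Rightarrow> 'w \<Rightarrow> ennreal" where
  "num_points N A \<omega> = emeasure (count_space UNIV) (N \<omega> \<inter> A)"

definition poisson_point_process :: "'w measure \<Rightarrow> ('w \<Rightarrow> 'a set) \<Rightarrow> 'a measure \<Rightarrow> bool" where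
  "poisson_point_process P N \<Lambda> \<longleftrightarrow>
     prob_space P \<and>
     (\<forall>\<omega>\<in>space P. N \<omega> \<subseteq> space \<Lambda>) \<and>
     (\<forall>A\<in>sets \<Lambda>. num_points N A \<in> borel_measurable P) \<and>
     (\<forall>A\<in>sets \<Lambda>. emeasure \<Lambda> A < \<infinity> \<longrightarrow>
        (\<forall>k::nat. \<P>(\<omega> in P. num_points N A \<omega> = of_nat k)
                   = measure \<Lambda> A ^ k / fact k * exp (- measure \<Lambda> A))) \<and>
     (\<forall>A\<in>sets \<Lambda>. emeasure \<Lambda> A = \<infinity> \<longrightarrow> (AE \<omega> in P. num_points N A \<omega> = \<infinity>)) \<and>
     (\<forall>(m::nat) A. (\<forall>i<m. A i \<in> sets \<Lambda>) \<and> disjoint_family_on A {..<m} \<longrightarrow>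
        prob_space.indep_vars P (\<lambda>_. borel) (\<lambda>i. num_points N (A i)) {..<m})"

text \<open>
  \<^term>\<open>\<xi> s \<omega>\<close> is the mark at time \<^term>\<open>s\<close>, with value 0 when \<^term>\<open>s\<close> carries no atom.
\<close>

definition poisson_marks :: "'w measure \<Rightarrow> (real \<Rightarrow> 'w \<Rightarrow> real) \<Rightarrow> real measure \<Rightarrow> bool" where
  "poisson_marks P \<xi> \<mu> \<longleftrightarrow>
     (\<forall>\<omega>\<in>space P. \<forall>s\<ge>0. 0 \<le> \<xi> s \<omega>) \<and>
     poisson_point_process P (\<lambda>\<omega>. {(s, \<xi> s \<omega>) | s. 0 \<le> s \<and> 0 < \<xi> s \<omega>})
       (restrict_space lborel {0..} \<Otimes>\<^sub>M \<mu>)"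

text \<open>
  The supremum is that of a bounded set for all times simultaneously, almost surely, as soon as
  the tail of the intensity is finite on (0,\<infinity>). On the exceptional null event the real
  supremum is an unspecified constant. The paths of \<open>esn\<close> are nonnegative everywhere.
\<close>

definition esn0 :: "(real \<Rightarrow> 'w \<Rightarrow> real) \<Rightarrow> real \<Rightarrow> real \<Rightarrow> 'w \<Rightarrow> real" where
  "esn0 \<xi> b t \<omega> = (SUP s\<in>{0..t}. max 0 (\<xi> s \<omega> - b * (t - s)))"

definition esn :: "(real \<Rightarrow> 'w \<Rightarrow> real) \<Rightarrow> real \<Rightarrow> real \<Rightarrow> real \<Rightarrow> 'w \<Rightarrow> real" where
  "esn \<xi> b x t \<omega> = max (max 0 (x - b * t)) (esn0 \<xi> b t \<omega>)"

text \<open>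
  Below \<^term>\<open>X x t \<omega>\<close> is a family of [0,\<infinity>)-valued processes on one probability space, indexed by
  the starting point \<^term>\<open>x\<close>; the law of \<^term>\<open>X x\<close> under \<^term>\<open>P\<close> plays the role of
  \<open>\<P>\<^sub>x\<close>.
\<close>

definition law_at :: "'w measure \<Rightarrow> (real \<Rightarrow> real \<Rightarrow> 'w \<Rightarrow> real) \<Rightarrow> real \<Rightarrow> real \<Rightarrow> real measure" where
  "law_at P X x t = distr P state_space (X x t)"

definition transition_op ::
    "'w measure \<Rightarrow> (real \<Rightarrow> real \<Rightarrow> 'w \<Rightarrow> real) \<Rightarrow> real \<Rightarrow> (real \<Rightarrow> real) \<Rightarrow> real \<Rightarrow> real" where
  "transition_op P X t f x = (\<integral>\<omega>. f (X x t \<omega>) \<partial>P)"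

definition natural_filtration :: "'w measure \<Rightarrow> (real \<Rightarrow> 'w \<Rightarrow> real) \<Rightarrow> real \<Rightarrow> 'w measure" where
  "natural_filtration P Y s =
     sigma (space P) {Y r -` B \<inter> space P | r B. 0 \<le> r \<and> r \<le> s \<and> B \<in> sets borel}"

definition bounded_borel :: "(real \<Rightarrow> real) set" where
  "bounded_borel = {f. f \<in> borel_measurable state_space \<and> bounded (f ` {0..})}"

text \<open>
  Time-homogeneous Markov property for the natural filtrations, the transition operators forming
  a semigroup on bounded Borel functions on [0,\<infinity>). As functions on [0,\<infinity>) are
  represented by functions on the reals, equalities are only required on [0,\<infinity>).
\<close>

definition markov_process :: "'w measure \<Rightarrow> (real \<Rightarrow> real \<Rightarrow> 'w \<Rightarrow> real) \<Rightarrow> bool" where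
  "markov_process P X \<longleftrightarrow>
     (\<forall>x\<ge>0. \<forall>t\<ge>0. X x t \<in> measurable P state_space) \<and>
     (\<forall>f\<in>bounded_borel.
        (\<forall>t\<ge>0. transition_op P X t f \<in> borel_measurable state_space) \<and>
        (\<forall>x\<ge>0. transition_op P X 0 f x = f x) \<and>
        (\<forall>s\<ge>0. \<forall>t\<ge>0. \<forall>x\<ge>0.
           transition_op P X (s + t) f x = transition_op P X s (transition_op P X t f) x) \<and>
        (\<forall>x\<ge>0. \<forall>s\<ge>0. \<forall>t\<ge>0. AE \<omega> in P.
           real_cond_exp P (natural_filtration P (X x) s) (\<lambda>\<omega>'. f (X x (s + t) \<omega>')) \<omega>
             = transition_op P X t f (X x s \<omega>)))"

text \<open>Continuous functions on [0,\<infinity>) vanishing at \<infinity>.\<close>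

definition C0 :: "(real \<Rightarrow> real) set" where
  "C0 = {f. continuous_on {0..} f \<and> (f \<longlongrightarrow> 0) at_top}"

definition stationary_distribution ::
    "'w measure \<Rightarrow> (real \<Rightarrow> real \<Rightarrow> 'w \<Rightarrow> real) \<Rightarrow> real measure \<Rightarrow> bool" where
  "stationary_distribution P X p \<longleftrightarrow>
     prob_space p \<and> sets p = sets state_space \<and>
     (\<forall>t\<ge>0. \<forall>A\<in>sets state_space. (\<integral>\<^sup>+x. emeasure (law_at P X x t) A \<partial>p) = emeasure p A)"

definition d_TV :: "'a measure \<Rightarrow> 'a measure \<Rightarrow> real" where
  "d_TV p q = (SUP A\<in>sets p. \<bar>measure p A - measure q A\<bar>)"

end

theory Submission
  imports Defs
begin

text \<open>
The marks form a Poisson process, and the only probabilistic input is the void probability: a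
measurable set of intensity \<open>m\<close> contains no point with probability \<open>exp (- m)\<close>. All random
variables in question are suprema of shots minus a gauge,
\<open>shot_sup \<xi> I g = (SUP r\<in>I. max 0 (\<xi> r - g r))\<close>: the process at time \<open>t\<close> is the case
\<open>I = {0..t}\<close>, \<open>g r = b * (t - r)\<close>. Such a supremum is at most \<open>u\<close> precisely when no point of
the process lies above the graph of \<open>u + g\<close>, apart from a deterministic condition coming from
the times that carry no point (\<open>AE_shot_sup_le_iff\<close>). Joint distribution functions are
therefore void probabilities of unions of such regions (\<open>prob_shot_sups_le\<close>). Slicing the
union in time gives the finite-dimensional laws (\<open>prob_esn0_finite_dimensional\<close>); a slice is a
ray, whose mass is a strict tail, and the closed tail may replace it because the boundary of
the region meets the countably many atoms of \<open>\<mu>\<close> for only countably many times when \<open>b \<noteq> 0\<close>.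

For the Markov property, splitting the supremum at time \<open>s\<close> expresses \<open>M (s + t)\<close> through
\<open>M s\<close> and the supremum of the later shots (\<open>AE_esn_flow\<close>). Events of the past and of the later
shots are void events of regions on the two sides of time \<open>s\<close>, so that their intensities add
and their probabilities multiply (\<open>indep_set_past_later_shots\<close>); by translation invariance the
later shots have the law of the process started afresh (\<open>distr_later_shots\<close>). The Feller
property follows from the explicit dependence of \<open>M\<close> on the starting point and from the
convergence of \<open>M 0 t\<close> to \<open>0\<close> in probability.

For \<open>b \<ge> 0\<close> and fixed \<open>t\<close>, reversing time replaces the gauge \<open>b * (t - r)\<close> by \<open>b * r\<close>, without
changing the law (\<open>distr_rev_shots\<close>). The reversed suprema over \<open>{0..t}\<close> increase with \<open>t\<close>, and
when \<open>b > 0\<close> and the tail is integrable at infinity the stationary law is the law of their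
limit, the supremum over \<open>{0..}\<close>. The two suprema agree unless a point after time \<open>t\<close> lies above
the line \<open>b * r\<close>, which has probability at most
\<open>(\<integral>\<^sup>+v\<in>{b * t..}. tail \<mu> v \<partial>lborel) / ennreal b\<close>. This coupling is the
total variation estimate.

The zero set is handled by Fubini: the expected length of the zeros before time \<open>e\<close> is the
integral of \<open>prob {M 0 t = 0}\<close>, which is close to \<open>e\<close> since this probability tends to \<open>1\<close>. Hence the
zeros before time \<open>e\<close> have positive length with probability close to \<open>1\<close>
(\<open>AE_zero_set_positive\<close>). Joint measurability comes from a description of the zeros by rational
times (\<open>AE_zero_iff_not_covered\<close>).
\<close>

section \<open>Exponentials of extended numbers, monotone functions and suprema\<close>

lemma exp_minus_zero [simp]: "exp_minus 0 = 1"
  by (simp add: exp_minus_def)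

lemma exp_minus_top [simp]: "exp_minus \<top> = 0"
  by (simp add: exp_minus_def)

lemma exp_minus_nonneg [simp]: "0 \<le> exp_minus a"
  by (simp add: exp_minus_def)

lemma exp_minus_le_1 [simp]: "exp_minus a \<le> 1"
  by (simp add: exp_minus_def)

lemma exp_minus_pos_iff: "0 < exp_minus a \<longleftrightarrow> a < \<top>"
  by (simp add: exp_minus_def less_top)

lemma exp_minus_add: "exp_minus (a + c) = exp_minus a * exp_minus c"
  by (cases a; cases c)
     (simp_all add: exp_minus_def exp_add[symmetric] ennreal_plus[symmetric] add.commute
        del: ennreal_plus)

lemma exp_minus_antimono: "a \<le> c \<Longrightarrow> exp_minus c \<le> exp_minus a"
  by (cases a; cases c) (auto simp: exp_minus_def top_unique)

lemma exp_minus_ge: "1 - exp_minus a \<le> enn2real a" if "a < \<top>"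
  using that exp_ge_add_one_self[of "- enn2real a"] by (simp add: exp_minus_def)

lemma exp_minus_ge_ennreal: "ennreal (1 - exp_minus a) \<le> a"
proof (cases "a = \<top>")
  case False
  then have "a < \<top>" by (simp add: less_top)
  from exp_minus_ge[OF this] this show ?thesis
    by (metis ennreal_enn2real ennreal_leI)
qed simp

lemma exp_minus_tendsto_1:
  assumes "(a \<longlongrightarrow> 0) F"
  shows "((\<lambda>x. exp_minus (a x)) \<longlongrightarrow> 1) F"
proof -
  have fin: "eventually (\<lambda>x. a x < \<top>) F"
    using order_tendstoD(2)[OF assms, of \<top>] by simp
  have "((\<lambda>x. enn2real (a x)) \<longlongrightarrow> 0) F"
    by (rule tendsto_enn2real) (use assms in simp_all)
  from tendsto_diff[OF tendsto_const[of "1::real"] this]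
  have lim: "((\<lambda>x. 1 - enn2real (a x)) \<longlongrightarrow> 1) F"
    by simp
  have low: "eventually (\<lambda>x. 1 - enn2real (a x) \<le> exp_minus (a x)) F"
    using fin
  proof eventually_elim
    case (elim x)
    from exp_minus_ge[OF this] show ?case by linarith
  qed
  have up: "eventually (\<lambda>x. exp_minus (a x) \<le> 1) F"
    by (simp add: always_eventually)
  show ?thesis
    by (rule tendsto_sandwich[OF low up lim tendsto_const])
qed

lemma exp_minus_tendsto_0:
  assumes "(a \<longlongrightarrow> \<top>) F"
  shows "((\<lambda>x. exp_minus (a x)) \<longlongrightarrow> 0) F"
proof (rule order_tendstoI)
  fix c :: real assume "c > 0"
  define K where "K = max 0 (- ln c) + 1"
  have "eventually (\<lambda>x. a x > ennreal K) F"
    using order_tendstoD(1)[OF assms] by simp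
  then show "eventually (\<lambda>x. exp_minus (a x) < c) F"
  proof eventually_elim
    case (elim x)
    have "exp_minus (a x) \<le> exp_minus (ennreal K)"
      using elim by (intro exp_minus_antimono) simp
    also have "\<dots> = exp (- K)"
    proof -
      have "0 \<le> K" by (simp add: K_def)
      then show ?thesis by (simp add: exp_minus_def)
    qed
    also have "\<dots> < exp (ln c)" unfolding K_def exp_less_cancel_iff by linarith
    also have "\<dots> = c" using \<open>c > 0\<close> by simp
    finally show ?case .
  qed
qed (auto intro!: always_eventually less_le_trans[OF _ exp_minus_nonneg])

lemma antimono_imp_borel:
  fixes f :: "real \<Rightarrow> ennreal"
  assumes "\<And>x y. x \<le> y \<Longrightarrow> f y \<le> f x"
  shows "f \<in> borel_measurable borel"
proof -
  have "{x. a < f x} \<in> sets borel" for a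
  proof -
    have "is_interval {x. a < f x}"
      unfolding is_interval_1 using assms less_le_trans by blast
    then show ?thesis by (simp add: is_interval_convex_1 real_interval_borel_measurable)
  qed
  then show ?thesis by (intro borel_measurableI_greater) simp
qed

text \<open>
An unbounded set has no upper bound, so its supremum is the least element of an empty set: some
unspecified number, but always the same one. This is what makes suprema of shots measurable on
the exceptional event where they are infinite.
\<close>

lemma Sup_real_unbounded:
  fixes A B :: "real set"
  assumes "\<not> bdd_above A" "\<not> bdd_above B"
  shows "Sup A = Sup B"
proof -
  have "(\<lambda>z. \<forall>x\<in>A. x \<le> z) = (\<lambda>z. \<forall>x\<in>B. x \<le> z)"
    using assms by (auto simp: bdd_above_def fun_eq_iff)
  then show ?thesis by (simp add: Sup_real_def)
qed

text \<open>
The value \<open>g r\<close> is the amount lost, at the time of observation, by a shot fired at time \<open>r\<close>.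
\<close>

definition shot_sup :: "(real \<Rightarrow> 'w \<Rightarrow> real) \<Rightarrow> real set \<Rightarrow> (real \<Rightarrow> real) \<Rightarrow> 'w \<Rightarrow> real" where
  "shot_sup \<xi> I g \<omega> = (SUP r\<in>I. max 0 (\<xi> r \<omega> - g r))"

lemma esn0_eq_shot_sup: "esn0 \<xi> b t = shot_sup \<xi> {0..t} (\<lambda>r. b * (t - r))"
  by (simp add: esn0_def shot_sup_def fun_eq_iff)

section \<open>The Poisson process of shots\<close>

locale extremal_shot_noise =
  fixes P :: "'w measure" and \<xi> :: "real \<Rightarrow> 'w \<Rightarrow> real" and b :: real and \<mu> :: "real measure"
  assumes sets_mu: "sets \<mu> = sets pos_halfline"
    and tail_finite: "\<And>x. x > 0 \<Longrightarrow> tail \<mu> x < \<infinity>"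
    and marks: "poisson_marks P \<xi> \<mu>"
begin

definition \<Lambda> :: "(real \<times> real) measure" where
  "\<Lambda> = restrict_space lborel {0..} \<Otimes>\<^sub>M \<mu>"

definition pts :: "'w \<Rightarrow> (real \<times> real) set" where
  "pts \<omega> = {(s, \<xi> s \<omega>) | s. 0 \<le> s \<and> 0 < \<xi> s \<omega>}"

definition avoids :: "(real \<times> real) set \<Rightarrow> 'w \<Rightarrow> bool" where
  "avoids A \<omega> \<longleftrightarrow> pts \<omega> \<inter> A = {}"

lemma ppp: "poisson_point_process P pts \<Lambda>"
  using marks unfolding poisson_marks_def \<Lambda>_def pts_def[abs_def] by simp

lemma mark_nonneg: "\<omega> \<in> space P \<Longrightarrow> 0 \<le> s \<Longrightarrow> 0 \<le> \<xi> s \<omega>"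
  using marks unfolding poisson_marks_def by auto

end

sublocale extremal_shot_noise \<subseteq> prob_space P
  using ppp unfolding poisson_point_process_def by simp

context extremal_shot_noise
begin

lemma space_mu: "space \<mu> = {0<..}"
  using sets_eq_imp_space_eq[OF sets_mu] by (simp add: space_restrict_space)

lemma Int_pos_in_sets_mu: "A \<in> sets borel \<Longrightarrow> {0<..} \<inter> A \<in> sets \<mu>"
  unfolding sets_mu by (auto simp: sets_restrict_space)

lemma tail_mono: "x \<le> y \<Longrightarrow> tail \<mu> y \<le> tail \<mu> x"
  unfolding tail_def by (intro emeasure_mono Int_pos_in_sets_mu) auto

lemma strict_tail_mono: "x \<le> y \<Longrightarrow> strict_tail \<mu> y \<le> strict_tail \<mu> x"
  unfolding strict_tail_def by (intro emeasure_mono Int_pos_in_sets_mu) auto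

lemma strict_tail_le_tail: "strict_tail \<mu> x \<le> tail \<mu> x"
  unfolding strict_tail_def tail_def by (intro emeasure_mono Int_pos_in_sets_mu) auto

lemma tail_borel [measurable]: "tail \<mu> \<in> borel_measurable borel"
  by (rule antimono_imp_borel) (rule tail_mono)

lemma strict_tail_borel [measurable]: "strict_tail \<mu> \<in> borel_measurable borel"
  by (rule antimono_imp_borel) (rule strict_tail_mono)

lemma sigma_finite_mu: "sigma_finite_measure \<mu>"
proof
  let ?A = "(\<lambda>n::nat. {0<..} \<inter> {1 / (1 + real n)..}) ` UNIV"
  have "\<exists>n::nat. 1 / (1 + real n) \<le> x" if "0 < x" for x :: real
  proof -
    from that obtain n :: nat where "inverse (real (Suc n)) < x"
      by (metis reals_Archimedean)
    then show ?thesis by (intro exI[of _ n]) (simp add: field_simps)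
  qed
  then have "\<Union>?A = space \<mu>" by (auto simp: space_mu)
  moreover have "\<forall>a\<in>?A. emeasure \<mu> a \<noteq> \<infinity>"
    using tail_finite by (auto simp: tail_def less_top)
  ultimately show "\<exists>A. countable A \<and> A \<subseteq> sets \<mu> \<and> \<Union>A = space \<mu> \<and> (\<forall>a\<in>A. emeasure \<mu> a \<noteq> \<infinity>)"
    by (intro exI[of _ ?A]) (auto intro!: Int_pos_in_sets_mu)
qed

lemma space_Lambda: "space \<Lambda> = {0..} \<times> {0<..}"
  by (simp add: \<Lambda>_def space_pair_measure space_mu space_restrict_space)

lemma fst_Lambda [measurable]: "fst \<in> borel_measurable \<Lambda>"
proof -
  have "(\<lambda>x. x) \<in> restrict_space lborel {0..} \<rightarrow>\<^sub>M (borel :: real measure)"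
    by (rule measurable_restrict_space1) simp
  from measurable_compose[OF measurable_fst this] show ?thesis by (simp add: \<Lambda>_def)
qed

lemma snd_Lambda [measurable]: "snd \<in> borel_measurable \<Lambda>"
proof -
  have "(\<lambda>x. x) \<in> \<mu> \<rightarrow>\<^sub>M (borel :: real measure)"
    unfolding measurable_cong_sets[OF sets_mu refl] by (rule measurable_restrict_space1) simp
  from measurable_compose[OF measurable_snd this] show ?thesis by (simp add: \<Lambda>_def)
qed

lemma emeasure_Lambda:
  assumes "A \<in> sets \<Lambda>"
  shows "emeasure \<Lambda> A = (\<integral>\<^sup>+r\<in>{0..}. emeasure \<mu> (Pair r -` A) \<partial>lborel)"
proof -
  interpret sigma_finite_measure \<mu> by (rule sigma_finite_mu)
  have "emeasure \<Lambda> A = (\<integral>\<^sup>+r. emeasure \<mu> (Pair r -` A) \<partial>restrict_space lborel {0..})"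
    using assms unfolding \<Lambda>_def by (rule emeasure_pair_measure_alt)
  then show ?thesis by (simp add: nn_integral_restrict_space)
qed

lemma avoids_iff_num_points: "avoids A \<omega> \<longleftrightarrow> num_points pts A \<omega> = 0"
  by (simp add: avoids_def num_points_def emeasure_count_space_eq_0)

lemma avoids_sets [measurable]:
  assumes "A \<in> sets \<Lambda>"
  shows "{\<omega>\<in>space P. avoids A \<omega>} \<in> sets P"
proof -
  have [measurable]: "num_points pts A \<in> borel_measurable P"
    using ppp assms unfolding poisson_point_process_def by simp
  show ?thesis unfolding avoids_iff_num_points by measurable
qed

text \<open>
The only property of the Poisson process on which the laws below rest. Independence over
disjoint sets is recovered from it, as intensities of disjoint sets add up.
\<close>

lemma prob_avoids:
  assumes A: "A \<in> sets \<Lambda>"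
  shows "\<P>(\<omega> in P. avoids A \<omega>) = exp_minus (emeasure \<Lambda> A)"
proof (cases "emeasure \<Lambda> A = \<infinity>")
  case False
  then have *: "emeasure \<Lambda> A < \<infinity>" by (simp add: less_top)
  then have "\<forall>k::nat. \<P>(\<omega> in P. num_points pts A \<omega> = of_nat k)
                   = measure \<Lambda> A ^ k / fact k * exp (- measure \<Lambda> A)"
    using ppp A unfolding poisson_point_process_def by simp
  from spec[OF this, of 0] have "\<P>(\<omega> in P. num_points pts A \<omega> = 0) = exp (- measure \<Lambda> A)"
    by simp
  then show ?thesis using * by (simp add: avoids_iff_num_points exp_minus_def measure_def)
next
  case True
  then have "AE \<omega> in P. num_points pts A \<omega> = \<infinity>"
    using ppp A unfolding poisson_point_process_def by simp
  then have "AE \<omega> in P. \<not> avoids A \<omega>" by eventually_elim (simp add: avoids_iff_num_points)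
  then have "\<P>(\<omega> in P. avoids A \<omega>) = 0"
    using prob_eq_0[OF avoids_sets[OF A]] by simp
  then show ?thesis using True by simp
qed

text \<open>
The Poisson weights of the finite values sum to \<open>1\<close>.
\<close>

lemma AE_finite_pts:
  assumes A: "A \<in> sets \<Lambda>" and fin: "emeasure \<Lambda> A < \<infinity>"
  shows "AE \<omega> in P. finite (pts \<omega> \<inter> A)"
proof -
  define E where "E k = {\<omega>\<in>space P. num_points pts A \<omega> = of_nat k}" for k
  have [measurable]: "num_points pts A \<in> borel_measurable P"
    using ppp A unfolding poisson_point_process_def by simp
  have E: "E k \<in> sets P" for k unfolding E_def by measurable
  have pE: "prob (E k) = measure \<Lambda> A ^ k / fact k * exp (- measure \<Lambda> A)" for k
    using ppp A fin unfolding poisson_point_process_def E_def by simp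
  have disj: "disjoint_family E"
    by (auto simp: disjoint_family_on_def E_def)
  have "(\<lambda>k. prob (E k)) sums prob (\<Union>k. E k)"
    using E disj by (intro finite_measure_UNION) auto
  moreover have "(\<lambda>k. prob (E k)) sums (exp (measure \<Lambda> A) * exp (- measure \<Lambda> A))"
    unfolding pE using sums_mult2[OF exp_converges[of "measure \<Lambda> A"], of "exp (- measure \<Lambda> A)"]
    by (simp add: divide_inverse mult_ac)
  ultimately have "prob (\<Union>k. E k) = 1"
    by (simp add: sums_unique2 exp_minus_inverse)
  then have "AE \<omega> in P. \<omega> \<in> (\<Union>k. E k)"
    using E by (subst (asm) prob_eq_1) auto
  then show ?thesis
  proof eventually_elim
    case (elim \<omega>)
    then have "emeasure (count_space UNIV) (pts \<omega> \<inter> A) \<noteq> \<infinity>"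
      by (auto simp: E_def num_points_def)
    then show ?case by (metis emeasure_count_space_infinite subset_UNIV)
  qed
qed

end

section \<open>Suprema of shots measured against a gauge\<close>

context extremal_shot_noise
begin

definition epi :: "real set \<Rightarrow> (real \<Rightarrow> real) \<Rightarrow> real \<Rightarrow> (real \<times> real) set" where
  "epi I g u = {z\<in>space \<Lambda>. fst z \<in> I \<and> u + g (fst z) < snd z}"

text \<open>
Conditions under which the supremum over \<open>I\<close> is almost surely finite: the lower bound on \<open>g\<close>
takes care of the times without a point, the finite intensity above some level of the others.
\<close>

definition gauge_on :: "real set \<Rightarrow> (real \<Rightarrow> real) \<Rightarrow> bool" where
  "gauge_on I g \<longleftrightarrow> I \<in> sets borel \<and> I \<noteq> {} \<and> I \<subseteq> {0..} \<and> g \<in> borel_measurable borel \<and>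
     (\<exists>C. \<forall>r\<in>I. - C \<le> g r) \<and> (\<exists>K. emeasure \<Lambda> (epi I g K) < \<infinity>)"

text \<open>
A time \<open>r\<close> without a point still contributes \<open>max 0 (- g r)\<close> to the supremum, so that the
supremum never falls below these values.
\<close>

definition above_floor :: "real set \<Rightarrow> (real \<Rightarrow> real) \<Rightarrow> real \<Rightarrow> bool" where
  "above_floor I g u \<longleftrightarrow> 0 \<le> u \<and> (\<forall>r\<in>I. - g r \<le> u)"

definition bounded_shots :: "real set \<Rightarrow> (real \<Rightarrow> real) \<Rightarrow> 'w \<Rightarrow> bool" where
  "bounded_shots I g \<omega> \<longleftrightarrow> bdd_above ((\<lambda>r. max 0 (\<xi> r \<omega> - g r)) ` I)"

lemma epi_sets [measurable]:
  assumes [measurable]: "I \<in> sets borel" "g \<in> borel_measurable borel"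
  shows "epi I g u \<in> sets \<Lambda>"
  unfolding epi_def by measurable

lemma emeasure_epi:
  assumes "I \<in> sets borel" "g \<in> borel_measurable borel" "I \<subseteq> {0..}"
  shows "emeasure \<Lambda> (epi I g u) = (\<integral>\<^sup>+r\<in>I. strict_tail \<mu> (u + g r) \<partial>lborel)"
proof -
  have "Pair r -` epi I g u = (if r \<in> I then {0<..} \<inter> {u + g r<..} else {})" for r
    using assms(3) by (auto simp: epi_def space_Lambda)
  then show ?thesis
    unfolding emeasure_Lambda[OF epi_sets[OF assms(1,2)]] using assms(3)
    by (intro nn_integral_cong) (auto simp: strict_tail_def indicator_def)
qed

lemma avoids_UN: "avoids (\<Union>j\<in>J. A j) \<omega> \<longleftrightarrow> (\<forall>j\<in>J. avoids (A j) \<omega>)"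
  by (auto simp: avoids_def)

lemma avoids_epi_iff:
  assumes "\<omega> \<in> space P" "I \<subseteq> {0..}"
  shows "avoids (epi I g u) \<omega> \<longleftrightarrow> (\<forall>r\<in>I. 0 < \<xi> r \<omega> \<longrightarrow> \<xi> r \<omega> - g r \<le> u)"
  using assms by (force simp: avoids_def epi_def pts_def space_Lambda not_less algebra_simps)

lemma shots_le_iff_avoids:
  assumes "\<omega> \<in> space P" "I \<subseteq> {0..}" "above_floor I g u"
  shows "(\<forall>r\<in>I. \<xi> r \<omega> - g r \<le> u) \<longleftrightarrow> avoids (epi I g u) \<omega>"
  unfolding avoids_epi_iff[OF assms(1,2)]
proof (intro ball_cong refl iffI impI)
  fix r assume r: "r \<in> I" and *: "0 < \<xi> r \<omega> \<longrightarrow> \<xi> r \<omega> - g r \<le> u"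
  show "\<xi> r \<omega> - g r \<le> u"
  proof (cases "0 < \<xi> r \<omega>")
    case False
    with mark_nonneg[OF assms(1), of r] r assms(2) have "\<xi> r \<omega> = 0" by force
    with assms(3) r show ?thesis by (auto simp: above_floor_def)
  qed (use * in auto)
qed auto

text \<open>
This expresses boundedness by countably many void events and thus makes it measurable.
\<close>

lemma bounded_shots_iff_avoids:
  assumes "\<omega> \<in> space P" "gauge_on I g"
  shows "bounded_shots I g \<omega> \<longleftrightarrow> (\<exists>n::nat. avoids (epi I g (real n)) \<omega>)"
proof
  assume "bounded_shots I g \<omega>"
  then obtain B where B: "\<And>r. r \<in> I \<Longrightarrow> max 0 (\<xi> r \<omega> - g r) \<le> B"
    by (auto simp: bounded_shots_def bdd_above_def)
  obtain n :: nat where "B \<le> n" using real_arch_simple by blast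
  with B have "\<And>r. r \<in> I \<Longrightarrow> \<xi> r \<omega> - g r \<le> n" by force
  then show "\<exists>n::nat. avoids (epi I g (real n)) \<omega>"
    using assms by (intro exI[of _ n]) (simp add: avoids_epi_iff gauge_on_def)
next
  assume "\<exists>n::nat. avoids (epi I g (real n)) \<omega>"
  then obtain n :: nat where n: "avoids (epi I g (real n)) \<omega>" by blast
  obtain C where C: "\<And>r. r \<in> I \<Longrightarrow> - C \<le> g r"
    using assms by (auto simp: gauge_on_def)
  define K where "K = max (real n) C"
  have I: "I \<subseteq> {0..}" using assms by (simp add: gauge_on_def)
  have "avoids (epi I g K) \<omega>"
    using n by (auto simp: avoids_epi_iff[OF assms(1) I] K_def)
  moreover have "above_floor I g K"
  proof -
    have "- g r \<le> K" if "r \<in> I" for r using C[OF that] by (simp add: K_def)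
    then show ?thesis by (auto simp: above_floor_def K_def)
  qed
  ultimately have "\<forall>r\<in>I. \<xi> r \<omega> - g r \<le> K"
    using shots_le_iff_avoids[OF assms(1) I] by blast
  then show "bounded_shots I g \<omega>"
    by (auto simp: bounded_shots_def bdd_above_def K_def intro!: exI[of _ K])
qed

lemma bounded_shots_sets:
  assumes "gauge_on I g"
  shows "{\<omega>\<in>space P. bounded_shots I g \<omega>} \<in> sets P"
proof -
  have [measurable]: "epi I g u \<in> sets \<Lambda>" for u
    using assms by (intro epi_sets) (auto simp: gauge_on_def)
  have "{\<omega>\<in>space P. bounded_shots I g \<omega>}
      = (\<Union>n::nat. {\<omega>\<in>space P. avoids (epi I g (real n)) \<omega>})"
    using bounded_shots_iff_avoids[OF _ assms] by auto
  then show ?thesis by simp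
qed

text \<open>
The regions above \<open>n + g\<close> decrease to the empty set, and one of them has finite intensity, so
their intensities tend to \<open>0\<close> and their void probabilities to \<open>1\<close>.
\<close>

lemma AE_bounded_shots:
  assumes g: "gauge_on I g"
  shows "AE \<omega> in P. bounded_shots I g \<omega>"
proof -
  have S: "epi I g u \<in> sets \<Lambda>" for u
    using g by (intro epi_sets) (auto simp: gauge_on_def)
  obtain K where K: "emeasure \<Lambda> (epi I g K) < \<infinity>" using g by (auto simp: gauge_on_def)
  obtain N :: nat where N: "K \<le> real N" using real_arch_simple by blast
  define A where "A n = epi I g (real (N + n))" for n
  have dec: "decseq A"
    by (auto simp: decseq_def A_def epi_def)
  have fin: "emeasure \<Lambda> (A n) \<noteq> \<infinity>" for n
  proof -
    have "emeasure \<Lambda> (A n) \<le> emeasure \<Lambda> (epi I g K)"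
      using N S by (intro emeasure_mono) (auto simp: A_def epi_def)
    with K show ?thesis by (auto simp: top_unique)
  qed
  have empty: "(\<Inter>n. A n) = {}"
  proof -
    have False if "\<And>n. (r, y) \<in> A n" for r y
    proof -
      obtain m :: nat where "y - g r \<le> m" using real_arch_simple by blast
      with that[of m] show False by (auto simp: A_def epi_def)
    qed
    then show ?thesis by auto
  qed
  have "(\<lambda>n. emeasure \<Lambda> (A n)) \<longlonglongrightarrow> emeasure \<Lambda> (\<Inter>n. A n)"
    using S by (intro Lim_emeasure_decseq[OF _ dec fin]) (simp add: A_def image_subset_iff)
  then have lim: "(\<lambda>n. exp_minus (emeasure \<Lambda> (A n))) \<longlonglongrightarrow> 1"
    by (intro exp_minus_tendsto_1) (simp add: empty)
  have "exp_minus (emeasure \<Lambda> (A n)) \<le> \<P>(\<omega> in P. bounded_shots I g \<omega>)" for n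
  proof -
    have "exp_minus (emeasure \<Lambda> (A n)) = \<P>(\<omega> in P. avoids (A n) \<omega>)"
      using S by (simp add: prob_avoids A_def)
    also have "\<dots> \<le> \<P>(\<omega> in P. bounded_shots I g \<omega>)"
      using bounded_shots_sets[OF g] bounded_shots_iff_avoids[OF _ g]
      by (intro finite_measure_mono) (auto simp: A_def simp del: of_nat_add)
    finally show ?thesis .
  qed
  from LIMSEQ_le_const2[OF lim] this have "1 \<le> \<P>(\<omega> in P. bounded_shots I g \<omega>)" by blast
  then have "\<P>(\<omega> in P. bounded_shots I g \<omega>) = 1" by (simp add: antisym)
  then show ?thesis using bounded_shots_sets[OF g] by (simp add: prob_Collect_eq_1)
qed

lemma shot_sup_le_iff:
  assumes "bounded_shots I g \<omega>" "I \<noteq> {}"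
  shows "shot_sup \<xi> I g \<omega> \<le> u \<longleftrightarrow> 0 \<le> u \<and> (\<forall>r\<in>I. \<xi> r \<omega> - g r \<le> u)"
  using assms unfolding shot_sup_def bounded_shots_def by (subst cSUP_le_iff) auto

lemma shot_sup_le_iff_avoids:
  assumes "\<omega> \<in> space P" "gauge_on I g" "bounded_shots I g \<omega>"
  shows "shot_sup \<xi> I g \<omega> \<le> u \<longleftrightarrow> above_floor I g u \<and> avoids (epi I g u) \<omega>"
proof -
  have I: "I \<noteq> {}" "I \<subseteq> {0..}" using assms(2) by (auto simp: gauge_on_def)
  have "above_floor I g u" if "0 \<le> u" "\<forall>r\<in>I. \<xi> r \<omega> - g r \<le> u"
    unfolding above_floor_def
  proof (intro conjI ballI)
    fix r assume "r \<in> I"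
    with that(2) mark_nonneg[OF assms(1), of r] I(2) show "- g r \<le> u" by force
  qed fact
  then show ?thesis
    using shots_le_iff_avoids[OF assms(1) I(2)] unfolding shot_sup_le_iff[OF assms(3) I(1)]
    by (auto simp: above_floor_def)
qed

lemma AE_shot_sup_le_iff:
  assumes "gauge_on I g"
  shows "AE \<omega> in P. \<forall>u. shot_sup \<xi> I g \<omega> \<le> u \<longleftrightarrow> above_floor I g u \<and> avoids (epi I g u) \<omega>"
  using AE_bounded_shots[OF assms] AE_space
  by eventually_elim (use shot_sup_le_iff_avoids assms in blast)

lemma shot_sup_borel [measurable]:
  assumes g: "gauge_on I g"
  shows "shot_sup \<xi> I g \<in> borel_measurable P"
proof (rule borel_measurableI_le)
  fix u :: real
  have [measurable]: "epi I g u \<in> sets \<Lambda>"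
    using g by (intro epi_sets) (auto simp: gauge_on_def)
  note [measurable] = bounded_shots_sets[OF g]
  define c where "c = Sup (UNIV :: real set)"
  \<comment> \<open>On the unbounded event the supremum is a constant, hence still measurable.\<close>
  have unb: "shot_sup \<xi> I g \<omega> = c" if "\<not> bounded_shots I g \<omega>" for \<omega>
    using that unfolding shot_sup_def bounded_shots_def c_def
    by (intro Sup_real_unbounded) (auto simp: bdd_above_def intro: gt_ex not_le)
  have "{\<omega>\<in>space P. shot_sup \<xi> I g \<omega> \<le> u} =
      {\<omega>\<in>space P. (bounded_shots I g \<omega> \<and> above_floor I g u \<and> avoids (epi I g u) \<omega>) \<or>
                  (\<not> bounded_shots I g \<omega> \<and> c \<le> u)}"
    using shot_sup_le_iff_avoids[OF _ g] unb by auto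
  also have "\<dots> \<in> sets P" by measurable
  finally show "{\<omega>\<in>space P. shot_sup \<xi> I g \<omega> \<le> u} \<in> sets P" .
qed

text \<open>
If the levels lie above the floors, then almost surely the suprema stay below their levels if
and only if the union of the regions contains no point; below a floor the event is impossible.
\<close>

lemma prob_shot_sups_le:
  assumes J: "finite J" and g: "\<And>j. j \<in> J \<Longrightarrow> gauge_on (I j) (g j)"
  shows "\<P>(\<omega> in P. \<forall>j\<in>J. shot_sup \<xi> (I j) (g j) \<omega> \<le> u j) =
    exp_minus (emeasure \<Lambda> (\<Union>j\<in>J. epi (I j) (g j) (u j))) *
    of_bool (\<forall>j\<in>J. above_floor (I j) (g j) (u j))"
proof -
  let ?A = "\<Union>j\<in>J. epi (I j) (g j) (u j)"
  let ?fl = "\<forall>j\<in>J. above_floor (I j) (g j) (u j)"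
  have A[measurable]: "?A \<in> sets \<Lambda>"
    using J g by (intro sets.finite_UN epi_sets) (auto simp: gauge_on_def)
  note [measurable] = avoids_sets[OF A]
  have "AE \<omega> in P. \<forall>j\<in>J. \<forall>v. shot_sup \<xi> (I j) (g j) \<omega> \<le> v \<longleftrightarrow>
      above_floor (I j) (g j) v \<and> avoids (epi (I j) (g j) v) \<omega>"
    using J AE_shot_sup_le_iff[OF g] by (intro AE_finite_allI) auto
  then have "AE \<omega> in P. (\<forall>j\<in>J. shot_sup \<xi> (I j) (g j) \<omega> \<le> u j) \<longleftrightarrow> ?fl \<and> avoids ?A \<omega>"
    by eventually_elim (auto simp: avoids_UN)
  moreover have "{\<omega>\<in>space P. \<forall>j\<in>J. shot_sup \<xi> (I j) (g j) \<omega> \<le> u j} \<in> sets P"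
  proof (intro sets.sets_Collect_finite_All J)
    fix j assume "j \<in> J"
    note [measurable] = shot_sup_borel[OF g[OF this]]
    show "{\<omega>\<in>space P. shot_sup \<xi> (I j) (g j) \<omega> \<le> u j} \<in> sets P" by measurable
  qed
  ultimately have "\<P>(\<omega> in P. \<forall>j\<in>J. shot_sup \<xi> (I j) (g j) \<omega> \<le> u j) =
      \<P>(\<omega> in P. ?fl \<and> avoids ?A \<omega>)"
    by (intro measure_eq_AE) auto
  also have "\<dots> = exp_minus (emeasure \<Lambda> ?A) * of_bool ?fl"
  proof (cases ?fl)
    case True
    then have "{\<omega>\<in>space P. ?fl \<and> avoids ?A \<omega>} = {\<omega>\<in>space P. avoids ?A \<omega>}" by blast
    then show ?thesis using prob_avoids[OF A] True by simp
  next
    case False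
    then have *: "{\<omega>\<in>space P. ?fl \<and> avoids ?A \<omega>} = {}" by blast
    show ?thesis unfolding * using False by simp
  qed
  finally show ?thesis .
qed

lemma prob_shot_sup_le:
  assumes g: "gauge_on I g"
  shows "\<P>(\<omega> in P. shot_sup \<xi> I g \<omega> \<le> u) =
    exp_minus (\<integral>\<^sup>+r\<in>I. strict_tail \<mu> (u + g r) \<partial>lborel) * of_bool (above_floor I g u)"
proof -
  have "emeasure \<Lambda> (epi I g u) = (\<integral>\<^sup>+r\<in>I. strict_tail \<mu> (u + g r) \<partial>lborel)"
    using g by (intro emeasure_epi) (auto simp: gauge_on_def)
  then show ?thesis
    using prob_shot_sups_le[of "{()}" "\<lambda>_. I" "\<lambda>_. g" "\<lambda>_. u"] g by simp
qed

text \<open>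
A continuous gauge is at least \<open>- C\<close> on a compact interval, so shots above \<open>C + 1 + g\<close> have size
at least \<open>1\<close>; their intensity is at most \<open>tail \<mu> 1\<close> times the length of the interval.
\<close>

lemma gauge_on_interval:
  assumes "0 \<le> s" "s \<le> t" and cont: "continuous_on UNIV g"
  shows "gauge_on {s..t} g"
proof -
  have [measurable]: "g \<in> borel_measurable borel"
    using cont by (rule borel_measurable_continuous_onI)
  have "compact (g ` {s..t})"
    by (intro compact_continuous_image continuous_on_subset[OF cont]) auto
  then obtain C where C: "\<And>r. r \<in> {s..t} \<Longrightarrow> \<bar>g r\<bar> \<le> C"
    unfolding compact_eq_bounded_closed bounded_iff by force
  then have lower: "- C \<le> g r" if "r \<in> {s..t}" for r using that by force
  have "emeasure \<Lambda> (epi {s..t} g (C + 1)) = (\<integral>\<^sup>+r\<in>{s..t}. strict_tail \<mu> (C + 1 + g r) \<partial>lborel)"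
    using assms by (intro emeasure_epi) auto
  also have "\<dots> \<le> (\<integral>\<^sup>+r. tail \<mu> 1 * indicator {s..t} r \<partial>lborel)"
  proof (intro nn_integral_mono)
    fix r
    have "strict_tail \<mu> (C + 1 + g r) \<le> tail \<mu> 1" if "r \<in> {s..t}"
      using strict_tail_mono[of 1 "C + 1 + g r"] strict_tail_le_tail[of 1] lower[OF that] by simp
    then show "strict_tail \<mu> (C + 1 + g r) * indicator {s..t} r \<le> tail \<mu> 1 * indicator {s..t} r"
      by (auto simp: indicator_def)
  qed
  also have "\<dots> = tail \<mu> 1 * ennreal (t - s)"
    using assms by (simp add: nn_integral_cmult_indicator)
  also have "\<dots> < \<infinity>"
    using tail_finite[of 1] by (simp add: ennreal_mult_less_top)
  finally have "\<exists>K. emeasure \<Lambda> (epi {s..t} g K) < \<infinity>" by blast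
  moreover have "\<exists>C. \<forall>r\<in>{s..t}. - C \<le> g r" using lower by blast
  ultimately show ?thesis
    using assms(1,2) unfolding gauge_on_def by simp
qed

lemma gauge_on_esn0: "0 \<le> t \<Longrightarrow> gauge_on {0..t} (\<lambda>r. b * (t - r))"
  by (intro gauge_on_interval continuous_intros) auto

lemma esn0_borel [measurable]: "0 \<le> t \<Longrightarrow> esn0 \<xi> b t \<in> borel_measurable P"
  unfolding esn0_eq_shot_sup by (intro shot_sup_borel gauge_on_esn0)

lemma above_floor_esn0:
  assumes "0 \<le> t"
  shows "above_floor {0..t} (\<lambda>r. b * (t - r)) u \<longleftrightarrow> max 0 (- b * t) \<le> u"
proof
  assume "above_floor {0..t} (\<lambda>r. b * (t - r)) u"
  then show "max 0 (- b * t) \<le> u" using assms by (auto simp: above_floor_def dest: bspec[of _ _ 0])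
next
  assume u: "max 0 (- b * t) \<le> u"
  have "- (b * (t - r)) \<le> u" if "r \<in> {0..t}" for r
  proof (cases "0 \<le> b")
    case True
    with that have "0 \<le> b * (t - r)" by simp
    with u show ?thesis by simp
  next
    case False
    with that have "b * t \<le> b * (t - r)" by (intro mult_left_mono_neg) auto
    with u show ?thesis by simp
  qed
  with u show "above_floor {0..t} (\<lambda>r. b * (t - r)) u" by (simp add: above_floor_def)
qed

end

section \<open>Finite-dimensional laws\<close>

lemma nn_integral_affine_set:
  fixes f :: "real \<Rightarrow> ennreal" and c :: real
  assumes [measurable]: "f \<in> borel_measurable borel" "J \<in> sets borel"
    and c: "c \<noteq> 0" and IJ: "\<And>r. r \<in> I \<longleftrightarrow> u + c * r \<in> J"
  shows "(\<integral>\<^sup>+r\<in>I. f (u + c * r) \<partial>lborel) = (\<integral>\<^sup>+y\<in>J. f y \<partial>lborel) / ennreal \<bar>c\<bar>"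
proof -
  have "(\<integral>\<^sup>+y\<in>J. f y \<partial>lborel)
      = ennreal \<bar>c\<bar> * (\<integral>\<^sup>+r. f (u + c * r) * indicator J (u + c * r) \<partial>lborel)"
    using nn_integral_real_affine[of "\<lambda>y. f y * indicator J y" c u] c by simp
  also have "(\<lambda>r. indicator J (u + c * r) :: ennreal) = indicator I"
    by (auto simp: indicator_def IJ)
  then have "(\<integral>\<^sup>+r. f (u + c * r) * indicator J (u + c * r) \<partial>lborel)
      = (\<integral>\<^sup>+r\<in>I. f (u + c * r) \<partial>lborel)" by (simp add: fun_eq_iff)
  finally show ?thesis
    using c by (simp add: ennreal_mult_divide_eq mult.commute[of "ennreal \<bar>c\<bar>"])
qed

lemma prod_of_bool: "finite A \<Longrightarrow> (\<Prod>i\<in>A. of_bool (Q i)) = (of_bool (\<forall>i\<in>A. Q i) :: real)"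
  by (induction rule: finite_induct) auto

context extremal_shot_noise
begin

lemma tail_eq_strict_tail:
  assumes "x \<le> 0 \<or> emeasure \<mu> {x} = 0"
  shows "tail \<mu> x = strict_tail \<mu> x"
proof (cases "x \<le> 0")
  case True
  then have "{0<..} \<inter> {x..} = {0<..} \<inter> {x<..}" by auto
  then show ?thesis by (simp add: tail_def strict_tail_def)
next
  case False
  then have *: "{0<..} \<inter> {x..} = {x} \<union> {0<..} \<inter> {x<..}" by auto
  have "{0<..} \<inter> {x} \<in> sets \<mu>" by (rule Int_pos_in_sets_mu) simp
  moreover have "{0<..} \<inter> {x} = {x}" using False by auto
  ultimately have "{x} \<in> sets \<mu>" by metis
  moreover have "{0<..} \<inter> {x<..} \<in> sets \<mu>" by (rule Int_pos_in_sets_mu) simp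
  ultimately have "tail \<mu> x = emeasure \<mu> {x} + strict_tail \<mu> x"
    unfolding tail_def strict_tail_def * by (intro plus_emeasure[symmetric]) auto
  with False assms show ?thesis by simp
qed

text \<open>
The two tails differ only at atoms, and \<open>\<mu>\<close> is finite on each of the sets
\<open>{1 / (1 + n)..}\<close>, where it has at most countably many atoms.
\<close>

lemma countable_atoms: "countable {x. tail \<mu> x \<noteq> strict_tail \<mu> x}"
proof -
  define R where "R n = restrict_space \<mu> ({0<..} \<inter> {1 / (1 + real n)..})" for n
  have count: "countable {x. measure (R n) {x} \<noteq> 0}" for n
  proof -
    have "emeasure (R n) (space (R n)) = tail \<mu> (1 / (1 + real n))"
      unfolding R_def
      by (subst emeasure_restrict_space)
         (auto simp: Int_pos_in_sets_mu tail_def space_mu space_restrict_space Int_absorb2)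
    then have "finite_measure (R n)"
      using tail_finite[of "1 / (1 + real n)"] by (intro finite_measureI) (simp add: less_top)
    then show ?thesis by (rule finite_measure.countable_support)
  qed
  have "{x. tail \<mu> x \<noteq> strict_tail \<mu> x} \<subseteq> (\<Union>n. {x. measure (R n) {x} \<noteq> 0})"
  proof
    fix x assume "x \<in> {x. tail \<mu> x \<noteq> strict_tail \<mu> x}"
    then have x: "0 < x" "emeasure \<mu> {x} \<noteq> 0" using tail_eq_strict_tail[of x] by force+
    from x(1) obtain n :: nat where "inverse (real (Suc n)) < x" by (metis reals_Archimedean)
    then have n: "1 / (1 + real n) \<le> x" by (simp add: field_simps)
    have "emeasure (R n) {x} = emeasure \<mu> {x}"
      unfolding R_def using x n Int_pos_in_sets_mu[of "{1 / (1 + real n)..}"]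
      by (subst emeasure_restrict_space) (auto simp: sets.Int_space_eq2)
    moreover have "emeasure \<mu> {x} \<le> tail \<mu> x"
      unfolding tail_def using x by (intro emeasure_mono Int_pos_in_sets_mu) auto
    ultimately have "measure (R n) {x} \<noteq> 0"
      using x tail_finite[of x] by (auto simp: measure_def enn2real_eq_0_iff top_unique)
    then show "x \<in> (\<Union>n. {x. measure (R n) {x} \<noteq> 0})" by blast
  qed
  then show ?thesis by (rule countable_subset) (intro countable_UN count countableI_type)
qed

lemma AE_tail_eq_strict_tail:
  assumes "c \<noteq> (0::real)"
  shows "AE r in lborel. tail \<mu> (a + c * r) = strict_tail \<mu> (a + c * r)"
proof -
  have "{r. tail \<mu> (a + c * r) \<noteq> strict_tail \<mu> (a + c * r)}
      \<subseteq> (\<lambda>y. (y - a) / c) ` {x. tail \<mu> x \<noteq> strict_tail \<mu> x}"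
    using assms by (auto simp: image_iff intro!: exI[of _ "a + c * _"])
  then have "countable {r. tail \<mu> (a + c * r) \<noteq> strict_tail \<mu> (a + c * r)}"
    by (rule countable_subset) (intro countable_image countable_atoms)
  then have "{r. tail \<mu> (a + c * r) \<noteq> strict_tail \<mu> (a + c * r)} \<in> null_sets lborel"
    by (rule countable_imp_null_set_lborel)
  from AE_not_in[OF this] show ?thesis by simp
qed

lemma strict_tail_affine_integral:
  assumes "J \<in> sets borel" "c \<noteq> 0" "\<And>r. r \<in> I \<longleftrightarrow> u + c * r \<in> J"
  shows "(\<integral>\<^sup>+r\<in>I. strict_tail \<mu> (u + c * r) \<partial>lborel) = (\<integral>\<^sup>+y\<in>J. tail \<mu> y \<partial>lborel) / ennreal \<bar>c\<bar>"
proof -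
  have "(\<integral>\<^sup>+r\<in>I. strict_tail \<mu> (u + c * r) \<partial>lborel) = (\<integral>\<^sup>+r\<in>I. tail \<mu> (u + c * r) \<partial>lborel)"
    using AE_tail_eq_strict_tail[OF assms(2), of u]
    by (intro nn_integral_cong_AE) (auto elim!: eventually_mono)
  also have "\<dots> = (\<integral>\<^sup>+y\<in>J. tail \<mu> y \<partial>lborel) / ennreal \<bar>c\<bar>"
    using assms by (intro nn_integral_affine_set) auto
  finally show ?thesis .
qed

lemma esn_nonneg: "0 \<le> esn \<xi> b x t \<omega>"
  by (simp add: esn_def)

lemma esn_le_iff: "esn \<xi> b x t \<omega> \<le> u \<longleftrightarrow> max 0 (x - b * t) \<le> u \<and> esn0 \<xi> b t \<omega> \<le> u"
  by (simp add: esn_def)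

lemma esn_borel [measurable]: "0 \<le> t \<Longrightarrow> esn \<xi> b x t \<in> borel_measurable P"
  unfolding esn_def[abs_def] by measurable

lemma prob_esn0_le:
  assumes t: "0 \<le> t"
  shows "\<P>(\<omega> in P. esn0 \<xi> b t \<omega> \<le> u)
    = exp_minus (\<integral>\<^sup>+r\<in>{0..t}. strict_tail \<mu> (u + b * (t - r)) \<partial>lborel) * of_bool (max 0 (- b * t) \<le> u)"
  using prob_shot_sup_le[OF gauge_on_esn0[OF t], of u]
  by (simp only: esn0_eq_shot_sup above_floor_esn0[OF t])

lemma prob_esn_le:
  assumes "0 \<le> t" "0 \<le> x"
  shows "\<P>(\<omega> in P. esn \<xi> b x t \<omega> \<le> u)
    = exp_minus (\<integral>\<^sup>+r\<in>{0..t}. strict_tail \<mu> (u + b * (t - r)) \<partial>lborel) * of_bool (max 0 (x - b * t) \<le> u)"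
  using prob_esn0_le[OF assms(1), of u] assms(2)
  by (cases "max 0 (x - b * t) \<le> u") (auto simp: esn_le_iff)

lemma strict_tail_time_integral:
  assumes "b \<noteq> 0" "0 \<le> t"
  shows "(\<integral>\<^sup>+r\<in>{0..t}. strict_tail \<mu> (u + b * (t - r)) \<partial>lborel)
    = (\<integral>\<^sup>+y\<in>{min u (u + b * t)..max u (u + b * t)}. tail \<mu> y \<partial>lborel) / ennreal \<bar>b\<bar>"
proof -
  have "r \<in> {0..t} \<longleftrightarrow> (u + b * t) + (- b) * r \<in> {min u (u + b * t)..max u (u + b * t)}" for r
  proof (cases "0 < b")
    case True
    then have "b * r \<le> b * t \<longleftrightarrow> r \<le> t" "0 \<le> b * r \<longleftrightarrow> 0 \<le> r" "0 \<le> b * t"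
      using assms by (auto simp: zero_le_mult_iff)
    then show ?thesis by auto
  next
    case False
    then have "b < 0" using assms by simp
    then have "b * t \<le> b * r \<longleftrightarrow> r \<le> t" "b * r \<le> 0 \<longleftrightarrow> 0 \<le> r" "b * t \<le> 0"
      using assms by (auto simp: mult_le_0_iff)
    then show ?thesis by auto
  qed
  from strict_tail_affine_integral[of _ "- b" "{0..t}" "u + b * t", OF _ _ this] assms
  show ?thesis by (simp add: algebra_simps)
qed

text \<open>
A point at time \<open>t\<close> between \<open>s (k - 1)\<close> and \<open>s k\<close> affects the values at the times \<open>s k, \<dots>, s n\<close>
only. The forbidden sizes at time \<open>t\<close> thus form the ray above the minimum of the corresponding
levels \<open>u j + b * (s j - t)\<close>, \<open>j \<ge> k\<close>.
\<close>

lemma prob_esn0_finite_dimensional: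
  fixes s u :: "nat \<Rightarrow> real"
  assumes n: "1 \<le> n" and s0: "s 0 = 0" and inc: "\<And>i. i < n \<Longrightarrow> s i < s (Suc i)"
  shows "\<P>(\<omega> in P. \<forall>i\<in>{1..n}. esn \<xi> b 0 (s i) \<omega> \<le> u i)
    = exp_minus (\<Sum>i=1..n. \<integral>\<^sup>+t\<in>{s (i - 1)..s i}.
        strict_tail \<mu> (MIN j\<in>{i..n}. u j + b * (s j - t)) \<partial>lborel)
      * (\<Prod>i=1..n. of_bool (u i \<ge> max 0 (- b * s i)))"
proof -
  have mono: "s i \<le> s j" if "i \<le> j" "j \<le> n" for i j
    using that
  proof (induction rule: dec_induct)
    case (step k)
    with inc[of k] show ?case by simp
  qed simp
  have pos: "0 \<le> s i" if "i \<le> n" for i using mono[of 0 i] that s0 by simp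
  define A where "A i = epi {0..s i} (\<lambda>r. b * (s i - r)) (u i)" for i
  define h where "h i t = strict_tail \<mu> (MIN j\<in>{i..n}. u j + b * (s j - t))" for i t
  have A_sets: "A i \<in> sets \<Lambda>" for i unfolding A_def by (intro epi_sets) auto
  have section_A: "Pair r -` A i = (if 0 \<le> r \<and> r \<le> s i then {0<..} \<inter> {u i + b * (s i - r)<..} else {})"
    for r i by (auto simp: A_def epi_def space_Lambda)
  have h_borel [measurable]: "h i \<in> borel_measurable borel" for i
  proof -
    have "continuous_on UNIV (\<lambda>t. MIN j\<in>{i..n}. u j + b * (s j - t))"
    proof (cases "i \<le> n")
      case True
      have eq: "(MIN j\<in>{i..n}. u j + b * (s j - t)) = (MIN j\<in>{i..n}. u j + b * s j) + - b * t" for t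
        using True Min_add_commute[of "{i..n}" "\<lambda>j. u j + b * s j" "- b * t"]
        by (simp add: algebra_simps)
      show ?thesis unfolding eq by (intro continuous_intros)
    qed simp
    then have "(\<lambda>t. MIN j\<in>{i..n}. u j + b * (s j - t)) \<in> borel_measurable borel"
      by (rule borel_measurable_continuous_onI)
    from measurable_compose[OF this strict_tail_borel] show ?thesis by (simp add: h_def[abs_def])
  qed
  \<comment> \<open>At the observation times themselves two neighbouring intervals overlap.\<close>
  have "s ` {0..n} \<in> null_sets lborel"
    by (intro finite_imp_null_set_lborel) simp
  from AE_not_in[OF this]
  have "AE r in lborel. emeasure \<mu> (Pair r -` (\<Union>i\<in>{1..n}. A i)) * indicator {0..} r
      = (\<Sum>i=1..n. h i r * indicator {s (i - 1)..s i} r)"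
  proof eventually_elim
    case (elim r)
    show ?case
    proof (cases "0 \<le> r \<and> r \<le> s n")
      case False
      then have "Pair r -` A i = {}" if "i \<in> {1..n}" for i
        using mono[of i n] that by (auto simp: section_A)
      then have "Pair r -` (\<Union>i\<in>{1..n}. A i) = {}" by (simp add: vimage_UN)
      moreover have "indicator {s (i - 1)..s i} r = (0::ennreal)" if "i \<in> {1..n}" for i
      proof -
        have "i - 1 \<le> n" using that by auto
        from False that mono[of i n] pos[OF this] show ?thesis by (auto simp: indicator_def)
      qed
      ultimately show ?thesis by simp
    next
      case True
      define k where "k = (LEAST i. r \<le> s i)"
      have rk: "r \<le> s k" and kn: "k \<le> n"
        unfolding k_def using True by (auto intro: LeastI Least_le)
      have k0: "k \<noteq> 0"
        using rk True s0 elim by (metis atLeastAtMost_iff image_eqI le0 order_antisym)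
      have rk': "s (k - 1) < r"
        using not_less_Least[of "k - 1" "\<lambda>i. r \<le> s i"] k0 unfolding k_def[symmetric] by simp
      have rk'': "r < s k" using rk elim kn by (metis atLeastAtMost_iff image_eqI le0 order_le_imp_less_or_eq)
      have le_iff: "r \<le> s j \<longleftrightarrow> k \<le> j" if "j \<in> {1..n}" for j
      proof (cases "k \<le> j")
        case True
        with that mono[of k j] rk show ?thesis by simp
      next
        case False
        then have "j \<le> k - 1" "k - 1 \<le> n" using kn by auto
        with mono[of j "k - 1"] rk' False show ?thesis by simp
      qed
      have "Pair r -` (\<Union>i\<in>{1..n}. A i) = {0<..} \<inter> {(MIN j\<in>{k..n}. u j + b * (s j - r))<..}"
      proof -
        have "Pair r -` (\<Union>i\<in>{1..n}. A i) = (\<Union>i\<in>{k..n}. {0<..} \<inter> {u i + b * (s i - r)<..})"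
        proof -
          have "Pair r -` A i = (if k \<le> i then {0<..} \<inter> {u i + b * (s i - r)<..} else {})"
            if "i \<in> {1..n}" for i
            using True le_iff[OF that] by (simp add: section_A)
          then have "Pair r -` (\<Union>i\<in>{1..n}. A i)
              = (\<Union>i\<in>{1..n}. if k \<le> i then {0<..} \<inter> {u i + b * (s i - r)<..} else {})"
            unfolding vimage_UN by (intro SUP_cong refl)
          also have "\<dots> = (\<Union>i\<in>{i\<in>{1..n}. k \<le> i}. {0<..} \<inter> {u i + b * (s i - r)<..})" by auto
          also have "{i\<in>{1..n}. k \<le> i} = {k..n}" using k0 by auto
          finally show ?thesis .
        qed
        also have "\<dots> = {0<..} \<inter> {(MIN j\<in>{k..n}. u j + b * (s j - r))<..}"
        proof -
          have "(MIN j\<in>{k..n}. u j + b * (s j - r)) < y \<longleftrightarrow> (\<exists>j\<in>{k..n}. u j + b * (s j - r) < y)" for y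
            using kn by (subst Min_less_iff) auto
          then show ?thesis by blast
        qed
        finally show ?thesis .
      qed
      then have "emeasure \<mu> (Pair r -` (\<Union>i\<in>{1..n}. A i)) = h k r"
        by (simp add: h_def strict_tail_def)
      moreover have "(\<Sum>i=1..n. h i r * indicator {s (i - 1)..s i} r)
          = (\<Sum>i=1..n. if i = k then h k r else 0)"
      proof (intro sum.cong refl)
        fix i assume i: "i \<in> {1..n}"
        show "h i r * indicator {s (i - 1)..s i} r = (if i = k then h k r else 0)"
        proof (cases i k rule: linorder_cases)
          case less
          then have "i \<le> k - 1" "k - 1 \<le> n" using kn by auto
          with mono[of i "k - 1"] rk' less show ?thesis by (auto simp: indicator_def)
        next
          case greater
          then have "k \<le> i - 1" "i - 1 \<le> n" using i by auto
          with mono[of k "i - 1"] rk'' greater show ?thesis by (auto simp: indicator_def)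
        qed (use rk rk' in auto)
      qed
      ultimately show ?thesis using True kn k0 by simp
    qed
  qed
  then have "emeasure \<Lambda> (\<Union>i\<in>{1..n}. A i)
      = (\<integral>\<^sup>+r. (\<Sum>i=1..n. h i r * indicator {s (i - 1)..s i} r) \<partial>lborel)"
    using A_sets by (subst emeasure_Lambda) (auto intro!: nn_integral_cong_AE)
  also have "\<dots> = (\<Sum>i=1..n. \<integral>\<^sup>+t\<in>{s (i - 1)..s i}. h i t \<partial>lborel)"
    by (intro nn_integral_sum) auto
  finally have mass: "emeasure \<Lambda> (\<Union>i\<in>{1..n}. A i) = (\<Sum>i=1..n. \<integral>\<^sup>+t\<in>{s (i - 1)..s i}. h i t \<partial>lborel)" .
  let ?fl = "\<forall>i\<in>{1..n}. max 0 (- b * s i) \<le> u i"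
  have "\<P>(\<omega> in P. \<forall>i\<in>{1..n}. esn0 \<xi> b (s i) \<omega> \<le> u i)
      = exp_minus (emeasure \<Lambda> (\<Union>i\<in>{1..n}. A i)) * of_bool ?fl"
    unfolding esn0_eq_shot_sup A_def
    using prob_shot_sups_le[of "{1..n}" "\<lambda>i. {0..s i}" "\<lambda>i r. b * (s i - r)" u]
      above_floor_esn0 gauge_on_esn0 pos by simp
  moreover have "\<P>(\<omega> in P. \<forall>i\<in>{1..n}. esn \<xi> b 0 (s i) \<omega> \<le> u i)
      = \<P>(\<omega> in P. \<forall>i\<in>{1..n}. esn0 \<xi> b (s i) \<omega> \<le> u i)" if ?fl
    using that by (intro arg_cong[where f=prob] Collect_cong) (auto simp: esn_le_iff)
  moreover have "\<P>(\<omega> in P. \<forall>i\<in>{1..n}. esn \<xi> b 0 (s i) \<omega> \<le> u i) = 0" if "\<not> ?fl"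
  proof -
    have *: "{\<omega>\<in>space P. \<forall>i\<in>{1..n}. esn \<xi> b 0 (s i) \<omega> \<le> u i} = {}"
      using that by (auto simp: esn_le_iff)
    show ?thesis unfolding * by simp
  qed
  ultimately show ?thesis
    unfolding mass h_def by (cases ?fl) (simp_all add: prod_of_bool)
qed

text \<open>
For \<open>b \<noteq> 0\<close> the minimum is an affine function of \<open>t\<close> with slope \<open>- b\<close> and meets the atoms of \<open>\<mu>\<close>
only countably often. For \<open>b = 0\<close> it is constant, namely one of the levels \<open>u j\<close>.
\<close>

lemma integral_tail_eq_strict_tail_Min:
  fixes s u :: "nat \<Rightarrow> real"
  assumes "i \<le> n" and "b \<noteq> 0 \<or> (\<forall>j\<in>{i..n}. emeasure \<mu> {u j} = 0)"
  shows "(\<integral>\<^sup>+t\<in>I. tail \<mu> (MIN j\<in>{i..n}. u j + b * (s j - t)) \<partial>lborel)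
    = (\<integral>\<^sup>+t\<in>I. strict_tail \<mu> (MIN j\<in>{i..n}. u j + b * (s j - t)) \<partial>lborel)"
proof (cases "b = 0")
  case True
  have "Min (u ` {i..n}) \<in> u ` {i..n}" using assms(1) by (intro Min_in) auto
  then have "tail \<mu> (Min (u ` {i..n})) = strict_tail \<mu> (Min (u ` {i..n}))"
    using assms(2) True by (intro tail_eq_strict_tail) auto
  then show ?thesis using True by simp
next
  case False
  have eq: "(MIN j\<in>{i..n}. u j + b * (s j - t)) = (MIN j\<in>{i..n}. u j + b * s j) + - b * t" for t
    using assms(1) Min_add_commute[of "{i..n}" "\<lambda>j. u j + b * s j" "- b * t"]
    by (simp add: algebra_simps)
  have "- b \<noteq> 0" using False by simp
  from AE_tail_eq_strict_tail[OF this, of "MIN j\<in>{i..n}. u j + b * s j"] show ?thesis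
    unfolding eq by (intro nn_integral_cong_AE) (auto elim!: eventually_mono)
qed

end

section \<open>The Markov property\<close>

context extremal_shot_noise
begin

text \<open>
The contribution at time \<open>s + t\<close> of the shots fired from time \<open>s\<close> on. A shot at time \<open>s\<close> exactly is
counted both here and in the past, which is harmless for a supremum and has probability \<open>0\<close>.
\<close>

definition later_shots :: "real \<Rightarrow> real \<Rightarrow> 'w \<Rightarrow> real" where
  "later_shots s t = shot_sup \<xi> {s..s + t} (\<lambda>r. b * (s + t - r))"

lemma gauge_on_later_shots: "0 \<le> s \<Longrightarrow> 0 \<le> t \<Longrightarrow> gauge_on {s..s + t} (\<lambda>r. b * (s + t - r))"
  by (intro gauge_on_interval continuous_intros) auto

lemma later_shots_borel [measurable]:
  "0 \<le> s \<Longrightarrow> 0 \<le> t \<Longrightarrow> later_shots s t \<in> borel_measurable P"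
  unfolding later_shots_def by (intro shot_sup_borel gauge_on_later_shots)

text \<open>
The void probabilities, and with them the distribution functions, depend on the intensities only.
\<close>

lemma distr_shot_sup_eqI:
  assumes g: "gauge_on I g" "gauge_on I' g'"
    and int: "\<And>u. (\<integral>\<^sup>+r\<in>I. strict_tail \<mu> (u + g r) \<partial>lborel) = (\<integral>\<^sup>+r\<in>I'. strict_tail \<mu> (u + g' r) \<partial>lborel)"
    and floor: "\<And>u. above_floor I g u \<longleftrightarrow> above_floor I' g' u"
  shows "distr P borel (shot_sup \<xi> I g) = distr P borel (shot_sup \<xi> I' g')"
proof (rule cdf_unique)
  note [measurable] = g[THEN shot_sup_borel]
  show "real_distribution (distr P borel (shot_sup \<xi> I g))"
    "real_distribution (distr P borel (shot_sup \<xi> I' g'))"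
    by (intro real_distribution_distr; measurable)+
  have cdf: "cdf (distr P borel X) u = \<P>(\<omega> in P. X \<omega> \<le> u)"
    if [measurable]: "X \<in> borel_measurable P" for X u
    by (simp add: cdf_def measure_distr vimage_def Int_def conj_commute)
  show "cdf (distr P borel (shot_sup \<xi> I g)) = cdf (distr P borel (shot_sup \<xi> I' g'))"
    by (rule ext) (simp add: cdf prob_shot_sup_le g int floor)
qed

lemma distr_later_shots:
  assumes "0 \<le> s" "0 \<le> t"
  shows "distr P borel (later_shots s t) = distr P borel (esn0 \<xi> b t)"
  unfolding later_shots_def esn0_eq_shot_sup
proof (rule distr_shot_sup_eqI)
  fix u
  show "(\<integral>\<^sup>+r\<in>{s..s + t}. strict_tail \<mu> (u + b * (s + t - r)) \<partial>lborel)
      = (\<integral>\<^sup>+r\<in>{0..t}. strict_tail \<mu> (u + b * (t - r)) \<partial>lborel)"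
    using nn_integral_affine_set[of "\<lambda>r. strict_tail \<mu> (u + b * (t - r))" "{0..t}" 1 "{s..s + t}" "- s"]
      ennreal_mult_divide_eq[of 1]
    by (simp add: algebra_simps)
  show "above_floor {s..s + t} (\<lambda>r. b * (s + t - r)) u \<longleftrightarrow> above_floor {0..t} (\<lambda>r. b * (t - r)) u"
  proof -
    have eq: "{s..s + t} = (\<lambda>r. r + s) ` {0..t}" by (simp add: add.commute)
    have "(\<forall>r\<in>{s..s + t}. - (b * (s + t - r)) \<le> u) \<longleftrightarrow> (\<forall>r\<in>{0..t}. - (b * (s + t - (r + s))) \<le> u)"
      unfolding eq by blast
    then show ?thesis by (simp add: above_floor_def)
  qed
qed (use assms in \<open>auto intro!: gauge_on_later_shots gauge_on_esn0\<close>)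

text \<open>
Both sides have the same upper bounds: the loss \<open>b * (s + t - r)\<close> of a shot at time \<open>r \<le> s\<close> is its
loss \<open>b * (s - r)\<close> until time \<open>s\<close> plus \<open>b * t\<close>.
\<close>

lemma AE_esn_flow:
  assumes s: "0 \<le> s" and t: "0 \<le> t"
  shows "AE \<omega> in P. esn \<xi> b x (s + t) \<omega> = max (max 0 (esn \<xi> b x s \<omega> - b * t)) (later_shots s t \<omega>)"
  using AE_bounded_shots[OF gauge_on_esn0[OF s]]
    AE_bounded_shots[OF gauge_on_esn0[OF add_nonneg_nonneg[OF s t]]]
    AE_bounded_shots[OF gauge_on_later_shots[OF s t]] AE_space
proof eventually_elim
  case (elim \<omega>)
  have le_esn0: "esn0 \<xi> b s \<omega> \<le> u \<longleftrightarrow> 0 \<le> u \<and> (\<forall>r\<in>{0..s}. \<xi> r \<omega> - b * (s - r) \<le> u)" for u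
    unfolding esn0_eq_shot_sup using elim(1) s by (intro shot_sup_le_iff) auto
  have le_esn0': "esn0 \<xi> b (s + t) \<omega> \<le> u \<longleftrightarrow> 0 \<le> u \<and> (\<forall>r\<in>{0..s + t}. \<xi> r \<omega> - b * (s + t - r) \<le> u)" for u
    unfolding esn0_eq_shot_sup using elim(2) s t by (intro shot_sup_le_iff) auto
  have le_later: "later_shots s t \<omega> \<le> u \<longleftrightarrow> 0 \<le> u \<and> (\<forall>r\<in>{s..s + t}. \<xi> r \<omega> - b * (s + t - r) \<le> u)" for u
    unfolding later_shots_def using elim(3) t by (intro shot_sup_le_iff) auto
  have split: "{0..s + t} = {0..s} \<union> {s..s + t}" using s t by auto
  have "esn \<xi> b x (s + t) \<omega> \<le> u \<longleftrightarrow> max (max 0 (esn \<xi> b x s \<omega> - b * t)) (later_shots s t \<omega>) \<le> u" for u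
  proof -
    have "max (max 0 (esn \<xi> b x s \<omega> - b * t)) (later_shots s t \<omega>) \<le> u \<longleftrightarrow>
        0 \<le> u \<and> esn \<xi> b x s \<omega> \<le> u + b * t \<and> later_shots s t \<omega> \<le> u" by auto
    also have "\<dots> \<longleftrightarrow> 0 \<le> u \<and> x - b * (s + t) \<le> u \<and> 0 \<le> u + b * t \<and>
        (\<forall>r\<in>{0..s}. \<xi> r \<omega> - b * (s + t - r) \<le> u) \<and> (\<forall>r\<in>{s..s + t}. \<xi> r \<omega> - b * (s + t - r) \<le> u)"
      unfolding esn_le_iff le_esn0 le_later by (auto simp: algebra_simps)
    also have "\<dots> \<longleftrightarrow> 0 \<le> u \<and> x - b * (s + t) \<le> u \<and>
        (\<forall>r\<in>{0..s}. \<xi> r \<omega> - b * (s + t - r) \<le> u) \<and> (\<forall>r\<in>{s..s + t}. \<xi> r \<omega> - b * (s + t - r) \<le> u)"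
    proof -
      \<comment> \<open>The time s itself belongs to the later times and has a nonnegative mark, which bounds
          u + b * t from below.\<close>
      have "0 \<le> u + b * t" if "\<forall>r\<in>{s..s + t}. \<xi> r \<omega> - b * (s + t - r) \<le> u"
        using bspec[OF that, of s] mark_nonneg[OF elim(4) s] t by simp
      then show ?thesis by blast
    qed
    also have "\<dots> \<longleftrightarrow> esn \<xi> b x (s + t) \<omega> \<le> u"
      unfolding esn_le_iff le_esn0' split by auto
    finally show ?thesis by simp
  qed
  then show ?case by (meson order_antisym order_refl)
qed

lemma emeasure_Lambda_time_null: "emeasure \<Lambda> {z\<in>space \<Lambda>. fst z = s} = 0"
proof -
  have [measurable]: "{z\<in>space \<Lambda>. fst z = s} \<in> sets \<Lambda>" by measurable
  have "Pair r -` {z\<in>space \<Lambda>. fst z = s} = {}" if "r \<noteq> s" for r using that by auto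
  then have "AE r in lborel. emeasure \<mu> (Pair r -` {z\<in>space \<Lambda>. fst z = s}) * indicator {0..} r = 0"
    using AE_lborel_singleton[of s] by (auto elim!: eventually_mono)
  then have "(\<integral>\<^sup>+r\<in>{0..}. emeasure \<mu> (Pair r -` {z\<in>space \<Lambda>. fst z = s}) \<partial>lborel) = (\<integral>\<^sup>+(r::real). 0 \<partial>lborel)"
    by (rule nn_integral_cong_AE)
  then show ?thesis by (subst emeasure_Lambda) simp_all
qed

text \<open>
The two sets can overlap at time \<open>s\<close> only, which is a null set for the intensity.
\<close>

lemma emeasure_Lambda_past_future:
  assumes A: "A \<in> sets \<Lambda>" "A \<subseteq> {..s} \<times> UNIV" and B: "B \<in> sets \<Lambda>" "B \<subseteq> {s..} \<times> UNIV"
  shows "emeasure \<Lambda> (A \<union> B) = emeasure \<Lambda> A + emeasure \<Lambda> B"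
proof -
  let ?N = "{z\<in>space \<Lambda>. fst z = s}"
  have N: "?N \<in> null_sets \<Lambda>" by (simp add: null_sets_def emeasure_Lambda_time_null)
  have "(A \<union> B) - ?N = (A - ?N) \<union> (B - ?N)" "(A - ?N) \<inter> (B - ?N) = {}"
    using assms sets.sets_into_space[OF A(1)] by fastforce+
  moreover have "emeasure \<Lambda> ((A \<union> B) - ?N) = emeasure \<Lambda> (A \<union> B)"
    "emeasure \<Lambda> (A - ?N) = emeasure \<Lambda> A" "emeasure \<Lambda> (B - ?N) = emeasure \<Lambda> B"
    using N A B by (auto intro!: emeasure_Diff_null_set)
  moreover have "emeasure \<Lambda> ((A - ?N) \<union> (B - ?N)) = emeasure \<Lambda> (A - ?N) + emeasure \<Lambda> (B - ?N)"
    using calculation(2) A B N by (intro plus_emeasure[symmetric]) auto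
  ultimately show ?thesis by simp
qed

text \<open>
All events in question are void events, those of the past for sets before time \<open>s\<close>, those of the
later shots for a set after time \<open>s\<close>. The intensities add up, so the probabilities multiply.
\<close>

lemma indep_past_later_shots:
  assumes s: "0 \<le> s" and t: "0 \<le> t" and J: "finite J" "J \<subseteq> {0..s} \<times> UNIV"
  shows "\<P>(\<omega> in P. (\<forall>(r, v)\<in>J. esn \<xi> b x r \<omega> \<le> v) \<and> later_shots s t \<omega> \<le> u)
    = \<P>(\<omega> in P. \<forall>(r, v)\<in>J. esn \<xi> b x r \<omega> \<le> v) * \<P>(\<omega> in P. later_shots s t \<omega> \<le> u)"
proof (cases "\<forall>(r, v)\<in>J. max 0 (x - b * r) \<le> v")
  case False
  then have "(\<forall>(r, v)\<in>J. esn \<xi> b x r \<omega> \<le> v) \<longleftrightarrow> False" for \<omega> by (auto simp: esn_le_iff)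
  then show ?thesis by (simp only:) simp
next
  case True
  \<comment> \<open>The index None stands for the later shots, Some (r, v) for the event that the process is at
      most v at time r.\<close>
  define I where "I = case_option {s..s + t} (\<lambda>(r::real, v::real). {0..r})"
  define g where "g = case_option (\<lambda>q. b * (s + t - q)) (\<lambda>(r, v::real) q. b * (r - q))"
  define w where "w = case_option u (\<lambda>(r::real, v::real). v)"
  let ?fl = "\<lambda>j. above_floor (I j) (g j) (w j)"
  let ?A = "\<Union>j\<in>Some ` J. epi (I j) (g j) (w j)"
  let ?B = "epi (I None) (g None) (w None)"
  have gauge: "gauge_on (I j) (g j)" if "j \<in> insert None (Some ` J)" for j
    using that J s t by (auto simp: I_def g_def intro!: gauge_on_esn0 gauge_on_later_shots)
  have epi: "epi (I j) (g j) (w j) \<in> sets \<Lambda>" if "j \<in> insert None (Some ` J)" for j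
    using gauge[OF that] by (intro epi_sets) (auto simp: gauge_on_def)
  have ev: "(\<forall>j\<in>Some ` J. shot_sup \<xi> (I j) (g j) \<omega> \<le> w j) \<longleftrightarrow> (\<forall>(r, v)\<in>J. esn \<xi> b x r \<omega> \<le> v)" for \<omega>
    using True by (auto simp: I_def g_def w_def esn_le_iff esn0_eq_shot_sup)
  have ev': "shot_sup \<xi> (I None) (g None) \<omega> \<le> w None \<longleftrightarrow> later_shots s t \<omega> \<le> u" for \<omega>
    by (simp add: I_def g_def w_def later_shots_def)
  have insert: "(\<forall>j\<in>insert None (Some ` J). Q j) \<longleftrightarrow> Q None \<and> (\<forall>j\<in>Some ` J. Q j)" for Q by blast
  have "\<P>(\<omega> in P. \<forall>j\<in>insert None (Some ` J). shot_sup \<xi> (I j) (g j) \<omega> \<le> w j)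
      = exp_minus (emeasure \<Lambda> (\<Union>j\<in>insert None (Some ` J). epi (I j) (g j) (w j)))
        * of_bool (\<forall>j\<in>insert None (Some ` J). ?fl j)"
    using J gauge by (intro prob_shot_sups_le) auto
  also have "(\<Union>j\<in>insert None (Some ` J). epi (I j) (g j) (w j)) = ?A \<union> ?B" by auto
  also have "emeasure \<Lambda> (?A \<union> ?B) = emeasure \<Lambda> ?A + emeasure \<Lambda> ?B"
  proof (rule emeasure_Lambda_past_future)
    show "?A \<in> sets \<Lambda>" using J epi by (intro sets.finite_UN) auto
    show "?B \<in> sets \<Lambda>" using epi by auto
    show "?A \<subseteq> {..s} \<times> UNIV" using J by (force simp: epi_def I_def)
    show "?B \<subseteq> {s..} \<times> UNIV" by (force simp: epi_def I_def)
  qed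
  also have "exp_minus \<dots> * of_bool (\<forall>j\<in>insert None (Some ` J). ?fl j)
      = (exp_minus (emeasure \<Lambda> ?A) * of_bool (\<forall>j\<in>Some ` J. ?fl j)) * (exp_minus (emeasure \<Lambda> ?B) * of_bool (?fl None))"
    by (simp only: exp_minus_add insert of_bool_conj mult_ac)
  also have "exp_minus (emeasure \<Lambda> ?A) * of_bool (\<forall>j\<in>Some ` J. ?fl j)
      = \<P>(\<omega> in P. \<forall>j\<in>Some ` J. shot_sup \<xi> (I j) (g j) \<omega> \<le> w j)"
    using J gauge by (intro prob_shot_sups_le[symmetric]) auto
  also have "exp_minus (emeasure \<Lambda> ?B) * of_bool (?fl None)
      = \<P>(\<omega> in P. shot_sup \<xi> (I None) (g None) \<omega> \<le> w None)"
    using prob_shot_sups_le[of "{None}" I g w] gauge by simp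
  finally show ?thesis
    unfolding insert ev ev' by (simp only: conj_commute)
qed

definition past :: "real \<Rightarrow> real \<Rightarrow> 'w measure" where
  "past x s = natural_filtration P (esn \<xi> b x) s"

lemma space_past [simp]: "space (past x s) = space P"
  by (simp add: past_def natural_filtration_def space_measure_of_conv)

lemma sets_past: "sets (past x s) =
    sigma_sets (space P) {esn \<xi> b x r -` B \<inter> space P | r B. 0 \<le> r \<and> r \<le> s \<and> B \<in> sets borel}"
  unfolding past_def natural_filtration_def by (intro sets_measure_of) auto

lemma esn_past_borel: "0 \<le> r \<Longrightarrow> r \<le> s \<Longrightarrow> esn \<xi> b x r \<in> borel_measurable (past x s)"
  by (rule measurableI) (auto simp: sets_past intro!: sigma_sets.Basic)

lemma subalgebra_past: "subalgebra P (past x s)"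
  unfolding subalgebra_def
proof (intro conjI)
  show "sets (past x s) \<subseteq> sets P"
    unfolding sets_past by (intro sets.sigma_sets_subset) (auto intro!: measurable_sets)
qed simp

text \<open>
The events \<open>{\<forall>(r, v)\<in>J. M r \<le> v}\<close> with finite \<open>J\<close> are stable under intersection and generate the
past, and similarly for the later shots. Hence independence extends from these events to the
generated \<open>\<sigma>\<close>-algebras.
\<close>

lemma indep_set_past_later_shots:
  assumes s: "0 \<le> s" and t: "0 \<le> t"
  shows "indep_set (sets (past x s)) (sigma_sets (space P) {later_shots s t -` B \<inter> space P | B. B \<in> sets borel})"
proof -
  define G1 where "G1 = {{\<omega>\<in>space P. \<forall>(r, v)\<in>J. esn \<xi> b x r \<omega> \<le> v} | J. finite J \<and> J \<subseteq> {0..s} \<times> UNIV}"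
  define G2 where "G2 = {{\<omega>\<in>space P. later_shots s t \<omega> \<le> u} | u. True}"
  note [measurable] = later_shots_borel[OF s t]
  have G1_sets: "G1 \<subseteq> sets P"
    unfolding G1_def
  proof safe
    fix J :: "(real \<times> real) set" assume J: "finite J" "J \<subseteq> {0..s} \<times> UNIV"
    have "{\<omega>\<in>space P. \<forall>p\<in>J. esn \<xi> b x (fst p) \<omega> \<le> snd p} \<in> sets P"
    proof (intro sets.sets_Collect_finite_All J)
      fix p assume "p \<in> J"
      with J have "0 \<le> fst p" by auto
      note [measurable] = esn_borel[OF this, of x]
      show "{\<omega>\<in>space P. esn \<xi> b x (fst p) \<omega> \<le> snd p} \<in> sets P" by measurable
    qed
    then show "{\<omega>\<in>space P. \<forall>(r, v)\<in>J. esn \<xi> b x r \<omega> \<le> v} \<in> sets P"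
      by (simp add: case_prod_unfold)
  qed
  have G2_sets: "G2 \<subseteq> sets P" unfolding G2_def by auto
  have "indep_set G1 G2"
    unfolding indep_sets2_eq
  proof (intro conjI ballI G1_sets G2_sets)
    fix A B assume "A \<in> G1" "B \<in> G2"
    then obtain J u where J: "finite J" "J \<subseteq> {0..s} \<times> UNIV"
      and A: "A = {\<omega>\<in>space P. \<forall>(r, v)\<in>J. esn \<xi> b x r \<omega> \<le> v}"
      and B: "B = {\<omega>\<in>space P. later_shots s t \<omega> \<le> u}"
      by (auto simp: G1_def G2_def)
    have "A \<inter> B = {\<omega>\<in>space P. (\<forall>(r, v)\<in>J. esn \<xi> b x r \<omega> \<le> v) \<and> later_shots s t \<omega> \<le> u}"
      by (auto simp: A B)
    then show "prob (A \<inter> B) = prob A * prob B"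
      using indep_past_later_shots[OF s t J, of x u] by (simp add: A B)
  qed
  moreover have "Int_stable G1"
  proof (rule Int_stableI)
    fix A B assume "A \<in> G1" "B \<in> G1"
    then obtain J J' where J: "finite J" "J \<subseteq> {0..s} \<times> UNIV" "finite J'" "J' \<subseteq> {0..s} \<times> UNIV"
      and A: "A = {\<omega>\<in>space P. \<forall>(r, v)\<in>J. esn \<xi> b x r \<omega> \<le> v}"
      and B: "B = {\<omega>\<in>space P. \<forall>(r, v)\<in>J'. esn \<xi> b x r \<omega> \<le> v}"
      unfolding G1_def by blast
    have "A \<inter> B = {\<omega>\<in>space P. \<forall>(r, v)\<in>J \<union> J'. esn \<xi> b x r \<omega> \<le> v}"
      unfolding A B by blast
    with J show "A \<inter> B \<in> G1" unfolding G1_def by blast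
  qed
  moreover have "Int_stable G2"
  proof (rule Int_stableI)
    fix A B assume "A \<in> G2" "B \<in> G2"
    then obtain u v where "A = {\<omega>\<in>space P. later_shots s t \<omega> \<le> u}" "B = {\<omega>\<in>space P. later_shots s t \<omega> \<le> v}"
      unfolding G2_def by blast
    then have "A \<inter> B = {\<omega>\<in>space P. later_shots s t \<omega> \<le> min u v}" by auto
    then show "A \<inter> B \<in> G2" unfolding G2_def by blast
  qed
  ultimately have ind: "indep_set (sigma_sets (space P) G1) (sigma_sets (space P) G2)"
    by (rule indep_set_sigma_sets)
  have "sets (past x s) \<subseteq> sigma_sets (space P) G1"
    unfolding sets_past
  proof (rule sigma_sets_mono, safe)
    fix r and B :: "real set" assume r: "0 \<le> r" "r \<le> s" and B: "B \<in> sets borel"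
    have G1_Pow: "G1 \<subseteq> Pow (space P)" using G1_sets sets.space_closed by blast
    have "esn \<xi> b x r \<in> borel_measurable (sigma (space P) G1)"
    proof (rule borel_measurableI_le)
      fix v
      have "{\<omega>\<in>space P. esn \<xi> b x r \<omega> \<le> v} \<in> G1"
        unfolding G1_def using r by (intro CollectI exI[of _ "{(r, v)}"]) auto
      then show "{\<omega>\<in>space (sigma (space P) G1). esn \<xi> b x r \<omega> \<le> v} \<in> sets (sigma (space P) G1)"
        using G1_Pow by (simp add: space_measure_of sets_measure_of sigma_sets.Basic)
    qed
    from measurable_sets[OF this B] show "esn \<xi> b x r -` B \<inter> space P \<in> sigma_sets (space P) G1"
      using G1_Pow by (simp add: space_measure_of sets_measure_of)
  qed
  moreover have "sigma_sets (space P) {later_shots s t -` B \<inter> space P | B. B \<in> sets borel}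
      \<subseteq> sigma_sets (space P) G2"
  proof (rule sigma_sets_mono, safe)
    fix B :: "real set" assume B: "B \<in> sets borel"
    have G2_Pow: "G2 \<subseteq> Pow (space P)" using G2_sets sets.space_closed by blast
    have "later_shots s t \<in> borel_measurable (sigma (space P) G2)"
    proof (rule borel_measurableI_le)
      fix v
      have "{\<omega>\<in>space P. later_shots s t \<omega> \<le> v} \<in> G2" unfolding G2_def by blast
      then show "{\<omega>\<in>space (sigma (space P) G2). later_shots s t \<omega> \<le> v} \<in> sets (sigma (space P) G2)"
        using G2_Pow by (simp add: space_measure_of sets_measure_of sigma_sets.Basic)
    qed
    from measurable_sets[OF this B] show "later_shots s t -` B \<inter> space P \<in> sigma_sets (space P) G2"
      using G2_Pow by (simp add: space_measure_of sets_measure_of)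
  qed
  ultimately show ?thesis
    using ind unfolding indep_sets2_eq by blast
qed

lemma distr_past_later_shots:
  assumes s: "0 \<le> s" and t: "0 \<le> t" and X: "X \<in> measurable (past x s) S"
  shows "distr P S X \<Otimes>\<^sub>M distr P borel (later_shots s t)
    = distr P (S \<Otimes>\<^sub>M borel) (\<lambda>\<omega>. (X \<omega>, later_shots s t \<omega>))"
proof -
  note [measurable] = later_shots_borel[OF s t]
  have XP [measurable]: "X \<in> measurable P S" by (rule measurable_from_subalg[OF subalgebra_past X])
  interpret D: prob_space "distr P borel (later_shots s t)" by (rule prob_space_distr) measurable
  interpret DX: prob_space "distr P S X" by (rule prob_space_distr) measurable
  show ?thesis
  proof (rule pair_measure_eqI)
    show "sigma_finite_measure (distr P S X)" "sigma_finite_measure (distr P borel (later_shots s t))"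
      by unfold_locales
    show "sets (distr P S X \<Otimes>\<^sub>M distr P borel (later_shots s t))
        = sets (distr P (S \<Otimes>\<^sub>M borel) (\<lambda>\<omega>. (X \<omega>, later_shots s t \<omega>)))"
      by (simp cong: sets_pair_measure_cong)
    fix A B assume "A \<in> sets (distr P S X)" "B \<in> sets (distr P borel (later_shots s t))"
    then have A [measurable]: "A \<in> sets S" and B [measurable]: "B \<in> sets borel" by auto
    have "X -` A \<inter> space P \<in> sets (past x s)" using measurable_sets[OF X A] by simp
    moreover have "later_shots s t -` B \<inter> space P
        \<in> sigma_sets (space P) {later_shots s t -` B \<inter> space P | B. B \<in> sets borel}"
      using B by (intro sigma_sets.Basic) blast
    ultimately have "prob ((X -` A \<inter> space P) \<inter> (later_shots s t -` B \<inter> space P))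
        = prob (X -` A \<inter> space P) * prob (later_shots s t -` B \<inter> space P)"
      using indep_set_past_later_shots[OF s t, of x] unfolding indep_sets2_eq by blast
    moreover have "(\<lambda>\<omega>. (X \<omega>, later_shots s t \<omega>)) -` (A \<times> B) \<inter> space P
        = (X -` A \<inter> space P) \<inter> (later_shots s t -` B \<inter> space P)" by auto
    moreover have "A \<times> B \<in> sets (S \<Otimes>\<^sub>M borel)" by measurable
    ultimately show "emeasure (distr P S X) A * emeasure (distr P borel (later_shots s t)) B
        = emeasure (distr P (S \<Otimes>\<^sub>M borel) (\<lambda>\<omega>. (X \<omega>, later_shots s t \<omega>))) (A \<times> B)"
      by (simp add: emeasure_distr emeasure_eq_measure ennreal_mult)
  qed
qed

lemma bounded_borel_bound:
  assumes "f \<in> bounded_borel"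
  obtains C where "\<And>y. 0 \<le> y \<Longrightarrow> \<bar>f y\<bar> \<le> C"
  using assms unfolding bounded_borel_def bounded_iff by auto

lemma bounded_borel_compose:
  assumes f: "f \<in> bounded_borel" and X: "X \<in> borel_measurable N" and nonneg: "\<And>z. z \<in> space N \<Longrightarrow> 0 \<le> X z"
  shows "(\<lambda>z. f (X z)) \<in> borel_measurable N"
proof -
  have "X \<in> measurable N state_space" using X nonneg by (intro measurable_restrict_space2) auto
  then show ?thesis using f unfolding bounded_borel_def by (auto intro: measurable_compose)
qed

lemma integrable_bounded_borel:
  assumes f: "f \<in> bounded_borel" and "finite_measure N" and X: "X \<in> borel_measurable N"
    and nonneg: "\<And>z. z \<in> space N \<Longrightarrow> 0 \<le> X z"
  shows "integrable N (\<lambda>z. f (X z))"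
proof -
  interpret N: finite_measure N by fact
  obtain C where "\<And>y. 0 \<le> y \<Longrightarrow> \<bar>f y\<bar> \<le> C" using bounded_borel_bound[OF f] by blast
  then show ?thesis
    using bounded_borel_compose[OF f X nonneg] nonneg by (intro N.integrable_const_bound[of _ C]) auto
qed

lemma transition_op_borel:
  assumes t: "0 \<le> t" and f: "f \<in> bounded_borel"
  shows "transition_op P (esn \<xi> b) t f \<in> borel_measurable borel"
proof -
  note [measurable] = esn0_borel[OF t]
  have "(\<lambda>(x, \<omega>). f (max (max 0 (x - b * t)) (esn0 \<xi> b t \<omega>))) \<in> borel_measurable (borel \<Otimes>\<^sub>M P)"
    unfolding case_prod_unfold by (rule bounded_borel_compose[OF f]) (auto simp: le_max_iff_disj)
  then show ?thesis
    unfolding transition_op_def[abs_def] esn_def by (rule borel_measurable_lebesgue_integral)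
qed

lemma transition_op_bounded_borel:
  assumes t: "0 \<le> t" and f: "f \<in> bounded_borel"
  shows "transition_op P (esn \<xi> b) t f \<in> bounded_borel"
proof -
  obtain C where C: "\<And>y. 0 \<le> y \<Longrightarrow> \<bar>f y\<bar> \<le> C" using bounded_borel_bound[OF f] by blast
  have "\<bar>transition_op P (esn \<xi> b) t f x\<bar> \<le> C" for x
  proof -
    have "\<bar>transition_op P (esn \<xi> b) t f x\<bar> \<le> (\<integral>\<omega>. \<bar>f (esn \<xi> b x t \<omega>)\<bar> \<partial>P)"
      unfolding transition_op_def by (rule integral_abs_bound)
    also have "\<dots> \<le> (\<integral>\<omega>. C \<partial>P)"
    proof (rule integral_mono)
      show "integrable P (\<lambda>\<omega>. \<bar>f (esn \<xi> b x t \<omega>)\<bar>)"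
        by (intro integrable_abs integrable_bounded_borel[OF f finite_measure_axioms esn_borel[OF t] esn_nonneg])
    qed (use C esn_nonneg in auto)
    finally show ?thesis by (simp add: prob_space)
  qed
  then show ?thesis
    using transition_op_borel[OF t f] unfolding bounded_borel_def
    by (auto simp: bounded_iff intro!: measurable_restrict_space1)
qed

text \<open>
By independence the later shots may be integrated out first, with the past fixed; as they have
the law of the process started at \<open>0\<close>, this yields the transition operator.
\<close>

lemma expectation_flow:
  assumes s: "0 \<le> s" and t: "0 \<le> t" and f: "f \<in> bounded_borel" and A: "A \<in> sets (past x s)"
  shows "(\<integral>\<omega>\<in>A. f (esn \<xi> b x (s + t) \<omega>) \<partial>P) = (\<integral>\<omega>\<in>A. transition_op P (esn \<xi> b) t f (esn \<xi> b x s \<omega>) \<partial>P)"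
proof -
  let ?g = "transition_op P (esn \<xi> b) t f"
  \<comment> \<open>The past enters only through membership in A and the value at time s.\<close>
  define X where "X \<omega> = (\<omega> \<in> A, esn \<xi> b x s \<omega>)" for \<omega>
  define S where "S = (count_space UNIV :: bool measure) \<Otimes>\<^sub>M (borel :: real measure)"
  define k where "k y z = f (max (max 0 (y - b * t)) z)" for y z
  define D where "D = distr P borel (later_shots s t)"
  note [measurable] = later_shots_borel[OF s t] esn0_borel[OF t] esn_borel[OF s] esn_borel[OF add_nonneg_nonneg[OF s t]]
  have AP [measurable]: "A \<in> sets P" using A subalgebra_past unfolding subalgebra_def by blast
  have X: "X \<in> measurable (past x s) S"
  proof -
    note [measurable] = A esn_past_borel[OF s order_refl, of x]
    show ?thesis unfolding X_def[abs_def] S_def by measurable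
  qed
  have XP [measurable]: "X \<in> measurable P S" by (rule measurable_from_subalg[OF subalgebra_past X])
  interpret D: prob_space D unfolding D_def by (rule prob_space_distr) measurable
  interpret DX: prob_space "distr P S X" by (rule prob_space_distr) measurable
  interpret pair: pair_prob_space "distr P S X" D ..
  obtain C where C: "\<And>y. 0 \<le> y \<Longrightarrow> \<bar>f y\<bar> \<le> C" using bounded_borel_bound[OF f] by blast
  have k_borel: "(\<lambda>(y, z). k y z) \<in> borel_measurable (borel \<Otimes>\<^sub>M borel)"
    unfolding case_prod_unfold k_def by (rule bounded_borel_compose[OF f]) (auto simp: le_max_iff_disj)
  define \<Phi> where "\<Phi> p = (if fst (fst p) then k (snd (fst p)) (snd p) else 0)" for p :: "(bool \<times> real) \<times> real"
  have \<Phi>_borel: "\<Phi> \<in> borel_measurable (S \<Otimes>\<^sub>M borel)"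
  proof -
    have [measurable]: "(\<lambda>p. k (snd (fst p)) (snd p)) \<in> borel_measurable (S \<Otimes>\<^sub>M borel)"
    proof -
      have "(\<lambda>p::(bool \<times> real) \<times> real. (snd (fst p), snd p)) \<in> measurable (S \<Otimes>\<^sub>M borel) (borel \<Otimes>\<^sub>M borel)"
        unfolding S_def by measurable
      from measurable_compose[OF this k_borel] show ?thesis by simp
    qed
    have [measurable]: "Measurable.pred (S \<Otimes>\<^sub>M borel) (\<lambda>p::(bool \<times> real) \<times> real. fst (fst p))"
      unfolding S_def by measurable
    show ?thesis unfolding \<Phi>_def[abs_def] by measurable
  qed
  have C0: "0 \<le> C" using C[of 0] by simp
  have \<Phi>_int: "integrable (distr P S X \<Otimes>\<^sub>M D) \<Phi>"
  proof (rule pair.P.integrable_const_bound[of _ C])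
    show "AE p in distr P S X \<Otimes>\<^sub>M D. norm (\<Phi> p) \<le> C"
      using C C0 by (auto simp: \<Phi>_def k_def le_max_iff_disj)
    show "\<Phi> \<in> borel_measurable (distr P S X \<Otimes>\<^sub>M D)"
      using \<Phi>_borel by (simp add: D_def cong: measurable_cong_sets)
  qed
  have gk: "?g y = (\<integral>z. k y z \<partial>D)" for y
  proof -
    have [measurable]: "k y \<in> borel_measurable borel"
      using measurable_compose[OF measurable_Pair1'[of y borel borel] k_borel] by simp
    have "(\<integral>z. k y z \<partial>D) = (\<integral>z. k y z \<partial>distr P borel (esn0 \<xi> b t))"
      by (simp add: D_def distr_later_shots[OF s t])
    also have "\<dots> = (\<integral>\<omega>. k y (esn0 \<xi> b t \<omega>) \<partial>P)" by (rule integral_distr) measurable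
    finally show ?thesis by (simp add: transition_op_def esn_def k_def)
  qed
  have "(\<integral>\<omega>\<in>A. f (esn \<xi> b x (s + t) \<omega>) \<partial>P) = (\<integral>\<omega>. \<Phi> (X \<omega>, later_shots s t \<omega>) \<partial>P)"
    unfolding set_lebesgue_integral_def
  proof (rule integral_cong_AE)
    have [measurable]: "(\<lambda>\<omega>. f (esn \<xi> b x (s + t) \<omega>)) \<in> borel_measurable P"
      by (rule bounded_borel_compose[OF f]) (auto simp: esn_nonneg)
    show "(\<lambda>\<omega>. indicator A \<omega> *\<^sub>R f (esn \<xi> b x (s + t) \<omega>)) \<in> borel_measurable P" by measurable
    have "(\<lambda>\<omega>. (X \<omega>, later_shots s t \<omega>)) \<in> measurable P (S \<Otimes>\<^sub>M borel)" by measurable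
    from measurable_compose[OF this \<Phi>_borel]
    show "(\<lambda>\<omega>. \<Phi> (X \<omega>, later_shots s t \<omega>)) \<in> borel_measurable P" .
    show "AE \<omega> in P. indicator A \<omega> *\<^sub>R f (esn \<xi> b x (s + t) \<omega>) = \<Phi> (X \<omega>, later_shots s t \<omega>)"
      using AE_esn_flow[OF s t, of x]
      by eventually_elim (simp add: \<Phi>_def X_def k_def indicator_def)
  qed
  also have "\<dots> = (\<integral>p. \<Phi> p \<partial>distr P (S \<Otimes>\<^sub>M borel) (\<lambda>\<omega>. (X \<omega>, later_shots s t \<omega>)))"
    using \<Phi>_borel by (intro integral_distr[symmetric]) measurable
  also have "distr P (S \<Otimes>\<^sub>M borel) (\<lambda>\<omega>. (X \<omega>, later_shots s t \<omega>)) = distr P S X \<Otimes>\<^sub>M D"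
    using distr_past_later_shots[OF s t X] by (simp add: D_def)
  also have "(\<integral>p. \<Phi> p \<partial>(distr P S X \<Otimes>\<^sub>M D)) = (\<integral>a. (\<integral>z. \<Phi> (a, z) \<partial>D) \<partial>distr P S X)"
    by (rule pair.integral_fst'[OF \<Phi>_int, symmetric])
  also have "\<dots> = (\<integral>a. (if fst a then ?g (snd a) else 0) \<partial>distr P S X)"
    by (intro Bochner_Integration.integral_cong refl) (simp add: \<Phi>_def gk)
  also have "\<dots> = (\<integral>\<omega>. (if fst (X \<omega>) then ?g (snd (X \<omega>)) else 0) \<partial>P)"
  proof (rule integral_distr)
    note [measurable] = transition_op_borel[OF t f]
    show "(\<lambda>a. if fst a then ?g (snd a) else 0) \<in> borel_measurable S" unfolding S_def by measurable
  qed measurable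
  also have "\<dots> = (\<integral>\<omega>\<in>A. ?g (esn \<xi> b x s \<omega>) \<partial>P)"
    unfolding set_lebesgue_integral_def
    by (intro Bochner_Integration.integral_cong refl) (simp add: X_def indicator_def)
  finally show ?thesis .
qed

text \<open>
The intensity does not charge the time \<open>0\<close>, so almost surely there is no shot at time \<open>0\<close>.
\<close>

lemma transition_op_0:
  assumes f: "f \<in> bounded_borel" and x: "0 \<le> x"
  shows "transition_op P (esn \<xi> b) 0 f x = f x"
proof -
  have "\<P>(\<omega> in P. esn0 \<xi> b 0 \<omega> \<le> 0) = 1"
    using prob_esn0_le[of 0 0] by (simp add: nn_integral_indicator_singleton)
  then have "AE \<omega> in P. esn0 \<xi> b 0 \<omega> \<le> 0"
    by (subst (asm) prob_Collect_eq_1) auto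
  then have "AE \<omega> in P. f (esn \<xi> b x 0 \<omega>) = f x"
    by eventually_elim (use x in \<open>simp add: esn_def max_absorb1\<close>)
  then have "transition_op P (esn \<xi> b) 0 f x = (\<integral>\<omega>. f x \<partial>P)"
    unfolding transition_op_def
    by (intro integral_cong_AE bounded_borel_compose[OF f]) (use x in \<open>auto simp: esn_nonneg\<close>)
  then show ?thesis by (simp add: prob_space)
qed

lemma markov_process_esn: "markov_process P (esn \<xi> b)"
  unfolding markov_process_def
proof (intro conjI ballI allI impI)
  fix x t :: real assume "0 \<le> x" "0 \<le> t"
  then show "esn \<xi> b x t \<in> measurable P state_space"
    by (intro measurable_restrict_space2) (auto simp: esn_nonneg)
next
  fix f t assume "f \<in> bounded_borel" "0 \<le> (t::real)"
  then show "transition_op P (esn \<xi> b) t f \<in> borel_measurable state_space"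
    by (intro measurable_restrict_space1 transition_op_borel)
next
  fix f x assume "f \<in> bounded_borel" "0 \<le> (x::real)"
  then show "transition_op P (esn \<xi> b) 0 f x = f x" by (rule transition_op_0)
next
  fix f and s t x :: real assume f: "f \<in> bounded_borel" and s: "0 \<le> s" and t: "0 \<le> t"
  have "space P \<in> sets (past x s)" using sets.top[of "past x s"] by simp
  from expectation_flow[OF s t f this]
  show "transition_op P (esn \<xi> b) (s + t) f x
      = transition_op P (esn \<xi> b) s (transition_op P (esn \<xi> b) t f) x"
    by (simp add: transition_op_def[of P _ "s + t"] transition_op_def[of P _ s]
        set_lebesgue_integral_def cong: Bochner_Integration.integral_cong)
next
  fix f and x s t :: real assume f: "f \<in> bounded_borel" and s: "0 \<le> s" and t: "0 \<le> t"
  interpret sub: finite_measure_subalgebra P "past x s"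
    by unfold_locales (rule subalgebra_past)
  have "AE \<omega> in P. real_cond_exp P (past x s) (\<lambda>\<omega>'. f (esn \<xi> b x (s + t) \<omega>')) \<omega>
      = transition_op P (esn \<xi> b) t f (esn \<xi> b x s \<omega>)"
  proof (rule sub.real_cond_exp_charact)
    show "integrable P (\<lambda>\<omega>'. f (esn \<xi> b x (s + t) \<omega>'))"
      using s t by (intro integrable_bounded_borel[OF f finite_measure_axioms] esn_borel esn_nonneg) auto
    show "integrable P (\<lambda>\<omega>. transition_op P (esn \<xi> b) t f (esn \<xi> b x s \<omega>))"
      using s t by (intro integrable_bounded_borel[OF transition_op_bounded_borel[OF t f] finite_measure_axioms]
          esn_borel esn_nonneg) auto
    show "(\<lambda>\<omega>. transition_op P (esn \<xi> b) t f (esn \<xi> b x s \<omega>)) \<in> borel_measurable (past x s)"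
      by (rule measurable_compose[OF esn_past_borel[OF s order_refl] transition_op_borel[OF t f]])
  qed (use expectation_flow[OF s t f] in blast)
  then show "AE \<omega> in P. real_cond_exp P (natural_filtration P (esn \<xi> b x) s) (\<lambda>\<omega>'. f (esn \<xi> b x (s + t) \<omega>')) \<omega>
      = transition_op P (esn \<xi> b) t f (esn \<xi> b x s \<omega>)"
    by (simp add: past_def)
qed

end

section \<open>The Feller property\<close>

lemma C0_subset_bounded_borel: "C0 \<subseteq> bounded_borel"
proof
  fix f assume f: "f \<in> C0"
  then have cont: "continuous_on {0..} f" and lim: "(f \<longlongrightarrow> 0) at_top" by (auto simp: C0_def)
  from lim have "eventually (\<lambda>x. dist (f x) 0 < 1) at_top" by (rule tendstoD) simp
  then obtain N where N: "\<And>x. N \<le> x \<Longrightarrow> \<bar>f x\<bar> < 1" by (auto simp: eventually_at_top_linorder)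
  have "bounded (f ` {0..N})"
    by (intro compact_imp_bounded compact_continuous_image continuous_on_subset[OF cont]) auto
  then obtain B where B: "\<And>x. x \<in> {0..N} \<Longrightarrow> \<bar>f x\<bar> \<le> B" unfolding bounded_iff by fastforce
  have "\<bar>f x\<bar> \<le> max B 1" if "0 \<le> x" for x
    using B[of x] N[of x] that by (cases "N \<le> x") auto
  then have "bounded (f ` {0..})" unfolding bounded_iff by (auto intro!: exI[of _ "max B 1"])
  moreover have "f \<in> borel_measurable state_space"
    using cont by (rule borel_measurable_continuous_on_restrict)
  ultimately show "f \<in> bounded_borel" by (simp add: bounded_borel_def)
qed

text \<open>
Uniform continuity on the compact set \<open>{0..N + 1}\<close>, combined with smallness of \<open>f\<close> beyond \<open>N\<close>; as
the distance is taken below \<open>1\<close>, two close points lie both in the one set or both in the other.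
\<close>

lemma C0_uniformly_continuous:
  assumes f: "f \<in> C0" and e: "0 < e"
  obtains d where "0 < d" "\<And>x y. 0 \<le> x \<Longrightarrow> 0 \<le> y \<Longrightarrow> \<bar>x - y\<bar> < d \<Longrightarrow> \<bar>f x - f y\<bar> < e"
proof -
  from f have cont: "continuous_on {0..} f" and lim: "(f \<longlongrightarrow> 0) at_top" by (auto simp: C0_def)
  from lim have "eventually (\<lambda>x. dist (f x) 0 < e / 2) at_top" by (rule tendstoD) (use e in simp)
  then obtain N where N: "\<And>x. N \<le> x \<Longrightarrow> \<bar>f x\<bar> < e / 2" by (auto simp: eventually_at_top_linorder)
  have "uniformly_continuous_on {0..N + 1} f"
    by (intro compact_uniformly_continuous continuous_on_subset[OF cont]) auto
  then obtain d where d: "0 < d"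
    and D: "\<And>x y. x \<in> {0..N + 1} \<Longrightarrow> y \<in> {0..N + 1} \<Longrightarrow> dist y x < d \<Longrightarrow> dist (f y) (f x) < e"
    using e unfolding uniformly_continuous_on_def by blast
  show ?thesis
  proof (rule that[of "min d 1"])
    fix x y :: real assume xy: "0 \<le> x" "0 \<le> y" "\<bar>x - y\<bar> < min d 1"
    show "\<bar>f x - f y\<bar> < e"
    proof (cases "x \<le> N + 1 \<and> y \<le> N + 1")
      case True
      then show ?thesis using D[of y x] xy by (simp add: dist_real_def)
    next
      case False
      then have "N \<le> x" "N \<le> y" using xy by auto
      with N[of x] N[of y] show ?thesis by linarith
    qed
  qed (use d in auto)
qed

context extremal_shot_noise
begin

text \<open>
The path value \<open>M x t\<close> is continuous in \<open>x\<close> and at least \<open>x - b * t\<close>, so dominated convergence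
yields both continuity and the limit at infinity.
\<close>

lemma transition_op_C0:
  assumes t: "0 \<le> t" and f: "f \<in> C0"
  shows "transition_op P (esn \<xi> b) t f \<in> C0"
proof -
  have fb: "f \<in> bounded_borel" using f C0_subset_bounded_borel by blast
  from f have cont: "continuous_on {0..} f" and lim: "(f \<longlongrightarrow> 0) at_top" by (auto simp: C0_def)
  obtain C where C: "\<And>y. 0 \<le> y \<Longrightarrow> \<bar>f y\<bar> \<le> C" using bounded_borel_bound[OF fb] by blast
  have meas [measurable]: "(\<lambda>\<omega>. f (esn \<xi> b x t \<omega>)) \<in> borel_measurable P" for x
    by (intro bounded_borel_compose[OF fb] esn_borel t esn_nonneg)
  have "continuous_on {0..} (transition_op P (esn \<xi> b) t f)"
    unfolding continuous_on_sequentially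
  proof safe
    fix X :: "nat \<Rightarrow> real" and a assume X: "X \<longlonglongrightarrow> a"
    have "(\<lambda>n. \<integral>\<omega>. f (esn \<xi> b (X n) t \<omega>) \<partial>P) \<longlonglongrightarrow> (\<integral>\<omega>. f (esn \<xi> b a t \<omega>) \<partial>P)"
    proof (rule integral_dominated_convergence[where w="\<lambda>_. C"])
      have "(\<lambda>n. f (esn \<xi> b (X n) t \<omega>)) \<longlonglongrightarrow> f (esn \<xi> b a t \<omega>)" for \<omega>
      proof (rule continuous_on_tendsto_compose[OF cont])
        show "(\<lambda>n. esn \<xi> b (X n) t \<omega>) \<longlonglongrightarrow> esn \<xi> b a t \<omega>"
          unfolding esn_def by (intro tendsto_intros X)
      qed (auto simp: esn_nonneg)
      then show "AE \<omega> in P. (\<lambda>n. f (esn \<xi> b (X n) t \<omega>)) \<longlonglongrightarrow> f (esn \<xi> b a t \<omega>)" by simp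
    qed (use C esn_nonneg in auto)
    then show "(transition_op P (esn \<xi> b) t f \<circ> X) \<longlonglongrightarrow> transition_op P (esn \<xi> b) t f a"
      by (simp add: transition_op_def comp_def)
  qed
  moreover have "(transition_op P (esn \<xi> b) t f \<longlongrightarrow> 0) at_top"
  proof -
    have "((\<lambda>x. \<integral>\<omega>. f (esn \<xi> b x t \<omega>) \<partial>P) \<longlongrightarrow> (\<integral>\<omega>. 0 \<partial>P)) at_top"
    proof (rule integral_dominated_convergence_at_top[where w="\<lambda>_. C"])
      have "((\<lambda>x. f (esn \<xi> b x t \<omega>)) \<longlongrightarrow> 0) at_top" for \<omega>
      proof (rule filterlim_compose[OF lim])
        have "LIM x at_top. - b * t + x :> at_top"
          by (intro filterlim_tendsto_add_at_top[OF tendsto_const] filterlim_ident)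
        then show "LIM x at_top. esn \<xi> b x t \<omega> :> at_top"
          by (rule filterlim_at_top_mono) (simp add: esn_def le_max_iff_disj)
      qed
      then show "AE \<omega> in P. ((\<lambda>x. f (esn \<xi> b x t \<omega>)) \<longlongrightarrow> 0) at_top" by simp
    qed (use C esn_nonneg in auto)
    then show ?thesis by (simp add: transition_op_def[abs_def])
  qed
  ultimately show ?thesis by (simp add: C0_def)
qed

lemma prob_gt:
  assumes [measurable]: "X \<in> borel_measurable P"
  shows "\<P>(\<omega> in P. (u::real) < X \<omega>) = 1 - \<P>(\<omega> in P. X \<omega> \<le> u)"
proof -
  have "{\<omega>\<in>space P. u < X \<omega>} = space P - {\<omega>\<in>space P. X \<omega> \<le> u}" by auto
  then show ?thesis by (simp add: prob_compl)
qed

text \<open>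
For small \<open>t\<close> the drift is at most \<open>d / 2\<close>, so that exceeding \<open>d\<close> takes a shot larger than \<open>d / 2\<close>
before time \<open>t\<close>, which has intensity at most \<open>tail \<mu> (d / 2) * t\<close>.
\<close>

lemma esn0_tendsto_0_in_probability:
  assumes d: "0 < d"
  shows "((\<lambda>t. \<P>(\<omega> in P. d < esn0 \<xi> b t \<omega>)) \<longlongrightarrow> 0) (at_right 0)"
proof -
  define T where "T = enn2real (tail \<mu> (d / 2))"
  have T: "tail \<mu> (d / 2) = ennreal T" using tail_finite[of "d / 2"] d by (simp add: T_def)
  have T0: "0 \<le> T" by (simp add: T_def)
  have small: "eventually (\<lambda>t. 0 < t \<and> \<bar>b\<bar> * t < d / 2) (at_right 0)"
  proof (intro eventually_conj eventually_at_right_less)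
    have "((\<lambda>t. \<bar>b\<bar> * t) \<longlongrightarrow> \<bar>b\<bar> * 0) (at_right 0)" by (intro tendsto_intros)
    then show "eventually (\<lambda>t. \<bar>b\<bar> * t < d / 2) (at_right 0)"
      by (rule order_tendstoD) (use d in simp)
  qed
  have bound: "\<P>(\<omega> in P. d < esn0 \<xi> b t \<omega>) \<le> T * t" if t: "0 < t" "\<bar>b\<bar> * t < d / 2" for t
  proof -
    have drift: "\<bar>b * q\<bar> \<le> d / 2" if "0 \<le> q" "q \<le> t" for q
    proof -
      have "\<bar>b * q\<bar> \<le> \<bar>b\<bar> * t" using that by (simp add: abs_mult mult_left_mono)
      with t show ?thesis by simp
    qed
    have "(\<integral>\<^sup>+r\<in>{0..t}. strict_tail \<mu> (d + b * (t - r)) \<partial>lborel) \<le> (\<integral>\<^sup>+r. tail \<mu> (d / 2) * indicator {0..t} r \<partial>lborel)"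
    proof (rule nn_integral_mono)
      fix r
      have "strict_tail \<mu> (d + b * (t - r)) \<le> tail \<mu> (d / 2)" if "r \<in> {0..t}"
      proof -
        have "d / 2 \<le> d + b * (t - r)" using drift[of "t - r"] that by auto
        from strict_tail_mono[OF this] strict_tail_le_tail[of "d / 2"] show ?thesis by simp
      qed
      then show "strict_tail \<mu> (d + b * (t - r)) * indicator {0..t} r \<le> tail \<mu> (d / 2) * indicator {0..t} r"
        by (auto simp: indicator_def)
    qed
    also have "\<dots> = ennreal (T * t)"
      using t by (simp add: nn_integral_cmult_indicator T ennreal_mult T0)
    finally have I: "(\<integral>\<^sup>+r\<in>{0..t}. strict_tail \<mu> (d + b * (t - r)) \<partial>lborel) \<le> ennreal (T * t)" .
    have "max 0 (- b * t) \<le> d" using drift[of t] t d by auto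
    then have "\<P>(\<omega> in P. d < esn0 \<xi> b t \<omega>)
        = 1 - exp_minus (\<integral>\<^sup>+r\<in>{0..t}. strict_tail \<mu> (d + b * (t - r)) \<partial>lborel)"
      using t by (simp add: prob_gt prob_esn0_le)
    also have "\<dots> \<le> T * t"
      using order_trans[OF exp_minus_ge_ennreal I] t T0 by simp
    finally show ?thesis .
  qed
  show ?thesis
  proof (rule tendsto_sandwich[of "\<lambda>_. 0" _ _ "\<lambda>t. T * t"])
    have "((\<lambda>t. T * t) \<longlongrightarrow> T * 0) (at_right 0)" by (intro tendsto_intros)
    then show "((\<lambda>t. T * t) \<longlongrightarrow> 0) (at_right 0)" by simp
    show "eventually (\<lambda>t. \<P>(\<omega> in P. d < esn0 \<xi> b t \<omega>) \<le> T * t) (at_right 0)"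
      using small by eventually_elim (use bound in blast)
  qed auto
qed

text \<open>
Unless \<open>M 0 t\<close> exceeds \<open>d / 2\<close>, the value \<open>M x t\<close> lies within \<open>d\<close> of \<open>x\<close>, uniformly in \<open>x\<close>.
\<close>

lemma transition_op_uniform_limit:
  assumes f: "f \<in> C0"
  shows "uniform_limit {0..} (\<lambda>t. transition_op P (esn \<xi> b) t f) f (at_right 0)"
proof (rule uniform_limitI)
  fix e :: real assume e: "0 < e"
  have fb: "f \<in> bounded_borel" using f C0_subset_bounded_borel by blast
  obtain C where C: "\<And>y. 0 \<le> y \<Longrightarrow> \<bar>f y\<bar> \<le> C" using bounded_borel_bound[OF fb] by blast
  obtain d where d: "0 < d"
    and D: "\<And>x y. 0 \<le> x \<Longrightarrow> 0 \<le> y \<Longrightarrow> \<bar>x - y\<bar> < d \<Longrightarrow> \<bar>f x - f y\<bar> < e / 2"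
    using C0_uniformly_continuous[OF f, of "e / 2"] e by auto
  have "((\<lambda>t. 2 * C * \<P>(\<omega> in P. d / 2 < esn0 \<xi> b t \<omega>)) \<longlongrightarrow> 2 * C * 0) (at_right 0)"
    using d by (intro tendsto_intros esn0_tendsto_0_in_probability) simp
  then have "eventually (\<lambda>t. 2 * C * \<P>(\<omega> in P. d / 2 < esn0 \<xi> b t \<omega>) < e / 2) (at_right 0)"
    by (rule order_tendstoD) (use e in simp)
  moreover have "eventually (\<lambda>t. \<bar>b\<bar> * t < d / 2) (at_right 0)"
  proof -
    have "((\<lambda>t. \<bar>b\<bar> * t) \<longlongrightarrow> \<bar>b\<bar> * 0) (at_right 0)" by (intro tendsto_intros)
    then show ?thesis by (rule order_tendstoD) (use d in simp)
  qed
  ultimately show "\<forall>\<^sub>F t in at_right 0. \<forall>x\<in>{0..}. dist (transition_op P (esn \<xi> b) t f x) (f x) < e"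
    using eventually_at_right_less[of "0::real"]
  proof eventually_elim
    case (elim t)
    note [measurable] = esn0_borel[OF less_imp_le[OF elim(3)]]
    have t: "0 \<le> t" using elim by simp
    let ?E = "{\<omega>\<in>space P. d / 2 < esn0 \<xi> b t \<omega>}"
    have E: "?E \<in> sets P" by measurable
    show ?case
    proof
      fix x :: real assume "x \<in> {0..}"
      then have x: "0 \<le> x" by simp
      have int: "integrable P (\<lambda>\<omega>. f (esn \<xi> b x t \<omega>))"
        by (rule integrable_bounded_borel[OF fb finite_measure_axioms esn_borel[OF t] esn_nonneg])
      have pt: "\<bar>f (esn \<xi> b x t \<omega>) - f x\<bar> \<le> e / 2 + 2 * C * indicator ?E \<omega>" if "\<omega> \<in> space P" for \<omega>
      proof (cases "\<omega> \<in> ?E")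
        case True
        then show ?thesis using C[OF x] C[OF esn_nonneg[of x t \<omega>]] e by simp
      next
        case False
        then have "esn0 \<xi> b t \<omega> \<le> d / 2" using that by auto
        moreover have "\<bar>b * t\<bar> < d / 2" using elim(2) t by (simp add: abs_mult)
        ultimately have "esn \<xi> b x t \<omega> < x + d"
          using x d unfolding esn_def by (simp add: abs_less_iff)
        moreover have "x - b * t \<le> esn \<xi> b x t \<omega>" by (simp add: esn_def le_max_iff_disj)
        ultimately have "\<bar>esn \<xi> b x t \<omega> - x\<bar> < d"
          using \<open>\<bar>b * t\<bar> < d / 2\<close> d unfolding abs_less_iff by linarith
        from D[OF esn_nonneg x this] show ?thesis using False by simp
      qed
      have "\<bar>transition_op P (esn \<xi> b) t f x - f x\<bar> = \<bar>\<integral>\<omega>. f (esn \<xi> b x t \<omega>) - f x \<partial>P\<bar>"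
        using int by (simp add: transition_op_def prob_space)
      also have "\<dots> \<le> (\<integral>\<omega>. \<bar>f (esn \<xi> b x t \<omega>) - f x\<bar> \<partial>P)" by (rule integral_abs_bound)
      also have "\<dots> \<le> (\<integral>\<omega>. e / 2 + 2 * C * indicator ?E \<omega> \<partial>P)"
      proof (rule integral_mono)
        show "integrable P (\<lambda>\<omega>. \<bar>f (esn \<xi> b x t \<omega>) - f x\<bar>)"
          using int by (intro integrable_abs Bochner_Integration.integrable_diff) auto
        show "integrable P (\<lambda>\<omega>. e / 2 + 2 * C * indicator ?E \<omega>)"
          using E by (intro Bochner_Integration.integrable_add integrable_mult_right integrable_real_indicator)
            (auto simp: less_top[symmetric])
      qed (use pt in auto)
      also have "\<dots> = e / 2 + 2 * C * prob ?E"
        using E by (subst Bochner_Integration.integral_add)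
          (auto simp: prob_space less_top[symmetric])
      also have "\<dots> < e" using elim(1) by simp
      finally show "dist (transition_op P (esn \<xi> b) t f x) (f x) < e" by (simp add: dist_real_def)
    qed
  qed
qed

end

section \<open>Time reversal and the stationary law\<close>

lemma nn_integral_Icc_tendsto_at_top:
  fixes f :: "real \<Rightarrow> ennreal"
  assumes [measurable]: "f \<in> borel_measurable borel"
  shows "((\<lambda>t. \<integral>\<^sup>+r\<in>{0..t}. f r \<partial>lborel) \<longlongrightarrow> (\<integral>\<^sup>+r\<in>{0..}. f r \<partial>lborel)) at_top"
proof -
  define m where "m A = emeasure (density lborel f) A" for A
  have m: "(\<integral>\<^sup>+r\<in>A. f r \<partial>lborel) = m A" if "A \<in> sets borel" for A
    unfolding m_def using that by (intro emeasure_density[symmetric]) auto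
  have mono: "m A \<le> m B" if "A \<subseteq> B" "B \<in> sets borel" for A B
    unfolding m_def using that by (intro emeasure_mono) auto
  have "(\<lambda>n. m {0..real n}) \<longlonglongrightarrow> m (\<Union>n. {0..real n})"
    unfolding m_def by (intro Lim_emeasure_incseq) (auto simp: incseq_def)
  also have "(\<Union>n. {0..real n}) = {0..}" by (auto intro: real_arch_simple)
  finally have lim: "(\<lambda>n. m {0..real n}) \<longlonglongrightarrow> m {0..}" .
  have "((\<lambda>t. m {0..t}) \<longlongrightarrow> m {0..}) at_top"
  proof (rule order_tendstoI)
    fix a assume "a < m {0..}"
    from order_tendstoD(1)[OF lim this] obtain n :: nat where n: "a < m {0..real n}"
      by (auto simp: eventually_sequentially)
    have "a < m {0..t}" if "real n \<le> t" for t
      using n mono[of "{0..real n}" "{0..t}"] that by auto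
    then show "eventually (\<lambda>t. a < m {0..t}) at_top" by (auto simp: eventually_at_top_linorder)
  next
    fix a assume "m {0..} < a"
    then have "m {0..t} < a" for t using mono[of "{0..t}" "{0..}"] by auto
    then show "eventually (\<lambda>t. m {0..t} < a) at_top" by simp
  qed
  then show ?thesis by (simp add: m)
qed

lemma nn_integral_Ici_tendsto_0:
  fixes f :: "real \<Rightarrow> ennreal"
  assumes [measurable]: "f \<in> borel_measurable borel" and fin: "(\<integral>\<^sup>+r\<in>{c..}. f r \<partial>lborel) < \<infinity>"
  shows "((\<lambda>t. \<integral>\<^sup>+r\<in>{t..}. f r \<partial>lborel) \<longlongrightarrow> 0) at_top"
proof -
  define m where "m A = emeasure (density lborel f) A" for A
  have m: "(\<integral>\<^sup>+r\<in>A. f r \<partial>lborel) = m A" if "A \<in> sets borel" for A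
    unfolding m_def using that by (intro emeasure_density[symmetric]) auto
  have mono: "m A \<le> m B" if "A \<subseteq> B" "B \<in> sets borel" for A B
    unfolding m_def using that by (intro emeasure_mono) auto
  have fin': "m {c + real n..} \<noteq> \<infinity>" for n
    using fin mono[of "{c + real n..}" "{c..}"] by (auto simp: m top_unique)
  have "(\<lambda>n. m {c + real n..}) \<longlonglongrightarrow> m (\<Inter>n. {c + real n..})"
    using fin' unfolding m_def by (intro Lim_emeasure_decseq) (auto simp: decseq_def)
  also have "(\<Inter>n. {c + real n..}) = {}"
  proof -
    have False if "\<And>n. c + real n \<le> x" for x
    proof -
      obtain n :: nat where "x - c < n" using reals_Archimedean2 by blast
      with that[of n] show False by simp
    qed
    then show ?thesis by auto
  qed
  finally have lim: "(\<lambda>n. m {c + real n..}) \<longlonglongrightarrow> 0" by (simp add: m_def)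
  have "((\<lambda>t. m {t..}) \<longlongrightarrow> 0) at_top"
  proof (rule order_tendstoI)
    fix a :: ennreal assume "0 < a"
    from order_tendstoD(2)[OF lim this] obtain n :: nat where n: "m {c + real n..} < a"
      by (auto simp: eventually_sequentially)
    have "m {t..} < a" if "c + real n \<le> t" for t
      using n mono[of "{t..}" "{c + real n..}"] that by auto
    then show "eventually (\<lambda>t. m {t..} < a) at_top" by (auto simp: eventually_at_top_linorder)
  qed auto
  then show ?thesis by (simp add: m)
qed

lemma nn_integral_Icc_tendsto_0:
  fixes f :: "real \<Rightarrow> ennreal"
  assumes [measurable]: "f \<in> borel_measurable borel" and fin: "(\<integral>\<^sup>+r\<in>{0..1}. f r \<partial>lborel) < \<infinity>"
  shows "((\<lambda>t. \<integral>\<^sup>+r\<in>{0..t}. f r \<partial>lborel) \<longlongrightarrow> 0) (at_right 0)"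
proof -
  define m where "m A = emeasure (density lborel f) A" for A
  have m: "(\<integral>\<^sup>+r\<in>A. f r \<partial>lborel) = m A" if "A \<in> sets borel" for A
    unfolding m_def using that by (intro emeasure_density[symmetric]) auto
  have mono: "m A \<le> m B" if "A \<subseteq> B" "B \<in> sets borel" for A B
    unfolding m_def using that by (intro emeasure_mono) auto
  have fin': "m {0..inverse (real (Suc n))} \<noteq> \<infinity>" for n
    using fin mono[of "{0..inverse (real (Suc n))}" "{0..1}"]
    by (auto simp: m top_unique inverse_le_1_iff)
  have "(\<lambda>n. m {0..inverse (real (Suc n))}) \<longlonglongrightarrow> m (\<Inter>n. {0..inverse (real (Suc n))})"
    using fin' unfolding m_def
    by (intro Lim_emeasure_decseq) (auto simp: decseq_def intro: order_trans le_imp_inverse_le)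
  also have "(\<Inter>n. {0..inverse (real (Suc n))}) = {0}"
  proof -
    have "x \<le> 0" if "\<And>n. x \<le> inverse (real (Suc n))" for x
    proof (rule ccontr)
      assume "\<not> x \<le> 0"
      then obtain n where "inverse (real (Suc n)) < x" by (metis not_le reals_Archimedean)
      with that[of n] show False by simp
    qed
    then show ?thesis by (auto intro!: antisym)
  qed
  also have "m {0} = 0"
    using AE_lborel_singleton[of "0::real"] unfolding m_def
    by (subst emeasure_density) (auto simp: nn_integral_0_iff_AE elim!: eventually_mono)
  finally have lim: "(\<lambda>n. m {0..inverse (real (Suc n))}) \<longlonglongrightarrow> 0" .
  have "((\<lambda>t. m {0..t}) \<longlongrightarrow> 0) (at_right 0)"
  proof (rule order_tendstoI)
    fix a :: ennreal assume "0 < a"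
    from order_tendstoD(2)[OF lim this] obtain n :: nat where n: "m {0..inverse (real (Suc n))} < a"
      by (auto simp: eventually_sequentially)
    have "m {0..t} < a" if "t < inverse (real (Suc n))" for t
      using n mono[of "{0..t}" "{0..inverse (real (Suc n))}"] that by (auto intro: le_less_trans)
    then show "eventually (\<lambda>t. m {0..t} < a) (at_right 0)"
      unfolding eventually_at_right_field by (intro exI[of _ "inverse (real (Suc n))"]) simp
  qed auto
  then show ?thesis by (simp add: m)
qed

lemma state_space_measure_eqI:
  assumes p: "prob_space p" "sets p = sets state_space"
    and q: "prob_space q" "sets q = sets state_space"
    and eq: "\<And>u. 0 \<le> u \<Longrightarrow> emeasure p {0..u} = emeasure q {0..u}"
  shows "p = q"
proof -
  have space: "space p = {0..}" "space q = {0..}"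
    using p(2)[THEN sets_eq_imp_space_eq] q(2)[THEN sets_eq_imp_space_eq] by auto
  have id: "(\<lambda>x. x) \<in> borel_measurable r" if "sets r = sets state_space" for r :: "real measure"
    unfolding measurable_cong_sets[OF that refl] by (rule measurable_restrict_space1) simp
  note [measurable] = id[OF p(2)] id[OF q(2)]
  have dist: "emeasure (distr r borel (\<lambda>x. x)) A = emeasure r (A \<inter> {0..})"
    if "sets r = sets state_space" "A \<in> sets borel" for r A
    using emeasure_distr[OF id[OF that(1)] that(2)] sets_eq_imp_space_eq[OF that(1)] by simp
  have "distr p borel (\<lambda>x. x) = distr q borel (\<lambda>x. x)"
  proof (rule cdf_unique)
    show "real_distribution (distr p borel (\<lambda>x. x))" "real_distribution (distr q borel (\<lambda>x. x))"
      using p q by (auto intro!: prob_space.real_distribution_distr)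
    show "cdf (distr p borel (\<lambda>x. x)) = cdf (distr q borel (\<lambda>x. x))"
    proof
      fix u :: real
      have "{..u} \<inter> {0..} = (if 0 \<le> u then {0..u} else {})" by auto
      then show "cdf (distr p borel (\<lambda>x. x)) u = cdf (distr q borel (\<lambda>x. x)) u"
        unfolding cdf_def measure_def using eq by (simp add: dist p q)
    qed
  qed
  then have *: "emeasure p (A \<inter> {0..}) = emeasure q (A \<inter> {0..})" if "A \<in> sets borel" for A
    using dist[OF p(2) that] dist[OF q(2) that] by metis
  show ?thesis
  proof (rule measure_eqI)
    fix A assume A: "A \<in> sets p"
    then obtain B where "B \<in> sets borel" "A = B \<inter> {0..}"
      unfolding p(2) by (auto simp: sets_restrict_space)
    then show "emeasure p A = emeasure q A" using * by simp
  qed (simp add: p q)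
qed

lemma d_TV_bounds:
  assumes "\<And>A. A \<in> sets p \<Longrightarrow> \<bar>measure p A - measure q A\<bar> \<le> c"
  shows "0 \<le> d_TV p q" "d_TV p q \<le> c"
proof -
  have bdd: "bdd_above ((\<lambda>A. \<bar>measure p A - measure q A\<bar>) ` sets p)"
    using assms by (auto simp: bdd_above_def)
  show "0 \<le> d_TV p q"
    unfolding d_TV_def by (rule cSUP_upper2[OF bdd, of "{}"]) auto
  show "d_TV p q \<le> c"
    unfolding d_TV_def by (rule cSUP_least) (use assms in auto)
qed

context extremal_shot_noise
begin

text \<open>
The coupling inequality: the events coincide on \<open>F\<close>.
\<close>

lemma measure_diff_le:
  assumes [measurable]: "E \<in> sets P" "E' \<in> sets P" "F \<in> sets P"
    and eq: "AE \<omega> in P. \<omega> \<in> F \<longrightarrow> (\<omega> \<in> E \<longleftrightarrow> \<omega> \<in> E')"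
  shows "\<bar>prob E - prob E'\<bar> \<le> 1 - prob F"
proof -
  have *: "prob A \<le> prob B + (1 - prob F)"
    if [measurable]: "A \<in> sets P" "B \<in> sets P" and "AE \<omega> in P. \<omega> \<in> F \<longrightarrow> (\<omega> \<in> A \<longleftrightarrow> \<omega> \<in> B)" for A B
  proof -
    have "AE \<omega> in P. \<omega> \<in> A \<longrightarrow> \<omega> \<in> B \<union> (space P - F)"
      using that(3) AE_space by eventually_elim auto
    then have "prob A \<le> prob (B \<union> (space P - F))"
      by (rule finite_measure_mono_AE) auto
    also have "\<dots> \<le> prob B + prob (space P - F)" by (rule measure_Un_le) auto
    finally show ?thesis by (simp add: prob_compl)
  qed
  have "AE \<omega> in P. \<omega> \<in> F \<longrightarrow> (\<omega> \<in> E' \<longleftrightarrow> \<omega> \<in> E)" using eq by eventually_elim auto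
  with *[of E E'] *[of E' E] eq show ?thesis by (simp add: abs_le_iff)
qed

text \<open>
The shots seen backwards from the time of observation: a point at reversed time \<open>r\<close> has lost
\<open>b * r\<close>. In contrast to the gauges \<open>b * (t - r)\<close> this gauge does not depend on the time of
observation, so the suprema over \<open>{0..t}\<close> are monotone in \<open>t\<close>.
\<close>

definition rev_shots :: "real set \<Rightarrow> 'w \<Rightarrow> real" where
  "rev_shots I = shot_sup \<xi> I (\<lambda>r. b * r)"

lemma strict_tail_reversal:
  "(\<integral>\<^sup>+r\<in>{0..t}. strict_tail \<mu> (u + b * (t - r)) \<partial>lborel) = (\<integral>\<^sup>+r\<in>{0..t}. strict_tail \<mu> (u + b * r) \<partial>lborel)"
  using nn_integral_affine_set[of "\<lambda>r. strict_tail \<mu> (u + b * r)" "{0..t}" "- 1" "{0..t}" t]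
    ennreal_mult_divide_eq[of 1]
  by (auto simp: algebra_simps)

lemma above_floor_rev_shots:
  assumes "0 \<le> b" "I \<subseteq> {0..}"
  shows "above_floor I (\<lambda>r. b * r) u \<longleftrightarrow> 0 \<le> u"
proof -
  have "0 \<le> b * r" if "r \<in> I" for r using assms that by auto
  then have "- (b * r) \<le> u" if "0 \<le> u" "r \<in> I" for r using that by force
  then show ?thesis by (auto simp: above_floor_def)
qed

lemma gauge_on_rev_shots: "0 \<le> t \<Longrightarrow> gauge_on {0..t} (\<lambda>r. b * r)"
  by (intro gauge_on_interval continuous_intros) auto

text \<open>
Reflecting \<open>{0..t}\<close> preserves Lebesgue measure and exchanges the two gauges.
\<close>

lemma distr_rev_shots:
  assumes "0 \<le> b" "0 \<le> t"
  shows "distr P borel (esn0 \<xi> b t) = distr P borel (rev_shots {0..t})"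
  unfolding esn0_eq_shot_sup rev_shots_def
proof (rule distr_shot_sup_eqI)
  show "above_floor {0..t} (\<lambda>r. b * (t - r)) u \<longleftrightarrow> above_floor {0..t} (\<lambda>r. b * r) u" for u
    using assms by (simp add: above_floor_esn0 above_floor_rev_shots)
qed (use assms in \<open>auto intro: gauge_on_esn0 gauge_on_rev_shots strict_tail_reversal\<close>)

lemma gauge_on_rev_shots_infinite:
  assumes b: "0 < b" and fin: "(\<integral>\<^sup>+v\<in>{1..}. tail \<mu> v \<partial>lborel) < \<infinity>"
  shows "gauge_on {0..} (\<lambda>r. b * r)"
proof -
  have "emeasure \<Lambda> (epi {0..} (\<lambda>r. b * r) 1) = (\<integral>\<^sup>+r\<in>{0..}. strict_tail \<mu> (1 + b * r) \<partial>lborel)"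
    by (intro emeasure_epi) auto
  also have "\<dots> = (\<integral>\<^sup>+v\<in>{1..}. tail \<mu> v \<partial>lborel) / ennreal \<bar>b\<bar>"
    using b by (intro strict_tail_affine_integral) (auto simp: zero_le_mult_iff)
  also have "\<dots> < \<infinity>" using b fin by (simp add: ennreal_divide_eq_top_iff less_top[symmetric])
  finally have "\<exists>K. emeasure \<Lambda> (epi {0..} (\<lambda>r. b * r) K) < \<infinity>" by blast
  moreover have "\<exists>C. \<forall>r\<in>{0..}. - C \<le> b * r" using b by (intro exI[of _ 0]) simp
  ultimately show ?thesis unfolding gauge_on_def by auto
qed

definition stationary_law :: "real measure" where
  "stationary_law = distr P state_space (\<lambda>\<omega>. max 0 (rev_shots {0..} \<omega>))"

lemma max_0_state_space: "X \<in> borel_measurable N \<Longrightarrow> (\<lambda>z. max 0 (X z)) \<in> measurable N state_space"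
  by (intro measurable_restrict_space2) auto

lemma rev_integral:
  assumes b: "0 < b"
  shows "(\<integral>\<^sup>+r\<in>{t..}. strict_tail \<mu> (u + b * r) \<partial>lborel) = (\<integral>\<^sup>+v\<in>{u + b * t..}. tail \<mu> v \<partial>lborel) / ennreal b"
  using strict_tail_affine_integral[of "{u + b * t..}" b "{t..}" u] b by simp

context
  assumes b: "0 < b" and fin: "(\<integral>\<^sup>+v\<in>{1..}. tail \<mu> v \<partial>lborel) < \<infinity>"
begin

lemma rev_shots_infinite_borel [measurable]: "rev_shots {0..} \<in> borel_measurable P"
  unfolding rev_shots_def by (intro shot_sup_borel gauge_on_rev_shots_infinite b fin)

lemma prob_space_stationary_law: "prob_space stationary_law"
  unfolding stationary_law_def by (intro prob_space_distr max_0_state_space rev_shots_infinite_borel)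

lemma sets_stationary_law [simp]: "sets stationary_law = sets state_space"
  by (simp add: stationary_law_def)

lemma measure_stationary_law:
  assumes A: "A \<in> sets state_space"
  shows "measure stationary_law A = \<P>(\<omega> in P. max 0 (rev_shots {0..} \<omega>) \<in> A)"
  unfolding stationary_law_def using A
  by (simp add: measure_distr max_0_state_space vimage_def Int_def conj_commute)

lemma Icc_state_space: "{0..u} \<in> sets state_space"
  by (auto simp: sets_restrict_space image_iff intro!: bexI[of _ "{0..u}"])

lemma stationary_law_cdf:
  assumes u: "0 \<le> u"
  shows "measure stationary_law {0..u} = exp_minus ((\<integral>\<^sup>+v\<in>{u..}. tail \<mu> v \<partial>lborel) / ennreal b)"
proof -
  have "measure stationary_law {0..u} = \<P>(\<omega> in P. rev_shots {0..} \<omega> \<le> u)"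
    unfolding measure_stationary_law[OF Icc_state_space] using u by simp
  also have "\<dots> = exp_minus (\<integral>\<^sup>+r\<in>{0..}. strict_tail \<mu> (u + b * r) \<partial>lborel)"
    unfolding rev_shots_def using prob_shot_sup_le[OF gauge_on_rev_shots_infinite[OF b fin], of u] u b
    by (simp add: above_floor_rev_shots)
  also have "(\<integral>\<^sup>+r\<in>{0..}. strict_tail \<mu> (u + b * r) \<partial>lborel) = (\<integral>\<^sup>+v\<in>{u..}. tail \<mu> v \<partial>lborel) / ennreal b"
    using rev_integral[OF b, of u 0] by simp
  finally show ?thesis .
qed

text \<open>
Without points above the line \<open>b * r\<close> after time \<open>t\<close>, later times contribute \<open>0\<close> only.
\<close>

lemma rev_shots_stabilize:
  assumes t: "0 \<le> t"
  shows "AE \<omega> in P. avoids (epi {t..} (\<lambda>r. b * r) 0) \<omega> \<longrightarrow> rev_shots {0..} \<omega> = rev_shots {0..t} \<omega>"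
  using AE_bounded_shots[OF gauge_on_rev_shots_infinite[OF b fin]]
    AE_bounded_shots[OF gauge_on_rev_shots[OF t]] AE_space
proof eventually_elim
  case (elim \<omega>)
  show ?case
  proof
    assume "avoids (epi {t..} (\<lambda>r. b * r) 0) \<omega>"
    moreover have "above_floor {t..} (\<lambda>r. b * r) 0" using b t by (intro above_floor_rev_shots[THEN iffD2]) auto
    ultimately have late: "\<forall>r\<in>{t..}. \<xi> r \<omega> - b * r \<le> 0"
      using shots_le_iff_avoids[OF elim(3), of "{t..}" "\<lambda>r. b * r" 0] t by auto
    have "rev_shots {0..} \<omega> \<le> u \<longleftrightarrow> rev_shots {0..t} \<omega> \<le> u" for u
    proof -
      have "rev_shots {0..} \<omega> \<le> u \<longleftrightarrow> 0 \<le> u \<and> (\<forall>r\<in>{0..}. \<xi> r \<omega> - b * r \<le> u)"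
        unfolding rev_shots_def using elim(1) by (intro shot_sup_le_iff) auto
      also have "\<dots> \<longleftrightarrow> 0 \<le> u \<and> (\<forall>r\<in>{0..t}. \<xi> r \<omega> - b * r \<le> u)"
      proof -
        have "\<xi> r \<omega> - b * r \<le> u" if "0 \<le> u" "\<forall>r\<in>{0..t}. \<xi> r \<omega> - b * r \<le> u" "0 \<le> r" for r
          using that bspec[OF late, of r] by (cases "t \<le> r") auto
        then show ?thesis by auto
      qed
      also have "\<dots> \<longleftrightarrow> rev_shots {0..t} \<omega> \<le> u"
        unfolding rev_shots_def using elim(2) t by (intro shot_sup_le_iff[symmetric]) auto
      finally show ?thesis .
    qed
    then show "rev_shots {0..} \<omega> = rev_shots {0..t} \<omega>" by (meson order_antisym order_refl)
  qed
qed

text \<open>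
Since \<open>x \<le> b * t\<close>, the starting point is forgotten by time \<open>t\<close>. The law is then that of the
reversed supremum over \<open>{0..t}\<close>, which is coupled with the supremum over \<open>{0..}\<close>.
\<close>

lemma law_at_close_to_stationary_law:
  assumes x: "0 \<le> x" and t: "x / b < t" and A: "A \<in> sets state_space"
  shows "\<bar>measure (law_at P (esn \<xi> b) x t) A - measure stationary_law A\<bar>
    \<le> 1 - exp_minus ((\<integral>\<^sup>+v\<in>{b * t..}. tail \<mu> v \<partial>lborel) / ennreal b)"
proof -
  have t0: "0 \<le> t" using x t b by (meson divide_nonneg_pos less_imp_le order_trans)
  have xt: "x - b * t \<le> 0" using t b by (simp add: field_simps)
  note [measurable] = esn0_borel[OF t0] max_0_state_space[OF measurable_ident_sets[OF refl]] A
  have rev_borel [measurable]: "rev_shots {0..t} \<in> borel_measurable P"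
    unfolding rev_shots_def by (intro shot_sup_borel gauge_on_rev_shots t0)
  have A': "{y. max 0 y \<in> A} \<in> sets borel"
    using measurable_sets[OF max_0_state_space[OF measurable_ident_sets[OF refl]] A] by (simp add: vimage_def)
  have law: "measure (distr P borel X) {y. max 0 y \<in> A} = \<P>(\<omega> in P. max 0 (X \<omega>) \<in> A)"
    if "X \<in> borel_measurable P" for X
    using that A' by (simp add: measure_distr vimage_def Int_def conj_commute)
  have "esn \<xi> b x t = (\<lambda>\<omega>. max 0 (esn0 \<xi> b t \<omega>))" using xt by (auto simp: esn_def fun_eq_iff)
  then have "measure (law_at P (esn \<xi> b) x t) A = \<P>(\<omega> in P. max 0 (esn0 \<xi> b t \<omega>) \<in> A)"
    unfolding law_at_def using A t0
    by (simp add: measure_distr max_0_state_space vimage_def Int_def conj_commute)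
  also have "\<dots> = measure (distr P borel (esn0 \<xi> b t)) {y. max 0 y \<in> A}"
    using t0 by (simp add: law)
  also have "\<dots> = \<P>(\<omega> in P. max 0 (rev_shots {0..t} \<omega>) \<in> A)"
    using b t0 by (simp add: distr_rev_shots law)
  finally have 1: "measure (law_at P (esn \<xi> b) x t) A = \<P>(\<omega> in P. max 0 (rev_shots {0..t} \<omega>) \<in> A)" .
  let ?F = "{\<omega>\<in>space P. avoids (epi {t..} (\<lambda>r. b * r) 0) \<omega>}"
  have F: "epi {t..} (\<lambda>r. b * r) 0 \<in> sets \<Lambda>" by (intro epi_sets) auto
  have "emeasure \<Lambda> (epi {t..} (\<lambda>r. b * r) 0) = (\<integral>\<^sup>+r\<in>{t..}. strict_tail \<mu> (0 + b * r) \<partial>lborel)"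
    using t0 by (intro emeasure_epi) auto
  also have "\<dots> = (\<integral>\<^sup>+v\<in>{b * t..}. tail \<mu> v \<partial>lborel) / ennreal b"
    using rev_integral[OF b, of 0 t] by simp
  finally have pF: "prob ?F = exp_minus ((\<integral>\<^sup>+v\<in>{b * t..}. tail \<mu> v \<partial>lborel) / ennreal b)"
    using prob_avoids[OF F] by simp
  have pred: "{\<omega>\<in>space P. max 0 (X \<omega>) \<in> A} \<in> sets P" if X: "X \<in> borel_measurable P" for X
    using measurable_sets[OF max_0_state_space[OF X] A] by (simp add: vimage_def Int_def conj_commute)
  have "AE \<omega> in P. \<omega> \<in> ?F \<longrightarrow> (\<omega> \<in> {\<omega>\<in>space P. max 0 (rev_shots {0..t} \<omega>) \<in> A} \<longleftrightarrow>
      \<omega> \<in> {\<omega>\<in>space P. max 0 (rev_shots {0..} \<omega>) \<in> A})"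
    using rev_shots_stabilize[OF t0] by eventually_elim auto
  from measure_diff_le[OF pred[OF rev_borel] pred[OF rev_shots_infinite_borel] avoids_sets[OF F] this]
  show ?thesis by (simp add: 1 pF measure_stationary_law[OF A])
qed

lemma d_TV_stationary_law:
  assumes x: "0 \<le> x" and t: "x / b < t"
  shows "0 \<le> d_TV (law_at P (esn \<xi> b) x t) stationary_law"
    and "ennreal (d_TV (law_at P (esn \<xi> b) x t) stationary_law)
      \<le> (\<integral>\<^sup>+v\<in>{b * t..}. tail \<mu> v \<partial>lborel) / ennreal b"
proof -
  have *: "\<bar>measure (law_at P (esn \<xi> b) x t) A - measure stationary_law A\<bar>
    \<le> 1 - exp_minus ((\<integral>\<^sup>+v\<in>{b * t..}. tail \<mu> v \<partial>lborel) / ennreal b)"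
    if "A \<in> sets (law_at P (esn \<xi> b) x t)" for A
    using that by (intro law_at_close_to_stationary_law[OF x t]) (simp add: law_at_def)
  show "0 \<le> d_TV (law_at P (esn \<xi> b) x t) stationary_law" by (rule d_TV_bounds(1)[OF *])
  have "ennreal (d_TV (law_at P (esn \<xi> b) x t) stationary_law)
      \<le> ennreal (1 - exp_minus ((\<integral>\<^sup>+v\<in>{b * t..}. tail \<mu> v \<partial>lborel) / ennreal b))"
    by (intro ennreal_leI d_TV_bounds(2)[OF *])
  also have "\<dots> \<le> (\<integral>\<^sup>+v\<in>{b * t..}. tail \<mu> v \<partial>lborel) / ennreal b" by (rule exp_minus_ge_ennreal)
  finally show "ennreal (d_TV (law_at P (esn \<xi> b) x t) stationary_law)
      \<le> (\<integral>\<^sup>+v\<in>{b * t..}. tail \<mu> v \<partial>lborel) / ennreal b" .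
qed

lemma d_TV_stationary_law_tendsto:
  assumes x: "0 \<le> x"
  shows "((\<lambda>t. d_TV (law_at P (esn \<xi> b) x t) stationary_law) \<longlongrightarrow> 0) at_top"
proof -
  have bt: "(\<integral>\<^sup>+r\<in>{t..}. strict_tail \<mu> (b * r) \<partial>lborel) = (\<integral>\<^sup>+v\<in>{b * t..}. tail \<mu> v \<partial>lborel) / ennreal b" for t
    using rev_integral[OF b, of 0 t] by simp
  have lim: "((\<lambda>t. \<integral>\<^sup>+r\<in>{t..}. strict_tail \<mu> (b * r) \<partial>lborel) \<longlongrightarrow> 0) at_top"
  proof (rule nn_integral_Ici_tendsto_0)
    show "(\<integral>\<^sup>+r\<in>{1 / b..}. strict_tail \<mu> (b * r) \<partial>lborel) < \<infinity>"
      unfolding bt using b fin by (simp add: ennreal_divide_eq_top_iff less_top[symmetric])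
  qed measurable
  have up: "eventually (\<lambda>t. ennreal (d_TV (law_at P (esn \<xi> b) x t) stationary_law)
      \<le> (\<integral>\<^sup>+r\<in>{t..}. strict_tail \<mu> (b * r) \<partial>lborel)) at_top"
    using eventually_gt_at_top[of "x / b"]
    by eventually_elim (simp only: bt d_TV_stationary_law[OF x])
  have low: "eventually (\<lambda>t. 0 \<le> ennreal (d_TV (law_at P (esn \<xi> b) x t) stationary_law)) at_top"
    by simp
  have "((\<lambda>t. ennreal (d_TV (law_at P (esn \<xi> b) x t) stationary_law)) \<longlongrightarrow> ennreal 0) at_top"
    unfolding ennreal_0 by (rule tendsto_sandwich[OF low up tendsto_const lim])
  moreover have "eventually (\<lambda>t. 0 \<le> d_TV (law_at P (esn \<xi> b) x t) stationary_law) at_top"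
    using eventually_gt_at_top[of "x / b"] by eventually_elim (rule d_TV_stationary_law(1)[OF x])
  ultimately show ?thesis by (rule tendsto_ennrealD) simp
qed

text \<open>
For a starting point with the stationary law, independent of the shots, the value at time \<open>t\<close>
is at most \<open>u\<close> if and only if the starting point is at most \<open>u + b * t\<close> and the reversed shots
on \<open>{0..t}\<close> stay below \<open>u\<close>. The first event is as likely as the absence of points above
\<open>u + b * r\<close> for \<open>r\<close> in \<open>{t..}\<close>, the second as for \<open>r\<close> in \<open>{0..t}\<close>. The two intensities add up to that
of the region over \<open>{0..}\<close>, which gives the stationary distribution function at \<open>u\<close>.
\<close>

lemma stationary_distribution_stationary_law: "stationary_distribution P (esn \<xi> b) stationary_law"
  unfolding stationary_distribution_def
proof (intro conjI allI impI ballI prob_space_stationary_law sets_stationary_law)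
  fix t :: real and A assume t: "0 \<le> t" and A: "A \<in> sets state_space"
  interpret p: prob_space stationary_law by (rule prob_space_stationary_law)
  interpret pair: pair_prob_space stationary_law P ..
  define Q where "Q = distr (stationary_law \<Otimes>\<^sub>M P) state_space (\<lambda>(x, \<omega>). esn \<xi> b x t \<omega>)"
  note [measurable] = esn0_borel[OF t]
  have id: "(\<lambda>x. x) \<in> borel_measurable stationary_law"
    unfolding measurable_cong_sets[OF sets_stationary_law refl] by (rule measurable_restrict_space1) simp
  have space_p: "space stationary_law = {0..}"
    using sets_eq_imp_space_eq[OF sets_stationary_law] by simp
  have fst_p [measurable]: "fst \<in> borel_measurable (stationary_law \<Otimes>\<^sub>M P)"
    by (rule measurable_compose[OF measurable_fst id])
  have joint: "(\<lambda>(x, \<omega>). esn \<xi> b x t \<omega>) \<in> measurable (stationary_law \<Otimes>\<^sub>M P) state_space"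
    by (intro measurable_restrict_space2) (auto simp: esn_nonneg, simp add: esn_def case_prod_unfold)
  have Q: "emeasure Q B = (\<integral>\<^sup>+x. emeasure (law_at P (esn \<xi> b) x t) B \<partial>stationary_law)"
    if B: "B \<in> sets state_space" for B
  proof -
    have "emeasure Q B = emeasure (stationary_law \<Otimes>\<^sub>M P)
        ((\<lambda>(x, \<omega>). esn \<xi> b x t \<omega>) -` B \<inter> space (stationary_law \<Otimes>\<^sub>M P))"
      unfolding Q_def by (rule emeasure_distr[OF joint B])
    also have "\<dots> = (\<integral>\<^sup>+x. emeasure P (Pair x -` ((\<lambda>(x, \<omega>). esn \<xi> b x t \<omega>) -` B
        \<inter> space (stationary_law \<Otimes>\<^sub>M P))) \<partial>stationary_law)"
      using measurable_sets[OF joint B] by (rule emeasure_pair_measure_alt)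
    also have "\<dots> = (\<integral>\<^sup>+x. emeasure (law_at P (esn \<xi> b) x t) B \<partial>stationary_law)"
    proof (rule nn_integral_cong)
      fix x assume x: "x \<in> space stationary_law"
      have "esn \<xi> b x t \<in> measurable P state_space"
        using t by (intro measurable_restrict_space2) (auto simp: esn_nonneg)
      from emeasure_distr[OF this B] x
      show "emeasure P (Pair x -` ((\<lambda>(x, \<omega>). esn \<xi> b x t \<omega>) -` B \<inter> space (stationary_law \<Otimes>\<^sub>M P)))
          = emeasure (law_at P (esn \<xi> b) x t) B"
        by (simp add: law_at_def space_pair_measure vimage_def Int_def)
    qed
    finally show ?thesis .
  qed
  have "Q = stationary_law"
  proof (rule state_space_measure_eqI)
    show "prob_space Q" unfolding Q_def by (rule pair.prob_space_distr[OF joint])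
    show "sets Q = sets state_space" by (simp add: Q_def)
    fix u :: real assume u: "0 \<le> u"
    define c where "c = exp_minus (\<integral>\<^sup>+r\<in>{0..t}. strict_tail \<mu> (u + b * r) \<partial>lborel)"
    have bt: "0 \<le> b * t" using b t by simp
    have "emeasure Q {0..u} = (\<integral>\<^sup>+x. ennreal c * indicator {0..u + b * t} x \<partial>stationary_law)"
      unfolding Q[OF Icc_state_space]
    proof (rule nn_integral_cong)
      fix x assume "x \<in> space stationary_law"
      then have x: "0 \<le> x" by (simp add: space_p)
      have "esn \<xi> b x t \<in> measurable P state_space"
        using t by (intro measurable_restrict_space2) (auto simp: esn_nonneg)
      then have "emeasure (law_at P (esn \<xi> b) x t) {0..u} = \<P>(\<omega> in P. esn \<xi> b x t \<omega> \<le> u)"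
        unfolding law_at_def
        by (subst emeasure_distr) (auto simp: Icc_state_space emeasure_eq_measure esn_nonneg
            vimage_def Int_def conj_commute)
      also have "\<dots> = c * of_bool (x \<le> u + b * t)"
      proof -
        have "max 0 (x - b * t) \<le> u \<longleftrightarrow> x \<le> u + b * t" using u by auto
        then show ?thesis by (simp only: prob_esn_le[OF t x] strict_tail_reversal c_def)
      qed
      finally show "emeasure (law_at P (esn \<xi> b) x t) {0..u} = ennreal c * indicator {0..u + b * t} x"
        using x by (simp add: indicator_def)
    qed
    also have "\<dots> = ennreal c * emeasure stationary_law {0..u + b * t}"
      by (rule nn_integral_cmult_indicator) (simp add: Icc_state_space)
    also have "\<dots> = ennreal (c * exp_minus (\<integral>\<^sup>+r\<in>{t..}. strict_tail \<mu> (u + b * r) \<partial>lborel))"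
      using u bt by (simp add: p.emeasure_eq_measure stationary_law_cdf rev_integral[OF b] ennreal_mult c_def)
    also have "c * exp_minus (\<integral>\<^sup>+r\<in>{t..}. strict_tail \<mu> (u + b * r) \<partial>lborel)
        = exp_minus (\<integral>\<^sup>+r\<in>{0..}. strict_tail \<mu> (u + b * r) \<partial>lborel)"
    proof -
      have "(\<integral>\<^sup>+r\<in>{0..}. strict_tail \<mu> (u + b * r) \<partial>lborel)
          = (\<integral>\<^sup>+r. strict_tail \<mu> (u + b * r) * indicator {0..t} r + strict_tail \<mu> (u + b * r) * indicator {t..} r \<partial>lborel)"
        using AE_lborel_singleton[of t] t
        by (intro nn_integral_cong_AE) (auto simp: indicator_def elim!: eventually_mono)
      also have "\<dots> = (\<integral>\<^sup>+r\<in>{0..t}. strict_tail \<mu> (u + b * r) \<partial>lborel) + (\<integral>\<^sup>+r\<in>{t..}. strict_tail \<mu> (u + b * r) \<partial>lborel)"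
        by (rule nn_integral_add) measurable
      finally show ?thesis by (simp add: c_def exp_minus_add)
    qed
    also have "\<dots> = measure stationary_law {0..u}"
      using u rev_integral[OF b, of u 0] by (simp add: stationary_law_cdf)
    finally show "emeasure Q {0..u} = emeasure stationary_law {0..u}" by (simp add: p.emeasure_eq_measure)
  qed (use prob_space_stationary_law in auto)
  then show "(\<integral>\<^sup>+x. emeasure (law_at P (esn \<xi> b) x t) A \<partial>stationary_law) = emeasure stationary_law A"
    using Q[OF A] by simp
qed

text \<open>
If the law were concentrated at a point \<open>c\<close>, its distribution function would be \<open>1\<close> at \<open>0\<close>, which
forces \<open>\<mu> = 0\<close>, or it would vanish at \<open>c / 2 > 0\<close>, which forces a tail that is not integrable.
\<close>

lemma stationary_law_nondegenerate:
  assumes mu: "emeasure \<mu> {0<..} \<noteq> 0" and c: "0 \<le> c"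
  shows "measure stationary_law {c} < 1"
proof (rule ccontr)
  interpret p: prob_space stationary_law by (rule prob_space_stationary_law)
  have sing: "{c} \<in> sets stationary_law"
    using c by (auto simp: sets_restrict_space image_iff intro!: bexI[of _ "{c}"])
  assume "\<not> measure stationary_law {c} < 1"
  then have one: "measure stationary_law {c} = 1" by (simp add: antisym)
  show False
  proof (cases "c = 0")
    case True
    then have "measure stationary_law {0..0} = 1" using one by simp
    then have "exp_minus ((\<integral>\<^sup>+v\<in>{0..}. tail \<mu> v \<partial>lborel) / ennreal b) = 1"
      by (simp only: stationary_law_cdf[OF order_refl])
    then have "(\<integral>\<^sup>+v\<in>{0..}. tail \<mu> v \<partial>lborel) / ennreal b = 0"
      by (auto simp: exp_minus_def enn2real_eq_0_iff split: if_splits)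
    then have int0: "(\<integral>\<^sup>+v\<in>{0..}. tail \<mu> v \<partial>lborel) = 0"
      by (simp add: ennreal_divide_eq_0_iff)
    have tail0: "tail \<mu> x = 0" if x: "0 < x" for x
    proof -
      have "(\<integral>\<^sup>+v. tail \<mu> x * indicator {0..x} v \<partial>lborel) \<le> (\<integral>\<^sup>+v\<in>{0..}. tail \<mu> v \<partial>lborel)"
        using tail_mono by (intro nn_integral_mono) (auto simp: indicator_def)
      then have "tail \<mu> x * ennreal x = 0"
        using x int0 by (simp add: nn_integral_cmult_indicator)
      then show ?thesis using x by simp
    qed
    have "{0<..} = (\<Union>n. {0<..} \<inter> {inverse (real (Suc n))..})"
      using reals_Archimedean less_imp_le by fastforce
    also have "emeasure \<mu> \<dots> = 0"
    proof (rule emeasure_UN_eq_0)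
      show "emeasure \<mu> ({0<..} \<inter> {inverse (real (Suc i))..}) = 0" for i
        using tail0[of "inverse (real (Suc i))"] by (simp add: tail_def)
    qed (auto intro!: Int_pos_in_sets_mu)
    finally show False using mu by simp
  next
    case False
    with c have c: "0 < c" by simp
    have "measure stationary_law {0..c / 2} + measure stationary_law {c} = measure stationary_law ({0..c / 2} \<union> {c})"
      using c sing by (intro p.finite_measure_Union[symmetric]) (auto simp: Icc_state_space)
    also have "\<dots> \<le> 1" by simp
    finally have "measure stationary_law {0..c / 2} \<le> 0" using one by simp
    then have "exp_minus ((\<integral>\<^sup>+v\<in>{c / 2..}. tail \<mu> v \<partial>lborel) / ennreal b) \<le> 0"
      using c by (simp add: stationary_law_cdf)
    then have "(\<integral>\<^sup>+v\<in>{c / 2..}. tail \<mu> v \<partial>lborel) = \<infinity>"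
      using b exp_minus_pos_iff[of "(\<integral>\<^sup>+v\<in>{c / 2..}. tail \<mu> v \<partial>lborel) / ennreal b"]
      by (auto simp: not_less less_top[symmetric] ennreal_divide_eq_top_iff ennreal_eq_0_iff)
    moreover have "(\<integral>\<^sup>+v\<in>{c / 2..}. tail \<mu> v \<partial>lborel)
        \<le> (\<integral>\<^sup>+v. tail \<mu> (c / 2) * indicator {0..1} v + tail \<mu> v * indicator {1..} v \<partial>lborel)"
      using tail_mono c by (intro nn_integral_mono) (auto simp: indicator_def)
    moreover have "\<dots> = tail \<mu> (c / 2) + (\<integral>\<^sup>+v\<in>{1..}. tail \<mu> v \<partial>lborel)"
      by (subst nn_integral_add) (auto simp: nn_integral_cmult_indicator)
    moreover have "\<dots> < \<infinity>" using fin tail_finite[of "c / 2"] c by simp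
    ultimately show False by (auto simp: top_unique)
  qed
qed

end

text \<open>
The distribution function at a fixed level is at most the exponential of minus an integral that
diverges as \<open>s\<close> grows. Only large levels matter, and for these the integral avoids the possible
singularity of the tail at \<open>0\<close>.
\<close>

lemma esn_tendsto_infinity_in_probability:
  assumes b: "0 < b" and inf: "(\<integral>\<^sup>+v\<in>{1..}. tail \<mu> v \<partial>lborel) = \<infinity>" and x: "0 \<le> x"
  shows "((\<lambda>s. \<P>(\<omega> in P. K < esn \<xi> b x s \<omega>)) \<longlongrightarrow> 1) at_top"
proof -
  define K' where "K' = max 1 K"
  have "(\<integral>\<^sup>+r\<in>{0..}. strict_tail \<mu> (K' + b * r) \<partial>lborel) = \<infinity>"
  proof -
    have "(\<integral>\<^sup>+v\<in>{1..}. tail \<mu> v \<partial>lborel)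
        \<le> (\<integral>\<^sup>+v. tail \<mu> 1 * indicator {1..K'} v + tail \<mu> v * indicator {K'..} v \<partial>lborel)"
      using tail_mono by (intro nn_integral_mono) (auto simp: indicator_def)
    also have "\<dots> = tail \<mu> 1 * ennreal (K' - 1) + (\<integral>\<^sup>+v\<in>{K'..}. tail \<mu> v \<partial>lborel)"
      by (subst nn_integral_add) (auto simp: nn_integral_cmult_indicator K'_def)
    finally have "(\<integral>\<^sup>+v\<in>{K'..}. tail \<mu> v \<partial>lborel) = \<infinity>"
      using inf tail_finite[of 1] by (auto simp: top_unique ennreal_mult_eq_top_iff)
    then show ?thesis using rev_integral[OF b, of K' 0] b by (simp add: ennreal_divide_eq_top_iff)
  qed
  then have "((\<lambda>s. \<integral>\<^sup>+r\<in>{0..s}. strict_tail \<mu> (K' + b * r) \<partial>lborel) \<longlongrightarrow> \<infinity>) at_top"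
    using nn_integral_Icc_tendsto_at_top[of "\<lambda>r. strict_tail \<mu> (K' + b * r)"] by simp
  then have lim: "((\<lambda>s. exp_minus (\<integral>\<^sup>+r\<in>{0..s}. strict_tail \<mu> (K' + b * r) \<partial>lborel)) \<longlongrightarrow> 0) at_top"
    by (intro exp_minus_tendsto_0) simp
  have low: "1 - exp_minus (\<integral>\<^sup>+r\<in>{0..s}. strict_tail \<mu> (K' + b * r) \<partial>lborel) \<le> \<P>(\<omega> in P. K < esn \<xi> b x s \<omega>)"
    if s: "0 \<le> s" for s
  proof -
    have "\<P>(\<omega> in P. esn \<xi> b x s \<omega> \<le> K) \<le> \<P>(\<omega> in P. esn \<xi> b x s \<omega> \<le> K')"
      using s by (intro finite_measure_mono) (auto simp: K'_def)
    also have "\<dots> \<le> exp_minus (\<integral>\<^sup>+r\<in>{0..s}. strict_tail \<mu> (K' + b * r) \<partial>lborel)"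
      by (simp add: prob_esn_le[OF s x] strict_tail_reversal)
    finally show ?thesis using s by (simp add: prob_gt)
  qed
  show ?thesis
  proof (rule tendsto_sandwich[OF _ _ _ tendsto_const])
    show "((\<lambda>s. 1 - exp_minus (\<integral>\<^sup>+r\<in>{0..s}. strict_tail \<mu> (K' + b * r) \<partial>lborel)) \<longlongrightarrow> 1) at_top"
      using tendsto_diff[OF tendsto_const[of "1::real"] lim] by simp
    show "eventually (\<lambda>s. 1 - exp_minus (\<integral>\<^sup>+r\<in>{0..s}. strict_tail \<mu> (K' + b * r) \<partial>lborel)
        \<le> \<P>(\<omega> in P. K < esn \<xi> b x s \<omega>)) at_top"
      using eventually_ge_at_top[of 0] by eventually_elim (rule low)
  qed (simp add: always_eventually)
qed

end

section \<open>The zero set\<close>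

context extremal_shot_noise
begin

lemma strict_tail_0: "strict_tail \<mu> 0 = tail \<mu> 0"
  by (rule tail_eq_strict_tail[symmetric]) simp

lemma tail_integral_finite_extend:
  assumes a: "0 < a" and fin: "(\<integral>\<^sup>+v\<in>{0..a}. tail \<mu> v \<partial>lborel) < \<infinity>"
  shows "(\<integral>\<^sup>+v\<in>{0..c}. tail \<mu> v \<partial>lborel) < \<infinity>"
proof -
  have "(\<integral>\<^sup>+v\<in>{0..c}. tail \<mu> v \<partial>lborel)
      \<le> (\<integral>\<^sup>+v. tail \<mu> v * indicator {0..a} v + tail \<mu> a * indicator {0..c} v \<partial>lborel)"
    using tail_mono by (intro nn_integral_mono) (auto simp: indicator_def)
  also have "\<dots> = (\<integral>\<^sup>+v\<in>{0..a}. tail \<mu> v \<partial>lborel) + tail \<mu> a * emeasure lborel {0..c}"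
    by (subst nn_integral_add) (auto simp: nn_integral_cmult_indicator)
  also have "\<dots> < \<infinity>"
    using fin tail_finite[OF a] by (simp add: ennreal_mult_less_top emeasure_lborel_Icc_eq)
  finally show ?thesis .
qed

lemma rev_integral_finite_iff:
  assumes b: "0 \<le> b" and t: "0 < t"
  shows "(\<integral>\<^sup>+r\<in>{0..t}. strict_tail \<mu> (b * r) \<partial>lborel) < \<infinity> \<longleftrightarrow>
    (\<integral>\<^sup>+v\<in>{0..1}. tail \<mu> v \<partial>lborel) < \<infinity> \<and> (b = 0 \<longrightarrow> tail \<mu> 0 < \<infinity>)"
proof (cases "b = 0")
  case True
  have "(\<integral>\<^sup>+r\<in>{0..t}. strict_tail \<mu> (b * r) \<partial>lborel) = tail \<mu> 0 * ennreal t"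
    using True t by (simp add: nn_integral_cmult_indicator strict_tail_0)
  moreover have "(\<integral>\<^sup>+v\<in>{0..1}. tail \<mu> v \<partial>lborel) < \<infinity>" if "tail \<mu> 0 < \<infinity>"
  proof -
    have "(\<integral>\<^sup>+v\<in>{0..1}. tail \<mu> v \<partial>lborel) \<le> (\<integral>\<^sup>+v. tail \<mu> 0 * indicator {0..1::real} v \<partial>lborel)"
      using tail_mono by (intro nn_integral_mono) (auto simp: indicator_def)
    also have "\<dots> = tail \<mu> 0" by (simp add: nn_integral_cmult_indicator)
    finally show ?thesis using that by (rule le_less_trans)
  qed
  moreover have "tail \<mu> 0 * ennreal t < \<infinity> \<longleftrightarrow> tail \<mu> 0 < \<infinity>"
    using t by (auto simp: ennreal_mult_less_top)
  ultimately show ?thesis using True by auto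
next
  case False
  then have b: "0 < b" using b by simp
  have "(\<integral>\<^sup>+r\<in>{0..t}. strict_tail \<mu> (0 + b * r) \<partial>lborel) = (\<integral>\<^sup>+v\<in>{0..b * t}. tail \<mu> v \<partial>lborel) / ennreal \<bar>b\<bar>"
    using b by (intro strict_tail_affine_integral) (auto simp: zero_le_mult_iff)
  then have "(\<integral>\<^sup>+r\<in>{0..t}. strict_tail \<mu> (b * r) \<partial>lborel) < \<infinity> \<longleftrightarrow> (\<integral>\<^sup>+v\<in>{0..b * t}. tail \<mu> v \<partial>lborel) < \<infinity>"
    using b by (simp add: less_top[symmetric] ennreal_divide_eq_top_iff ennreal_eq_0_iff)
  also have "\<dots> \<longleftrightarrow> (\<integral>\<^sup>+v\<in>{0..1}. tail \<mu> v \<partial>lborel) < \<infinity>"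
    using tail_integral_finite_extend[of "b * t" 1] tail_integral_finite_extend[of 1 "b * t"] b t by auto
  finally show ?thesis using False by simp
qed

lemma prob_esn_eq_0:
  assumes b: "0 \<le> b" and t: "0 \<le> t"
  shows "\<P>(\<omega> in P. esn \<xi> b 0 t \<omega> = 0) = exp_minus (\<integral>\<^sup>+r\<in>{0..t}. strict_tail \<mu> (b * r) \<partial>lborel)"
proof -
  have "esn \<xi> b 0 t \<omega> = 0 \<longleftrightarrow> esn \<xi> b 0 t \<omega> \<le> 0" for \<omega>
    using esn_nonneg[of 0 t \<omega>] by auto
  then have "\<P>(\<omega> in P. esn \<xi> b 0 t \<omega> = 0) = \<P>(\<omega> in P. esn \<xi> b 0 t \<omega> \<le> 0)" by simp
  also have "\<dots> = exp_minus (\<integral>\<^sup>+r\<in>{0..t}. strict_tail \<mu> (0 + b * r) \<partial>lborel)"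
    unfolding prob_esn_le[OF t order_refl] strict_tail_reversal using b t by simp
  finally show ?thesis by simp
qed

text \<open>
Equivalently, the reversed shots above the line \<open>b * r\<close> have finite intensity on bounded
intervals. For \<open>b = 0\<close> these are all the shots.
\<close>

definition zero_criterion :: bool where
  "zero_criterion \<longleftrightarrow>
    (\<integral>\<^sup>+v\<in>{0..1}. tail \<mu> v \<partial>lborel) < \<infinity> \<and> (b = 0 \<longrightarrow> tail \<mu> 0 < \<infinity>)"

lemma prob_esn_eq_0_pos_iff:
  "0 \<le> b \<Longrightarrow> 0 < t \<Longrightarrow> 0 < \<P>(\<omega> in P. esn \<xi> b 0 t \<omega> = 0) \<longleftrightarrow> zero_criterion"
  using rev_integral_finite_iff[of t]
  by (simp add: prob_esn_eq_0 exp_minus_pos_iff zero_criterion_def)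

text \<open>
The points up to time \<open>p\<close> whose shots keep the process away from \<open>0\<close> before time \<open>q\<close>.
\<close>

definition late_shots :: "real \<Rightarrow> real \<Rightarrow> (real \<times> real) set" where
  "late_shots p q = {z\<in>space \<Lambda>. fst z \<le> p \<and> b * (q - fst z) \<le> snd z}"

text \<open>
A description by rational times of the event that some shot keeps the process positive at time
\<open>t\<close>. It is jointly measurable in \<open>t\<close> and \<open>\<omega>\<close>, which is not evident for the supremum itself.
\<close>

definition covered :: "real \<Rightarrow> 'w \<Rightarrow> bool" where
  "covered t \<omega> \<longleftrightarrow> (\<exists>q::rat. t < of_rat q \<and>
     (\<forall>p::rat. t \<le> of_rat p \<and> (of_rat p :: real) < of_rat q \<longrightarrow> \<not> avoids (late_shots (of_rat p) (of_rat q)) \<omega>))"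

lemma late_shots_sets [measurable]: "late_shots p q \<in> sets \<Lambda>"
  unfolding late_shots_def by measurable

context
  assumes b: "0 \<le> b" and criterion: zero_criterion
begin

lemma emeasure_late_shots:
  assumes pq: "p < q"
  shows "emeasure \<Lambda> (late_shots p q) < \<infinity>"
proof -
  have sub: "emeasure \<mu> (Pair r -` late_shots p q) * indicator {0..} r
      \<le> tail \<mu> (b * (q - p)) * indicator {0..p} r" for r
  proof (cases "0 \<le> r \<and> r \<le> p")
    case True
    have "b * (q - p) \<le> b * (q - r)" using True b by (intro mult_left_mono) auto
    then have "Pair r -` late_shots p q \<subseteq> {0<..} \<inter> {b * (q - p)..}"
      by (auto simp: late_shots_def space_Lambda)
    then have "emeasure \<mu> (Pair r -` late_shots p q) \<le> tail \<mu> (b * (q - p))"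
      unfolding tail_def by (intro emeasure_mono Int_pos_in_sets_mu) auto
    then show ?thesis using True by simp
  next
    case False
    then have "Pair r -` late_shots p q = {}" if "0 \<le> r" using that by (auto simp: late_shots_def)
    then show ?thesis by (auto simp: indicator_def)
  qed
  have "emeasure \<Lambda> (late_shots p q) \<le> (\<integral>\<^sup>+r. tail \<mu> (b * (q - p)) * indicator {0..p} r \<partial>lborel)"
    unfolding emeasure_Lambda[OF late_shots_sets] by (intro nn_integral_mono sub)
  also have "\<dots> = tail \<mu> (b * (q - p)) * emeasure lborel {0..p}"
    by (simp add: nn_integral_cmult_indicator)
  also have "\<dots> < \<infinity>"
  proof -
    have "tail \<mu> (b * (q - p)) < \<infinity>"
    proof (cases "b = 0")
      case True
      with criterion have "tail \<mu> 0 < \<infinity>" unfolding zero_criterion_def by blast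
      with True show ?thesis by simp
    next
      case False
      with b pq show ?thesis by (intro tail_finite) simp
    qed
    then show ?thesis by (simp add: ennreal_mult_less_top emeasure_lborel_Icc_eq)
  qed
  finally show ?thesis .
qed

text \<open>
A shot up to time \<open>t\<close> that is still positive at \<open>t\<close> remains so until some later rational \<open>q\<close>, and
then belongs to \<open>late_shots p q\<close> for all rational \<open>p \<ge> t\<close>. Conversely, let every \<open>late_shots p q\<close> with
\<open>t \<le> p < q\<close> contain a point. For fixed \<open>p\<close> there are only finitely many, so they cannot all lie
strictly after \<open>t\<close>: some \<open>p > t\<close> would precede them all.
\<close>

lemma AE_zero_iff_not_covered:
  "AE \<omega> in P. \<forall>t\<ge>0. esn \<xi> b 0 t \<omega> = 0 \<longleftrightarrow> \<not> covered t \<omega>"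
proof -
  have "AE \<omega> in P. \<forall>p q::rat. p < q \<longrightarrow> finite (pts \<omega> \<inter> late_shots (of_rat p) (of_rat q))"
  proof (intro AE_all_countable[THEN iffD2] allI)
    fix p q :: rat
    show "AE \<omega> in P. p < q \<longrightarrow> finite (pts \<omega> \<inter> late_shots (of_rat p) (of_rat q))"
    proof (cases "p < q")
      case True
      then have "emeasure \<Lambda> (late_shots (of_rat p) (of_rat q)) < \<infinity>"
        by (intro emeasure_late_shots) (simp add: of_rat_less)
      from AE_finite_pts[OF late_shots_sets this] show ?thesis using True by simp
    qed simp
  qed
  moreover have "AE \<omega> in P. \<forall>n::nat. bounded_shots {0..real n} (\<lambda>r. b * (real n - r)) \<omega>"
    by (intro AE_all_countable[THEN iffD2] allI AE_bounded_shots gauge_on_esn0) simp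
  ultimately show ?thesis
    using AE_space
  proof eventually_elim
    case (elim \<omega>)
    show ?case
    proof (intro allI impI)
      fix t :: real assume t: "0 \<le> t"
      \<comment> \<open>Boundedness is known almost surely at countably many times only; at time t it is inherited
          from an integer n \<ge> t, since the losses until t and n differ by the constant b * (n - t).\<close>
      have bdd: "bounded_shots {0..t} (\<lambda>r. b * (t - r)) \<omega>"
      proof -
        obtain n :: nat where n: "t \<le> n" using real_arch_simple by blast
        obtain B where B: "\<And>r. r \<in> {0..real n} \<Longrightarrow> max 0 (\<xi> r \<omega> - b * (real n - r)) \<le> B"
          using elim(2) unfolding bounded_shots_def bdd_above_def by fastforce
        have "max 0 (\<xi> r \<omega> - b * (t - r)) \<le> max 0 B + b * (n - t)" if "r \<in> {0..t}" for r
        proof -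
          have "0 \<le> b * (n - t)" using b n by simp
          moreover have "\<xi> r \<omega> - b * (t - r) = (\<xi> r \<omega> - b * (n - r)) + b * (n - t)"
            by (simp add: algebra_simps)
          ultimately show ?thesis using B[of r] that n by auto
        qed
        then show ?thesis unfolding bounded_shots_def bdd_above_def by blast
      qed
      have "esn \<xi> b 0 t \<omega> = 0 \<longleftrightarrow> esn \<xi> b 0 t \<omega> \<le> 0"
        using esn_nonneg[of 0 t \<omega>] by auto
      also have "\<dots> \<longleftrightarrow> shot_sup \<xi> {0..t} (\<lambda>r. b * (t - r)) \<omega> \<le> 0"
        using b t by (simp add: esn_le_iff esn0_eq_shot_sup)
      also have "\<dots> \<longleftrightarrow> avoids (epi {0..t} (\<lambda>r. b * (t - r)) 0) \<omega>"
        using shot_sup_le_iff_avoids[OF elim(3) gauge_on_esn0[OF t] bdd] above_floor_esn0[OF t] b t by simp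
      also have "\<dots> \<longleftrightarrow> \<not> covered t \<omega>"
      proof
        assume avoid: "avoids (epi {0..t} (\<lambda>r. b * (t - r)) 0) \<omega>"
        show "\<not> covered t \<omega>"
        proof
          assume "covered t \<omega>"
          then obtain q :: rat where q: "t < of_rat q" and
            cov: "\<And>p::rat. t \<le> of_rat p \<Longrightarrow> (of_rat p :: real) < of_rat q \<Longrightarrow>
              pts \<omega> \<inter> late_shots (of_rat p) (of_rat q) \<noteq> {}"
            unfolding covered_def avoids_def by blast
          have late: "t < fst z" if z: "z \<in> pts \<omega>" "z \<in> late_shots p (of_rat q)" for z p
          proof (rule ccontr)
            assume "\<not> t < fst z"
            then have zt: "fst z \<le> t" by simp
            have pos: "0 < snd z" using z(2) by (simp add: late_shots_def space_Lambda mem_Times_iff)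
            have "b * (t - fst z) < snd z"
            proof (cases "b = 0")
              case False
              then have "b * (t - fst z) < b * (of_rat q - fst z)" using b q by simp
              with z(2) show ?thesis by (simp add: late_shots_def)
            qed (use pos in simp)
            then have "z \<in> epi {0..t} (\<lambda>r. b * (t - r)) 0"
              using z(2) zt by (auto simp: epi_def late_shots_def space_Lambda)
            with z(1) avoid show False by (auto simp: avoids_def)
          qed
          obtain p0 :: rat where p0: "t < of_rat p0" "(of_rat p0 :: real) < of_rat q"
            using of_rat_dense[OF q] by blast
          let ?R = "insert (of_rat p0) (fst ` (pts \<omega> \<inter> late_shots (of_rat p0) (of_rat q)))"
          have fin: "finite ?R" using elim(1) p0 by (simp add: of_rat_less)
          have "t < Min ?R" using fin p0 late by (subst Min_gr_iff) auto
          then obtain p :: rat where p: "t < of_rat p" "of_rat p < Min ?R"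
            using of_rat_dense by blast
          have pp0: "(of_rat p :: real) < of_rat p0" using p(2) fin by (subst (asm) Min_gr_iff) auto
          obtain z where z: "z \<in> pts \<omega>" "z \<in> late_shots (of_rat p) (of_rat q)"
            using cov[of p] p(1) pp0 p0(2) by auto
          then have "z \<in> late_shots (of_rat p0) (of_rat q)" using pp0 by (auto simp: late_shots_def)
          with z(1) have "Min ?R \<le> fst z" using fin by (intro Min_le) auto
          moreover have "fst z \<le> of_rat p" using z(2) by (simp add: late_shots_def)
          ultimately show False using p(2) by simp
        qed
      next
        assume ncov: "\<not> covered t \<omega>"
        show "avoids (epi {0..t} (\<lambda>r. b * (t - r)) 0) \<omega>"
        proof (rule ccontr)
          assume "\<not> avoids (epi {0..t} (\<lambda>r. b * (t - r)) 0) \<omega>"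
          then obtain z where z: "z \<in> pts \<omega>" "z \<in> space \<Lambda>" "fst z \<le> t" "b * (t - fst z) < snd z"
            by (auto simp: avoids_def epi_def)
          obtain q' where q': "t < q'" "b * (q' - fst z) \<le> snd z"
          proof (cases "b = 0")
            case True
            then show ?thesis using z that[of "t + 1"] by auto
          next
            case False
            then have "0 < b" using b by simp
            then show ?thesis using z that[of "fst z + snd z / b"] by (auto simp: field_simps)
          qed
          obtain q :: rat where q: "t < of_rat q" "of_rat q < q'" using of_rat_dense[OF q'(1)] by blast
          have "b * (of_rat q - fst z) \<le> snd z"
            using q'(2) q(2) b mult_left_mono[of "of_rat q - fst z" "q' - fst z" b] by simp
          then have "z \<in> late_shots (of_rat p) (of_rat q)" if "t \<le> of_rat p" for p :: rat
            using z that by (auto simp: late_shots_def)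
          then have "covered t \<omega>" using z(1) q(1) unfolding covered_def avoids_def by blast
          with ncov show False by simp
        qed
      qed
      finally show "esn \<xi> b 0 t \<omega> = 0 \<longleftrightarrow> \<not> covered t \<omega>" .
    qed
  qed
qed

lemma prob_esn_eq_0_tendsto: "((\<lambda>t. \<P>(\<omega> in P. esn \<xi> b 0 t \<omega> = 0)) \<longlongrightarrow> 1) (at_right 0)"
proof -
  have fin: "(\<integral>\<^sup>+r\<in>{0..1}. strict_tail \<mu> (b * r) \<partial>lborel) < \<infinity>"
    using rev_integral_finite_iff[OF b, of 1] criterion unfolding zero_criterion_def by simp
  have "((\<lambda>t. \<integral>\<^sup>+r\<in>{0..t}. strict_tail \<mu> (b * r) \<partial>lborel) \<longlongrightarrow> 0) (at_right 0)"
    by (rule nn_integral_Icc_tendsto_0[OF _ fin]) measurable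
  then have "((\<lambda>t. exp_minus (\<integral>\<^sup>+r\<in>{0..t}. strict_tail \<mu> (b * r) \<partial>lborel)) \<longlongrightarrow> 1) (at_right 0)"
    by (rule exp_minus_tendsto_1)
  moreover have "eventually (\<lambda>t. exp_minus (\<integral>\<^sup>+r\<in>{0..t}. strict_tail \<mu> (b * r) \<partial>lborel)
      = \<P>(\<omega> in P. esn \<xi> b 0 t \<omega> = 0)) (at_right 0)"
    using eventually_at_right_less[of "0::real"]
    by eventually_elim (simp add: prob_esn_eq_0[OF b less_imp_le])
  ultimately show ?thesis by (rule Lim_transform_eventually)
qed

text \<open>
By Fubini the zeros in \<open>{0<..e / 2}\<close> have expected length at least \<open>c * e / 2\<close> when \<open>M 0 t = 0\<close> has
probability above \<open>c\<close> for all \<open>t < e\<close>. As the length never exceeds \<open>e / 2\<close>, it is positive with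
probability at least \<open>c\<close>; and \<open>c < 1\<close> is arbitrary.
\<close>

lemma AE_zero_set_positive: "AE \<omega> in P. 0 < emeasure lborel {t. 0 < t \<and> esn \<xi> b 0 t \<omega> = 0}"
proof -
  interpret pair: pair_sigma_finite P lborel ..
  have avoids_pred [measurable]: "Measurable.pred P (avoids (late_shots p q))" for p q
    unfolding pred_def by (rule avoids_sets) measurable
  have covered_pred [measurable]: "Measurable.pred (P \<Otimes>\<^sub>M lborel) (\<lambda>z. covered (snd z) (fst z))"
    unfolding covered_def by measurable
  \<comment> \<open>The slices of these sets at \<omega> are the zeros in (0, e] and all positive zeros, respectively.\<close>
  define Z where "Z e = {z\<in>space (P \<Otimes>\<^sub>M lborel). 0 < snd z \<and> snd z \<le> e \<and> \<not> covered (snd z) (fst z)}" for e :: real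
  define Z' where "Z' = {z\<in>space (P \<Otimes>\<^sub>M lborel). 0 < snd z \<and> \<not> covered (snd z) (fst z)}"
  have Z [measurable]: "Z e \<in> sets (P \<Otimes>\<^sub>M lborel)" for e unfolding Z_def by measurable
  have Z' [measurable]: "Z' \<in> sets (P \<Otimes>\<^sub>M lborel)" unfolding Z'_def by measurable
  define E where "E = {\<omega>\<in>space P. 0 < emeasure lborel (Pair \<omega> -` Z')}"
  have [measurable]: "(\<lambda>\<omega>. emeasure lborel (Pair \<omega> -` Z')) \<in> borel_measurable P"
    by (rule lborel.measurable_emeasure_Pair[OF Z'])
  have E: "E \<in> sets P" unfolding E_def by measurable
  have "c \<le> prob E" if c: "c < 1" "0 \<le> c" for c
  proof -
    from order_tendstoD(1)[OF prob_esn_eq_0_tendsto c(1)]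
    obtain e where e: "0 < e" and small: "\<And>t. 0 < t \<Longrightarrow> t < e \<Longrightarrow> c < \<P>(\<omega> in P. esn \<xi> b 0 t \<omega> = 0)"
      unfolding eventually_at_right_field by auto
    have "ennreal (c * (e / 2)) = ennreal c * ennreal (e / 2)"
      using c e by (intro ennreal_mult) auto
    also have "\<dots> = (\<integral>\<^sup>+t. ennreal c * indicator {0<..e / 2} t \<partial>lborel)"
      using e by (simp add: nn_integral_cmult_indicator)
    also have "\<dots> \<le> (\<integral>\<^sup>+t. emeasure P ((\<lambda>\<omega>. (\<omega>, t)) -` Z (e / 2)) \<partial>lborel)"
    proof (rule nn_integral_mono)
      fix t :: real
      show "ennreal c * indicator {0<..e / 2} t \<le> emeasure P ((\<lambda>\<omega>. (\<omega>, t)) -` Z (e / 2))"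
      proof (cases "t \<in> {0<..e / 2}")
        case True
        have [measurable]: "Measurable.pred P (covered t)" unfolding covered_def by measurable
        note [measurable] = esn_borel[of t 0]
        have "c \<le> \<P>(\<omega> in P. esn \<xi> b 0 t \<omega> = 0)" using small[of t] True e by auto
        also have "\<dots> = \<P>(\<omega> in P. \<not> covered t \<omega>)"
          using True by (intro measure_eq_AE eventually_mono[OF AE_zero_iff_not_covered]) auto
        finally have "ennreal c \<le> emeasure P {\<omega>\<in>space P. \<not> covered t \<omega>}"
          by (simp add: emeasure_eq_measure)
        moreover have "(\<lambda>\<omega>. (\<omega>, t)) -` Z (e / 2) = {\<omega>\<in>space P. \<not> covered t \<omega>}"
          using True by (auto simp: Z_def space_pair_measure)
        ultimately show ?thesis using True by simp
      qed simp
    qed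
    also have "\<dots> = emeasure (P \<Otimes>\<^sub>M lborel) (Z (e / 2))"
      by (rule pair.emeasure_pair_measure_alt2[OF Z, symmetric])
    also have "\<dots> = (\<integral>\<^sup>+\<omega>. emeasure lborel (Pair \<omega> -` Z (e / 2)) \<partial>P)"
      by (rule lborel.emeasure_pair_measure_alt[OF Z])
    also have "\<dots> \<le> (\<integral>\<^sup>+\<omega>. ennreal (e / 2) * indicator E \<omega> \<partial>P)"
    proof (rule nn_integral_mono)
      fix \<omega> assume \<omega>: "\<omega> \<in> space P"
      have "Pair \<omega> -` Z (e / 2) \<subseteq> {0<..e / 2}" by (auto simp: Z_def)
      then have "emeasure lborel (Pair \<omega> -` Z (e / 2)) \<le> emeasure lborel {0<..e / 2}"
        by (intro emeasure_mono) auto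
      moreover have "emeasure lborel (Pair \<omega> -` Z (e / 2)) \<le> emeasure lborel (Pair \<omega> -` Z')"
        using sets_Pair1[OF Z', of \<omega>] by (intro emeasure_mono) (auto simp: Z_def Z'_def)
      ultimately show "emeasure lborel (Pair \<omega> -` Z (e / 2)) \<le> ennreal (e / 2) * indicator E \<omega>"
        using \<omega> e by (cases "\<omega> \<in> E") (auto simp: E_def)
    qed
    also have "\<dots> = ennreal (e / 2) * emeasure P E"
      by (rule nn_integral_cmult_indicator[OF E])
    also have "\<dots> = ennreal (e / 2 * prob E)" using e by (subst ennreal_mult') (simp_all add: emeasure_eq_measure)
    finally have "ennreal (c * (e / 2)) \<le> ennreal (e / 2 * prob E)" .
    then have "c * (e / 2) \<le> e / 2 * prob E" using e by (subst (asm) ennreal_le_iff) auto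
    then show "c \<le> prob E" using e by (simp add: field_simps)
  qed
  then have "1 \<le> prob E"
    by (intro dense_le_bounded[of 0 1 "prob E"]) auto
  then have "prob E = 1" by (simp add: antisym)
  then have "AE \<omega> in P. \<omega> \<in> E" using E by (simp add: prob_eq_1)
  then show ?thesis
    using AE_zero_iff_not_covered
  proof eventually_elim
    case (elim \<omega>)
    then have "{t. 0 < t \<and> esn \<xi> b 0 t \<omega> = 0} = Pair \<omega> -` Z'"
      by (auto simp: Z'_def E_def space_pair_measure)
    with elim(1) show ?case by (simp add: E_def)
  qed
qed

end

end

section \<open>The properties of extremal shot noise processes\<close>

theorem theorem2p1:
  fixes P :: "'w measure" and \<xi> :: "real \<Rightarrow> 'w \<Rightarrow> real" and b :: real and \<mu> :: "real measure"
    and M :: "real \<Rightarrow> real \<Rightarrow> 'w \<Rightarrow> real"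
  assumes sets_mu: "sets \<mu> = sets pos_halfline"
    and tail_finite: "\<And>x. x > 0 \<Longrightarrow> tail \<mu> x < \<infinity>"
    and marks: "poisson_marks P \<xi> \<mu>"
    and M_def: "M = esn \<xi> b"
  shows "
    \<comment> \<open>(1), finite-dimensional laws; the closed tail is not correct at atoms when b = 0\<close>
    (\<forall>n\<ge>1. \<forall>(s::nat \<Rightarrow> real) u.
       s 0 = 0 \<and> (\<forall>i<n. s i < s (Suc i)) \<and> (\<forall>i\<in>{1..n}. 0 \<le> u i) \<longrightarrow>
       (\<forall>T. (T = tail \<mu> \<and> (b \<noteq> 0 \<or> (\<forall>i\<in>{1..n}. emeasure \<mu> {u i} = 0))) \<or> T = strict_tail \<mu> \<longrightarrow>
         \<P>(\<omega> in P. \<forall>i\<in>{1..n}. M 0 (s i) \<omega> \<le> u i)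
         = exp_minus (\<Sum>i=1..n. \<integral>\<^sup>+t\<in>{s (i - 1)..s i}.
                         T (MIN j\<in>{i..n}. u j + b * (s j - t)) \<partial>lborel)
           * (\<Prod>i=1..n. of_bool (u i \<ge> max 0 (- b * s i))))) \<and>
    \<comment> \<open>(1), one-dimensional laws\<close>
    (\<forall>s\<ge>0. \<forall>u.
       (\<forall>T. (T = tail \<mu> \<and> (b \<noteq> 0 \<or> emeasure \<mu> {u} = 0)) \<or> T = strict_tail \<mu> \<longrightarrow>
         \<P>(\<omega> in P. M 0 s \<omega> \<le> u)
         = exp_minus (\<integral>\<^sup>+t\<in>{0..s}. T (u + b * (s - t)) \<partial>lborel)
           * of_bool (u \<ge> max 0 (- b * s))) \<and>
       (b > 0 \<longrightarrow> \<P>(\<omega> in P. M 0 s \<omega> \<le> u)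
         = exp_minus ((\<integral>\<^sup>+y\<in>{u..u + b * s}. tail \<mu> y \<partial>lborel) / ennreal b)
           * of_bool (u \<ge> max 0 (- b * s))) \<and>
       (b < 0 \<longrightarrow> \<P>(\<omega> in P. M 0 s \<omega> \<le> u)
         = exp_minus ((\<integral>\<^sup>+y\<in>{u + b * s..u}. tail \<mu> y \<partial>lborel) / ennreal (- b))
           * of_bool (u \<ge> max 0 (- b * s)))) \<and>
    \<comment> \<open>(2)\<close>
    (\<forall>x\<ge>0. \<forall>t\<ge>0. \<forall>u.
       \<P>(\<omega> in P. M x t \<omega> \<le> u) = \<P>(\<omega> in P. M 0 t \<omega> \<le> u) * of_bool (u \<ge> max 0 (x - b * t))) \<and>
    \<comment> \<open>(3)\<close>
    (markov_process P M) \<and>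
    (\<forall>t\<ge>0. \<forall>f\<in>C0. transition_op P M t f \<in> C0) \<and>
    (\<forall>f\<in>C0. uniform_limit {0..} (\<lambda>t. transition_op P M t f) f (at_right 0)) \<and>
    \<comment> \<open>(4); for b = 0 the condition must be finiteness of the measure\<close>
    (b \<ge> 0 \<longrightarrow>
       (\<forall>s>0. \<P>(\<omega> in P. M 0 s \<omega> = 0) > 0 \<longleftrightarrow>
          (\<integral>\<^sup>+v\<in>{0..1}. tail \<mu> v \<partial>lborel) < \<infinity> \<and> (b = 0 \<longrightarrow> tail \<mu> 0 < \<infinity>)) \<and>
       ((\<integral>\<^sup>+v\<in>{0..1}. tail \<mu> v \<partial>lborel) < \<infinity> \<and> (b = 0 \<longrightarrow> tail \<mu> 0 < \<infinity>) \<longrightarrow>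
          (AE \<omega> in P. emeasure lborel {t. 0 < t \<and> M 0 t \<omega> = 0} > 0))) \<and>
    \<comment> \<open>(5)\<close>
    (b > 0 \<and> (\<integral>\<^sup>+v\<in>{1..}. tail \<mu> v \<partial>lborel) = \<infinity> \<longrightarrow>
       (\<forall>x\<ge>0. \<forall>K. ((\<lambda>s. \<P>(\<omega> in P. M x s \<omega> > K)) \<longlongrightarrow> 1) at_top)) \<and>
    (b > 0 \<and> (\<integral>\<^sup>+v\<in>{1..}. tail \<mu> v \<partial>lborel) < \<infinity> \<longrightarrow>
       (\<exists>p. stationary_distribution P M p \<and>
          (emeasure \<mu> {0<..} \<noteq> 0 \<longrightarrow> (\<forall>c\<ge>0. measure p {c} < 1)) \<and>
          (\<forall>u\<ge>0. measure p {0..u}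
             = exp_minus ((\<integral>\<^sup>+v\<in>{u..}. tail \<mu> v \<partial>lborel) / ennreal b)) \<and>
          (\<forall>x\<ge>0. ((\<lambda>t. d_TV (law_at P M x t) p) \<longlongrightarrow> 0) at_top) \<and>
          (\<forall>x\<ge>0. \<forall>t>x / b. ennreal (d_TV (law_at P M x t) p)
             \<le> (\<integral>\<^sup>+v\<in>{b * t..}. tail \<mu> v \<partial>lborel) / ennreal b)))"
proof -
  interpret extremal_shot_noise P \<xi> b \<mu>
    using sets_mu tail_finite marks by (rule extremal_shot_noise.intro)
  have one_dim: "(\<P>(\<omega> in P. M 0 s \<omega> \<le> u)
      = exp_minus (\<integral>\<^sup>+t\<in>{0..s}. T (u + b * (s - t)) \<partial>lborel) * of_bool (u \<ge> max 0 (- b * s)))"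
    if s: "0 \<le> s" and T: "(T = tail \<mu> \<and> (b \<noteq> 0 \<or> emeasure \<mu> {u} = 0)) \<or> T = strict_tail \<mu>" for s u T
  proof -
    have "(\<integral>\<^sup>+t\<in>{0..s}. T (u + b * (s - t)) \<partial>lborel)
        = (\<integral>\<^sup>+t\<in>{0..s}. strict_tail \<mu> (u + b * (s - t)) \<partial>lborel)"
      using T integral_tail_eq_strict_tail_Min[where i=0 and n=0 and u="\<lambda>_. u" and s="\<lambda>_. s" and I="{0..s}"] by auto
    then show ?thesis using prob_esn_le[OF s order_refl, of u] by (simp add: M_def)
  qed
  show ?thesis
  proof (intro conjI allI impI ballI)
    fix n :: nat and s u :: "nat \<Rightarrow> real" and T
    assume "1 \<le> n"
      and s: "s 0 = 0 \<and> (\<forall>i<n. s i < s (Suc i)) \<and> (\<forall>i\<in>{1..n}. 0 \<le> u i)"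
      and T: "(T = tail \<mu> \<and> (b \<noteq> 0 \<or> (\<forall>i\<in>{1..n}. emeasure \<mu> {u i} = 0))) \<or> T = strict_tail \<mu>"
    have "(\<integral>\<^sup>+t\<in>{s (i - 1)..s i}. T (MIN j\<in>{i..n}. u j + b * (s j - t)) \<partial>lborel)
        = (\<integral>\<^sup>+t\<in>{s (i - 1)..s i}. strict_tail \<mu> (MIN j\<in>{i..n}. u j + b * (s j - t)) \<partial>lborel)"
      if i: "i \<in> {1..n}" for i
      using T
    proof
      assume "T = tail \<mu> \<and> (b \<noteq> 0 \<or> (\<forall>i\<in>{1..n}. emeasure \<mu> {u i} = 0))"
      then show ?thesis using i by (auto intro!: integral_tail_eq_strict_tail_Min)
    qed simp
    then show "\<P>(\<omega> in P. \<forall>i\<in>{1..n}. M 0 (s i) \<omega> \<le> u i)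
         = exp_minus (\<Sum>i=1..n. \<integral>\<^sup>+t\<in>{s (i - 1)..s i}.
                         T (MIN j\<in>{i..n}. u j + b * (s j - t)) \<partial>lborel)
           * (\<Prod>i=1..n. of_bool (u i \<ge> max 0 (- b * s i)))"
      using prob_esn0_finite_dimensional[OF \<open>1 \<le> n\<close>, of s u] s
      by (simp only: M_def cong: sum.cong)
  next
    fix s u :: real and T
    assume "0 \<le> s" "(T = tail \<mu> \<and> (b \<noteq> 0 \<or> emeasure \<mu> {u} = 0)) \<or> T = strict_tail \<mu>"
    then show "\<P>(\<omega> in P. M 0 s \<omega> \<le> u)
        = exp_minus (\<integral>\<^sup>+t\<in>{0..s}. T (u + b * (s - t)) \<partial>lborel) * of_bool (u \<ge> max 0 (- b * s))"
      by (rule one_dim)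
  next
    fix s u :: real assume s: "0 \<le> s" and b: "0 < b"
    have "0 \<le> b * s" using b s by simp
    then show "\<P>(\<omega> in P. M 0 s \<omega> \<le> u)
         = exp_minus ((\<integral>\<^sup>+y\<in>{u..u + b * s}. tail \<mu> y \<partial>lborel) / ennreal b)
           * of_bool (u \<ge> max 0 (- b * s))"
      using one_dim[OF s, of "strict_tail \<mu>" u] strict_tail_time_integral[OF _ s, of u] b
      by (simp add: min_absorb1 max_absorb2)
  next
    fix s u :: real assume s: "0 \<le> s" and b: "b < 0"
    have "b * s \<le> 0" using b s by (simp add: mult_le_0_iff)
    then show "\<P>(\<omega> in P. M 0 s \<omega> \<le> u)
         = exp_minus ((\<integral>\<^sup>+y\<in>{u + b * s..u}. tail \<mu> y \<partial>lborel) / ennreal (- b))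
           * of_bool (u \<ge> max 0 (- b * s))"
      using one_dim[OF s, of "strict_tail \<mu>" u] strict_tail_time_integral[OF _ s, of u] b
      by (simp add: min_absorb2 max_absorb1)
  next
    fix x t u :: real assume x: "0 \<le> x" and t: "0 \<le> t"
    have "max 0 (- b * t) \<le> u" if "max 0 (x - b * t) \<le> u" using that x by auto
    then show "\<P>(\<omega> in P. M x t \<omega> \<le> u) = \<P>(\<omega> in P. M 0 t \<omega> \<le> u) * of_bool (u \<ge> max 0 (x - b * t))"
      unfolding M_def prob_esn_le[OF t x] prob_esn_le[OF t order_refl]
      by (cases "max 0 (x - b * t) \<le> u") simp_all
  next
    show "markov_process P M" unfolding M_def by (rule markov_process_esn)
  next
    fix t f assume "0 \<le> (t::real)" "f \<in> C0"
    then show "transition_op P M t f \<in> C0" unfolding M_def by (rule transition_op_C0)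
  next
    fix f assume "f \<in> C0"
    then show "uniform_limit {0..} (\<lambda>t. transition_op P M t f) f (at_right 0)"
      unfolding M_def by (rule transition_op_uniform_limit)
  next
    fix s :: real assume "0 \<le> b" "0 < s"
    from prob_esn_eq_0_pos_iff[OF this]
    show "0 < \<P>(\<omega> in P. M 0 s \<omega> = 0) \<longleftrightarrow>
        (\<integral>\<^sup>+v\<in>{0..1}. tail \<mu> v \<partial>lborel) < \<infinity> \<and> (b = 0 \<longrightarrow> tail \<mu> 0 < \<infinity>)"
      unfolding M_def zero_criterion_def .
  next
    assume "0 \<le> b" "(\<integral>\<^sup>+v\<in>{0..1}. tail \<mu> v \<partial>lborel) < \<infinity> \<and> (b = 0 \<longrightarrow> tail \<mu> 0 < \<infinity>)"
    then show "AE \<omega> in P. 0 < emeasure lborel {t. 0 < t \<and> M 0 t \<omega> = 0}"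
      unfolding M_def zero_criterion_def[symmetric] by (rule AE_zero_set_positive)
  next
    fix x K :: real
    assume "b > 0 \<and> (\<integral>\<^sup>+v\<in>{1..}. tail \<mu> v \<partial>lborel) = \<infinity>" "0 \<le> x"
    then show "((\<lambda>s. \<P>(\<omega> in P. M x s \<omega> > K)) \<longlongrightarrow> 1) at_top"
      unfolding M_def by (blast intro: esn_tendsto_infinity_in_probability)
  next
    assume "b > 0 \<and> (\<integral>\<^sup>+v\<in>{1..}. tail \<mu> v \<partial>lborel) < \<infinity>"
    then have b: "0 < b" and fin: "(\<integral>\<^sup>+v\<in>{1..}. tail \<mu> v \<partial>lborel) < \<infinity>" by auto
    show "\<exists>p. stationary_distribution P M p \<and>
          (emeasure \<mu> {0<..} \<noteq> 0 \<longrightarrow> (\<forall>c\<ge>0. measure p {c} < 1)) \<and>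
          (\<forall>u\<ge>0. measure p {0..u}
             = exp_minus ((\<integral>\<^sup>+v\<in>{u..}. tail \<mu> v \<partial>lborel) / ennreal b)) \<and>
          (\<forall>x\<ge>0. ((\<lambda>t. d_TV (law_at P M x t) p) \<longlongrightarrow> 0) at_top) \<and>
          (\<forall>x\<ge>0. \<forall>t>x / b. ennreal (d_TV (law_at P M x t) p)
             \<le> (\<integral>\<^sup>+v\<in>{b * t..}. tail \<mu> v \<partial>lborel) / ennreal b)"
      unfolding M_def
      using stationary_distribution_stationary_law[OF b fin] stationary_law_nondegenerate[OF b fin]
        stationary_law_cdf[OF b fin] d_TV_stationary_law_tendsto[OF b fin] d_TV_stationary_law(2)[OF b fin]
      by (intro exI[of _ stationary_law] conjI allI impI)
  qed
qed

end
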